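(* Let $(M,g)$ be a Riemannian manifold with Levi-Civita connection $\nabla^g$ and curvature tensor $R^g(\overline X,\overline Y)\overline Z=\nabla^g_{\overline X}\nabla^g_{\overline Y}\overline Z-\nabla^g_{\overline Y}\nabla^g_{\overline X}\overline Z-\nabla^g_{[\overline X,\overline Y]}\overline Z$. Let $G=G_g$ be the associated graded metric on $\Omega(M)$, $U\in\Gamma(M,TM)$, $\omega\in\Omega^{\mathrm{odd}}(M)$, and let $R'$ be the curvature tensor of the semi-symmetric metric connection $\nabla'$ on $(M,\Omega(M),G_g)$ determined by $P=\omega L_U$. Then for all vector fields $\overline X,\overline Y,\overline Z$ on $M$: \begin{align*} R'(L_{\overline X},L_{\overline Y})L_{\overline Z}&=L_{R^g(\overline X,\overline Y)\overline Z}+L_{\overline X}(\omega)d(g(\overline Z,U))L_{\overline Y}+\omega d(g(\overline Z,\nabla^g_{\overline X}U))L_{\overline Y}\\ &\quad-L_{\overline Y}(\omega)d(g(\overline Z,U))L_{\overline X}-\omega d(g(\overline Z,\nabla^g_{\overline Y}U))L_{\overline X}-d(g(\overline Y,\overline Z))L_{\overline X}(\omega)L_U\\ &\quad-d(g(\overline Y,\overline Z))\omega L_{\nabla^g_{\overline X}U}+d(g(\overline X,\overline Z))L_{\overline Y}(\omega)L_U+d(g(\overline X,\overline Z))\omega L_{\nabla^g_{\overline Y}U},\\ R'(L_{\overline X},L_{\overline Y})i_{\overline Z}&=i_{R^g(\overline X,\overline Y)\overline Z}-L_{\overline X}(\omega)g(\overline Z,U)L_{\overline Y}-\omega g(\overline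 Z,\nabla^g_{\overline X}U)L_{\overline Y}\\ &\quad+L_{\overline Y}(\omega)g(\overline Z,U)L_{\overline X}+\omega g(\overline Z,\nabla^g_{\overline Y}U)L_{\overline X}-g(\overline Y,\overline Z)L_{\overline X}(\omega)L_U\\ &\quad-g(\overline Y,\overline Z)\omega L_{\nabla^g_{\overline X}U}+g(\overline X,\overline Z)L_{\overline Y}(\omega)L_U+g(\overline X,\overline Z)\omega L_{\nabla^g_{\overline Y}U},\\ R'(L_{\overline X},i_{\overline Y})L_{\overline Z}&=i_{R^g(\overline X,\overline Y)\overline Z}+L_{\overline X}(\omega)d(g(\overline Z,U))i_{\overline Y}+\omega d(g(\overline Z,\nabla^g_{\overline X}U))i_{\overline Y}\\ &\quad-i_{\overline Y}(\omega)d(g(\overline Z,U))L_{\overline X}+\omega g(\overline Z,\nabla^g_{\overline Y}U)L_{\overline X}-g(\overline Y,\overline Z)L_{\overline X}(\omega)L_U\\ &\quad-g(\overline Y,\overline Z)\omega L_{\nabla^g_{\overline X}U}-d(g(\overline X,\overline Z))i_{\overline Y}(\omega)L_U+d(g(\overline X,\overline Z))\omega i_{\nabla^g_{\overline Y}U},\\ R'(L_{\overline X},i_{\overline Y})i_{\overline Z}&=L_{\overline X}(\omega)g(\overline Z,U)i_{\overline Y}+\omega g(\overline Z,\nabla^g_{\overline X}U)i_{\overline Y}+i_{\overline Y}(\omega)g(\overline Z,U)L_{\overline X}\\ &\quad+g(\overline X,\overline Z)i_{\overline Y}(\omega)L_U-g(\overline X,\overline Z)\omega i_{\nabla^g_{\overline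 Y}U},\\ R'(i_{\overline X},i_{\overline Y})L_{\overline Z}&=i_{\overline X}(\omega)d(g(\overline Z,U))i_{\overline Y}-\omega g(\overline Z,\nabla^g_{\overline X}U)i_{\overline Y}+i_{\overline Y}(\omega)d(g(\overline Z,U))i_{\overline X}\\ &\quad-\omega g(\overline Z,\nabla^g_{\overline Y}U)i_{\overline X}-g(\overline Y,\overline Z)i_{\overline X}(\omega)L_U+g(\overline Y,\overline Z)\omega i_{\nabla^g_{\overline X}U}\\ &\quad-g(\overline X,\overline Z)i_{\overline Y}(\omega)L_U+g(\overline X,\overline Z)\omega i_{\nabla^g_{\overline Y}U},\\ R'(i_{\overline X},i_{\overline Y})i_{\overline Z}&=i_{\overline X}(\omega)g(\overline Z,U)i_{\overline Y}+i_{\overline Y}(\omega)g(\overline Z,U)i_{\overline X}. \end{align*}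
   Context: Let $M$ be a smooth $m$-dimensional manifold, $\Omega(M)$ its $\mathbb Z_2$-graded commutative algebra of differential forms (products are wedge products), and $\mathrm{Der}\,\Omega(M)$ the graded left $\Omega(M)$-module of graded derivations of $\Omega(M)$, with graded commutator $[X,Y]=XY-(-1)^{|X||Y|}YX$; it is also a right module via $X\cdot\alpha=(-1)^{|\alpha||X|}\alpha X$. All elements appearing in formulas with signs are homogeneous. For a vector field $\overline X$ on $M$, $L_{\overline X}$ (even) is the Lie derivative and $i_{\overline X}$ (odd) is the interior product; $L_{\overline X}(\omega)$, $i_{\overline X}(\omega)$ denote their values on a form $\omega$. For a local frame $\{\overline X_k\}$ of $TM$, $\{L_{\overline X_k},i_{\overline X_k}\}$ is a local frame of $\mathrm{Der}\,\Omega(M)$. A graded metric is a map $G:(X,Y)\mapsto\langle X,Y;G\rangle\in\Omega(M)$ on $\mathrm{Der}\,\Omega(M)$ that is biadditive, satisfies $\langle X,Y;G\rangle=(-1)^{|X||Y|}\langle Y,X;G\rangle$ and $\langle\alpha X,Y;G\rangle=\alpha\langle X,Y;G\rangle=(-1)^{|X||\alpha|}\langle X,\alpha Y;G\rangle$, and is non-degenerate ($X\mapsto\langle\cdot,X;G\rangle$ is an isomorphism onto $\mathrm{Hom}(\mathrm{Der}\,\Omega(M),\Omega(M))$). It has parity $|G|$ if $|\langle X,Y;G\rangle|=|X|+|Y|+|G|$ mod 2. For a Riemannian metric $g$, the odd graded metric $G_g$ is determined by $\langle L_{\overline X},L_{\overline Y};G_g\rangle=d(g(\overline X,\overline Y))$,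 $\langle L_{\overline X},i_{\overline Y};G_g\rangle=\langle i_{\overline X},L_{\overline Y};G_g\rangle=g(\overline X,\overline Y)$, $\langle i_{\overline X},i_{\overline Y};G_g\rangle=0$. A graded connection is a $\mathbb Z_2$-degree preserving biadditive map $\nabla:\mathrm{Der}\,\Omega(M)\times\mathrm{Der}\,\Omega(M)\to\mathrm{Der}\,\Omega(M)$ with $\nabla_{\alpha X}Y=\alpha\nabla_XY$ and $\nabla_X(\alpha Y)=X(\alpha)Y+(-1)^{|X||\alpha|}\alpha\nabla_XY$. Its curvature tensor is $R_\nabla(X,Y)Z=\nabla_X\nabla_YZ-(-1)^{|X||Y|}\nabla_Y\nabla_XZ-\nabla_{[X,Y]}Z$. The graded Levi-Civita connection $\nabla^L$ of $G$ is the unique graded connection that is torsion free ($\nabla^L_XY-(-1)^{|X||Y|}\nabla^L_YX=[X,Y]$) and metric ($X\langle Y,Z;G\rangle=\langle\nabla^L_XY,Z;G\rangle+(-1)^{|X||Y|}\langle Y,\nabla^L_XZ;G\rangle$). For $G=G_g$ it satisfies $\nabla^L_{L_{\overline X}}L_{\overline Y}=L_{\nabla^g_{\overline X}\overline Y}$, $\nabla^L_{L_{\overline X}}i_{\overline Y}=\nabla^L_{i_{\overline X}}L_{\overline Y}=i_{\nabla^g_{\overline X}\overline Y}$, $\nabla^L_{i_{\overline X}}i_{\overline Y}=0$. For $P\in\mathrm{Der}\,\Omega(M)$ with $|P|+|G|=0$ mod 2, the semi-symmetric metric connection determined by $P$ is $\nabla_XY=\nabla^L_XY+X\cdot\langle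 Y,P;G\rangle-\langle X,Y;G\rangle P$. *)

theory Defs
  imports "HOL-Analysis.Analysis" "HOL-Library.Function_Algebras"
begin

section \<open>Smooth manifolds\<close>

text \<open>
  Sums, differences and negatives of functions, vector fields, forms and derivations are the
  pointwise ones of the theory \<^verbatim>\<open>Function_Algebras\<close>, and \<open>0\<close> is the zero function.
  All algebraic objects (tangent vectors, forms, derivations) are made extensional by the
  value \<open>0\<close> outside their domain, so that HOL equality is the intended equality.
\<close>

text \<open>Only meant for open \<^term>\<open>S\<close>.\<close>

primrec Ck_on :: "nat \<Rightarrow> 'a::real_normed_vector set \<Rightarrow> ('a \<Rightarrow> 'b::real_normed_vector) \<Rightarrow> bool" where
  "Ck_on 0 S f \<longleftrightarrow> continuous_on S f"
| "Ck_on (Suc k) S f \<longleftrightarrow>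
     (\<forall>x\<in>S. f differentiable (at x)) \<and> (\<forall>v. Ck_on k S (\<lambda>x. frechet_derivative f (at x) v))"

definition smooth_on :: "'a::real_normed_vector set \<Rightarrow> ('a \<Rightarrow> 'b::real_normed_vector) \<Rightarrow> bool" where
  "smooth_on S f \<longleftrightarrow> (\<forall>k. Ck_on k S f)"

type_synonym ('p, 'e) atlas = "('p set \<times> ('p \<Rightarrow> 'e)) set"

text \<open>
  The underlying space is the whole type \<^typ>\<open>'p\<close>; the dimension is \<open>DIM('e)\<close>. The atlas
  need not be maximal: it determines the same smooth functions as its maximal extension.
\<close>

definition smooth_manifold ::
  "('p::{t2_space, second_countable_topology}, 'e::euclidean_space) atlas \<Rightarrow> bool" where
  "smooth_manifold A \<longleftrightarrow>
     (\<forall>(W, \<phi>)\<in>A. open W \<and> open (\<phi> ` W) \<and> homeomorphism W (\<phi> ` W) \<phi> (inv_into W \<phi>)) \<and>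
     (\<Union>(W, \<phi>)\<in>A. W) = UNIV \<and>
     (\<forall>(W, \<phi>)\<in>A. \<forall>(V, \<psi>)\<in>A. smooth_on (\<phi> ` (W \<inter> V)) (\<psi> \<circ> inv_into W \<phi>))"

definition smooth_functions :: "('p, 'e::euclidean_space) atlas \<Rightarrow> ('p \<Rightarrow> real) set" where
  "smooth_functions A = {f. \<forall>(W, \<phi>)\<in>A. smooth_on (\<phi> ` W) (f \<circ> inv_into W \<phi>)}"


section \<open>Vector fields and Riemannian metrics\<close>

type_synonym 'p tvec = "('p \<Rightarrow> real) \<Rightarrow> real"
type_synonym 'p vfield = "'p \<Rightarrow> 'p tvec"

definition tangent_space :: "('p, 'e::euclidean_space) atlas \<Rightarrow> 'p \<Rightarrow> 'p tvec set" where
  "tangent_space A p = {v.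
     (\<forall>f\<in>smooth_functions A. \<forall>h\<in>smooth_functions A. v (f + h) = v f + v h) \<and>
     (\<forall>c. \<forall>f\<in>smooth_functions A. v (\<lambda>q. c * f q) = c * v f) \<and>
     (\<forall>f\<in>smooth_functions A. \<forall>h\<in>smooth_functions A. v (f * h) = v f * h p + f p * v h) \<and>
     (\<forall>f. f \<notin> smooth_functions A \<longrightarrow> v f = 0)}"

definition vfields :: "('p, 'e::euclidean_space) atlas \<Rightarrow> 'p vfield set" where
  "vfields A = {X. (\<forall>p. X p \<in> tangent_space A p) \<and>
     (\<forall>f\<in>smooth_functions A. (\<lambda>p. X p f) \<in> smooth_functions A)}"

definition vscale :: "('p \<Rightarrow> real) \<Rightarrow> 'p vfield \<Rightarrow> 'p vfield" where
  "vscale f X = (\<lambda>p h. f p * X p h)"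

definition vbracket :: "'p vfield \<Rightarrow> 'p vfield \<Rightarrow> 'p vfield" where
  "vbracket X Y = (\<lambda>p f. X p (\<lambda>q. Y q f) - Y p (\<lambda>q. X q f))"

definition riemannian_metric ::
  "('p, 'e::euclidean_space) atlas \<Rightarrow> ('p \<Rightarrow> 'p tvec \<Rightarrow> 'p tvec \<Rightarrow> real) \<Rightarrow> bool" where
  "riemannian_metric A g \<longleftrightarrow>
     (\<forall>p. \<forall>u\<in>tangent_space A p. \<forall>v\<in>tangent_space A p. \<forall>w\<in>tangent_space A p. \<forall>c.
        g p u v = g p v u \<and> g p (u + v) w = g p u w + g p v w \<and>
        g p (\<lambda>f. c * u f) v = c * g p u v \<and> (u \<noteq> 0 \<longrightarrow> g p u u > 0)) \<and>
     (\<forall>X\<in>vfields A. \<forall>Y\<in>vfields A. (\<lambda>p. g p (X p) (Y p)) \<in> smooth_functions A)"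

definition levi_civita ::
  "('p, 'e::euclidean_space) atlas \<Rightarrow> ('p \<Rightarrow> 'p tvec \<Rightarrow> 'p tvec \<Rightarrow> real)
     \<Rightarrow> ('p vfield \<Rightarrow> 'p vfield \<Rightarrow> 'p vfield) \<Rightarrow> bool" where
  "levi_civita A g nab \<longleftrightarrow>
     (\<forall>X\<in>vfields A. \<forall>Y\<in>vfields A. nab X Y \<in> vfields A) \<and>
     (\<forall>X\<in>vfields A. \<forall>Y\<in>vfields A. \<forall>Z\<in>vfields A.
        nab (X + Y) Z = nab X Z + nab Y Z \<and> nab X (Y + Z) = nab X Y + nab X Z) \<and>
     (\<forall>f\<in>smooth_functions A. \<forall>X\<in>vfields A. \<forall>Y\<in>vfields A.
        nab (vscale f X) Y = vscale f (nab X Y) \<and>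
        nab X (vscale f Y) = vscale (\<lambda>p. X p f) Y + vscale f (nab X Y)) \<and>
     (\<forall>X\<in>vfields A. \<forall>Y\<in>vfields A. nab X Y - nab Y X = vbracket X Y) \<and>
     (\<forall>X\<in>vfields A. \<forall>Y\<in>vfields A. \<forall>Z\<in>vfields A. \<forall>p.
        X p (\<lambda>q. g q (Y q) (Z q)) = g p (nab X Y p) (Z p) + g p (Y p) (nab X Z p))"

definition curvature ::
  "('p vfield \<Rightarrow> 'p vfield \<Rightarrow> 'p vfield) \<Rightarrow> 'p vfield \<Rightarrow> 'p vfield \<Rightarrow> 'p vfield \<Rightarrow> 'p vfield" where
  "curvature nab X Y Z = nab X (nab Y Z) - nab Y (nab X Z) - nab (vbracket X Y) Z"


section \<open>Differential forms\<close>

text \<open>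
  A \<open>k\<close>-form is an alternating \<open>k\<close>-linear map on vector fields over the ring of smooth
  functions. A possibly inhomogeneous form is one function \<^term>\<open>\<omega>\<close> on lists of vector fields
  of arbitrary length, whose restriction to lists of length \<open>k\<close> is its component of degree
  \<open>k\<close>; the empty list gives the function component. Only finitely many components are nonzero.
\<close>

type_synonym 'p form = "'p vfield list \<Rightarrow> 'p \<Rightarrow> real"

definition forms :: "('p, 'e::euclidean_space) atlas \<Rightarrow> 'p form set" where
  "forms A = {\<omega>.
     (\<forall>Xs\<in>lists (vfields A). \<omega> Xs \<in> smooth_functions A) \<and>
     (\<forall>Xs. Xs \<notin> lists (vfields A) \<longrightarrow> \<omega> Xs = 0) \<and>
     (\<forall>Xs\<in>lists (vfields A). \<forall>Ys\<in>lists (vfields A). \<forall>X\<in>vfields A. \<forall>Y\<in>vfields A.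
        \<omega> (Xs @ (X + Y) # Ys) = \<omega> (Xs @ X # Ys) + \<omega> (Xs @ Y # Ys)) \<and>
     (\<forall>Xs\<in>lists (vfields A). \<forall>Ys\<in>lists (vfields A). \<forall>X\<in>vfields A. \<forall>f\<in>smooth_functions A.
        \<omega> (Xs @ vscale f X # Ys) = f * \<omega> (Xs @ X # Ys)) \<and>
     (\<forall>Xs\<in>lists (vfields A). \<forall>Ys\<in>lists (vfields A). \<forall>Zs\<in>lists (vfields A). \<forall>X\<in>vfields A.
        \<omega> (Xs @ X # Ys @ X # Zs) = 0) \<and>
     (\<exists>N. \<forall>Xs. length Xs > N \<longrightarrow> \<omega> Xs = 0)}"

text \<open>
  Parities are natural numbers read modulo 2, so that parities can be added. The submodule of
  forms of parity \<^term>\<open>a\<close>, and the projection to it: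
\<close>

definition pforms :: "('p, 'e::euclidean_space) atlas \<Rightarrow> nat \<Rightarrow> 'p form set" where
  "pforms A a = {\<omega>\<in>forms A. \<forall>Xs. odd (length Xs + a) \<longrightarrow> \<omega> Xs = 0}"

definition fpart :: "nat \<Rightarrow> 'p form \<Rightarrow> 'p form" where
  "fpart a \<omega> = (\<lambda>Xs. if even (length Xs + a) then \<omega> Xs else 0)"

definition func_form :: "('p \<Rightarrow> real) \<Rightarrow> 'p form" where
  "func_form f = (\<lambda>Xs. if Xs = [] then f else 0)"

text \<open>
  The usual sum over shuffles: a shuffle is given by the set \<^term>\<open>S\<close> of the positions of the
  arguments of the first factor; all degrees of the two factors are covered at once.
\<close>

definition shuffle_sign :: "nat \<Rightarrow> nat set \<Rightarrow> real" where
  "shuffle_sign n S = (-1) ^ card {(i, j). i < j \<and> j < n \<and> i \<notin> S \<and> j \<in> S}"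

definition wedge :: "'p form \<Rightarrow> 'p form \<Rightarrow> 'p form"  (infixr "\<^bold>\<and>" 75) where
  "\<alpha> \<^bold>\<and> \<beta> = (\<lambda>Xs p. \<Sum>S\<in>Pow {..<length Xs}.
     shuffle_sign (length Xs) S * \<alpha> (nths Xs S) p * \<beta> (nths Xs (- S)) p)"

definition ext_deriv :: "('p, 'e::euclidean_space) atlas \<Rightarrow> 'p form \<Rightarrow> 'p form" where
  "ext_deriv A \<omega> = (\<lambda>Xs p. if Xs \<in> lists (vfields A) then
       (\<Sum>i<length Xs. (-1) ^ i * (Xs ! i) p (\<omega> (nths Xs (- {i})))) +
       (\<Sum>j<length Xs. \<Sum>i<j.
          (-1) ^ (i + j) * \<omega> (vbracket (Xs ! i) (Xs ! j) # nths Xs (- {i, j})) p)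
     else 0)"


section \<open>Graded derivations\<close>

type_synonym 'p der = "'p form \<Rightarrow> 'p form"

definition pders :: "('p, 'e::euclidean_space) atlas \<Rightarrow> nat \<Rightarrow> 'p der set" where
  "pders A a = {D.
     (\<forall>b. \<forall>\<alpha>\<in>pforms A b. D \<alpha> \<in> pforms A (a + b)) \<and>
     (\<forall>\<alpha>\<in>forms A. \<forall>\<beta>\<in>forms A. D (\<alpha> + \<beta>) = D \<alpha> + D \<beta>) \<and>
     (\<forall>c. \<forall>\<alpha>\<in>forms A. D (\<lambda>Xs p. c * \<alpha> Xs p) = (\<lambda>Xs p. c * D \<alpha> Xs p)) \<and>
     (\<forall>b. \<forall>\<alpha>\<in>pforms A b. \<forall>\<beta>\<in>forms A.
        D (\<alpha> \<^bold>\<and> \<beta>) = D \<alpha> \<^bold>\<and> \<beta> + (if even (a * b) then \<alpha> \<^bold>\<and> D \<beta> else - (\<alpha> \<^bold>\<and> D \<beta>))) \<and>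
     (\<forall>\<alpha>. \<alpha> \<notin> forms A \<longrightarrow> D \<alpha> = 0)}"

definition ders :: "('p, 'e::euclidean_space) atlas \<Rightarrow> 'p der set" where
  "ders A = {D + E | D E. D \<in> pders A 0 \<and> E \<in> pders A 1}"

definition dpart :: "('p, 'e::euclidean_space) atlas \<Rightarrow> nat \<Rightarrow> 'p der \<Rightarrow> 'p der" where
  "dpart A a D = (\<lambda>\<alpha>. if \<alpha> \<in> forms A then \<Sum>b<2. fpart (a + b) (D (fpart b \<alpha>)) else 0)"

definition ksign :: "nat \<Rightarrow> 'a::ab_group_add \<Rightarrow> 'a" where
  "ksign n x = (if even n then x else - x)"

definition lmult :: "'p form \<Rightarrow> 'p der \<Rightarrow> 'p der"  (infixr "\<cdot>" 70) where
  "\<alpha> \<cdot> D = (\<lambda>\<beta>. \<alpha> \<^bold>\<and> D \<beta>)"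

text \<open>
  The right multiplication, the graded commutator and the curvature are given by sign formulas
  for homogeneous arguments; here they are defined on all arguments, as the biadditive
  extensions of these formulas, by summing over the homogeneous parts.
\<close>

definition rmult :: "('p, 'e::euclidean_space) atlas \<Rightarrow> 'p der \<Rightarrow> 'p form \<Rightarrow> 'p der" where
  "rmult A X \<alpha> = (\<Sum>a<2. \<Sum>b<2. ksign (a * b) (fpart b \<alpha> \<cdot> dpart A a X))"

definition gcommutator :: "('p, 'e::euclidean_space) atlas \<Rightarrow> 'p der \<Rightarrow> 'p der \<Rightarrow> 'p der" where
  "gcommutator A X Y = (\<Sum>a<2. \<Sum>b<2.
     (dpart A a X \<circ> dpart A b Y) - ksign (a * b) (dpart A b Y \<circ> dpart A a X))"

definition lie_der :: "('p, 'e::euclidean_space) atlas \<Rightarrow> 'p vfield \<Rightarrow> 'p der" where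
  "lie_der A X = (\<lambda>\<omega>. if \<omega> \<in> forms A then
       (\<lambda>Xs p. if Xs \<in> lists (vfields A) then
          X p (\<omega> Xs) - (\<Sum>i<length Xs. \<omega> (Xs[i := vbracket X (Xs ! i)]) p)
        else 0)
     else 0)"

definition int_prod :: "('p, 'e::euclidean_space) atlas \<Rightarrow> 'p vfield \<Rightarrow> 'p der" where
  "int_prod A X = (\<lambda>\<omega>. if \<omega> \<in> forms A then (\<lambda>Xs. \<omega> (X # Xs)) else 0)"


section \<open>Graded metrics and connections\<close>

definition graded_hom :: "('p, 'e::euclidean_space) atlas \<Rightarrow> ('p der \<Rightarrow> 'p form) set" where
  "graded_hom A = {F.
     (\<forall>X\<in>ders A. F X \<in> forms A) \<and>
     (\<forall>X\<in>ders A. \<forall>Y\<in>ders A. F (X + Y) = F X + F Y) \<and>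
     (\<forall>\<alpha>\<in>forms A. \<forall>X\<in>ders A. F (\<alpha> \<cdot> X) = \<alpha> \<^bold>\<and> F X)}"

text \<open>
  The last clause is non-degeneracy. The map \<^term>\<open>\<lambda>Y. (\<lambda>X. G X Y)\<close> takes values in
  \<^term>\<open>graded_hom A\<close> and is additive by the preceding clauses.
\<close>

definition graded_metric ::
  "('p, 'e::euclidean_space) atlas \<Rightarrow> ('p der \<Rightarrow> 'p der \<Rightarrow> 'p form) \<Rightarrow> bool" where
  "graded_metric A G \<longleftrightarrow>
     (\<forall>X\<in>ders A. \<forall>Y\<in>ders A. G X Y \<in> forms A) \<and>
     (\<forall>X\<in>ders A. \<forall>Y\<in>ders A. \<forall>Z\<in>ders A.
        G (X + Y) Z = G X Z + G Y Z \<and> G X (Y + Z) = G X Y + G X Z) \<and>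
     (\<forall>a b. \<forall>X\<in>pders A a. \<forall>Y\<in>pders A b. G X Y = ksign (a * b) (G Y X)) \<and>
     (\<forall>a b c. \<forall>\<alpha>\<in>pforms A a. \<forall>X\<in>pders A b. \<forall>Y\<in>pders A c.
        G (\<alpha> \<cdot> X) Y = \<alpha> \<^bold>\<and> G X Y \<and> \<alpha> \<^bold>\<and> G X Y = ksign (b * a) (G X (\<alpha> \<cdot> Y))) \<and>
     (\<forall>F\<in>graded_hom A. \<exists>!Y. Y \<in> ders A \<and> (\<forall>X\<in>ders A. G X Y = F X))"

definition metric_parity ::
  "('p, 'e::euclidean_space) atlas \<Rightarrow> ('p der \<Rightarrow> 'p der \<Rightarrow> 'p form) \<Rightarrow> nat \<Rightarrow> bool" where
  "metric_parity A G c \<longleftrightarrow>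
     (\<forall>a b. \<forall>X\<in>pders A a. \<forall>Y\<in>pders A b. G X Y \<in> pforms A (a + b + c))"

definition metric_form ::
  "('p \<Rightarrow> 'p tvec \<Rightarrow> 'p tvec \<Rightarrow> real) \<Rightarrow> 'p vfield \<Rightarrow> 'p vfield \<Rightarrow> 'p form" where
  "metric_form g X Y = func_form (\<lambda>p. g p (X p) (Y p))"

definition associated_graded_metric ::
  "('p, 'e::euclidean_space) atlas \<Rightarrow> ('p \<Rightarrow> 'p tvec \<Rightarrow> 'p tvec \<Rightarrow> real)
     \<Rightarrow> ('p der \<Rightarrow> 'p der \<Rightarrow> 'p form) \<Rightarrow> bool" where
  "associated_graded_metric A g G \<longleftrightarrow> graded_metric A G \<and> metric_parity A G 1 \<and>
     (\<forall>X\<in>vfields A. \<forall>Y\<in>vfields A.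
        G (lie_der A X) (lie_der A Y) = ext_deriv A (metric_form g X Y) \<and>
        G (lie_der A X) (int_prod A Y) = metric_form g X Y \<and>
        G (int_prod A X) (lie_der A Y) = metric_form g X Y \<and>
        G (int_prod A X) (int_prod A Y) = 0)"

definition graded_connection ::
  "('p, 'e::euclidean_space) atlas \<Rightarrow> ('p der \<Rightarrow> 'p der \<Rightarrow> 'p der) \<Rightarrow> bool" where
  "graded_connection A nab \<longleftrightarrow>
     (\<forall>a b. \<forall>X\<in>pders A a. \<forall>Y\<in>pders A b. nab X Y \<in> pders A (a + b)) \<and>
     (\<forall>X\<in>ders A. \<forall>Y\<in>ders A. \<forall>Z\<in>ders A.
        nab (X + Y) Z = nab X Z + nab Y Z \<and> nab X (Y + Z) = nab X Y + nab X Z) \<and>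
     (\<forall>\<alpha>\<in>forms A. \<forall>X\<in>ders A. \<forall>Y\<in>ders A. nab (\<alpha> \<cdot> X) Y = \<alpha> \<cdot> nab X Y) \<and>
     (\<forall>a b. \<forall>\<alpha>\<in>pforms A a. \<forall>X\<in>pders A b. \<forall>Y\<in>ders A.
        nab X (\<alpha> \<cdot> Y) = X \<alpha> \<cdot> Y + ksign (b * a) (\<alpha> \<cdot> nab X Y))"

definition graded_levi_civita ::
  "('p, 'e::euclidean_space) atlas \<Rightarrow> ('p der \<Rightarrow> 'p der \<Rightarrow> 'p form)
     \<Rightarrow> ('p der \<Rightarrow> 'p der \<Rightarrow> 'p der) \<Rightarrow> bool" where
  "graded_levi_civita A G nab \<longleftrightarrow> graded_connection A nab \<and>
     (\<forall>a b. \<forall>X\<in>pders A a. \<forall>Y\<in>pders A b.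
        nab X Y - ksign (a * b) (nab Y X) = gcommutator A X Y) \<and>
     (\<forall>a b. \<forall>X\<in>pders A a. \<forall>Y\<in>pders A b. \<forall>Z\<in>ders A.
        X (G Y Z) = G (nab X Y) Z + ksign (a * b) (G Y (nab X Z)))"

definition semi_symmetric_connection ::
  "('p, 'e::euclidean_space) atlas \<Rightarrow> ('p der \<Rightarrow> 'p der \<Rightarrow> 'p form)
     \<Rightarrow> ('p der \<Rightarrow> 'p der \<Rightarrow> 'p der) \<Rightarrow> 'p der \<Rightarrow> 'p der \<Rightarrow> 'p der \<Rightarrow> 'p der" where
  "semi_symmetric_connection A G nabL P X Y = nabL X Y + rmult A X (G Y P) - G X Y \<cdot> P"

definition graded_curvature ::
  "('p, 'e::euclidean_space) atlas \<Rightarrow> ('p der \<Rightarrow> 'p der \<Rightarrow> 'p der)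
     \<Rightarrow> 'p der \<Rightarrow> 'p der \<Rightarrow> 'p der \<Rightarrow> 'p der" where
  "graded_curvature A nab X Y Z =
     (\<Sum>a<2. \<Sum>b<2. nab (dpart A a X) (nab (dpart A b Y) Z)
        - ksign (a * b) (nab (dpart A b Y) (nab (dpart A a X) Z)))
     - nab (gcommutator A X Y) Z"

end

theory Submission
  imports Defs
begin

text \<open>
  Write \<open>e\<^sub>0 X = L\<^sub>X\<close>, \<open>e\<^sub>1 X = i\<^sub>X\<close>, \<open>e\<^sub>n X = 0\<close> for \<open>n \<ge> 2\<close>, and for a function \<open>f\<close> write
  \<open>m\<^sub>0 f = df\<close>, \<open>m\<^sub>1 f = f\<close>, \<open>m\<^sub>n f = 0\<close> for \<open>n \<ge> 2\<close>. Then \<open>[e\<^sub>a X, e\<^sub>b Y] = e\<^sub>a\<^sub>+\<^sub>b [X, Y]\<close>,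
  \<open>\<langle>e\<^sub>a X, e\<^sub>b Y\<rangle> = m\<^sub>a\<^sub>+\<^sub>b (g(X, Y))\<close> and \<open>e\<^sub>a X (m\<^sub>b f) = m\<^sub>a\<^sub>+\<^sub>b (X f)\<close>, so that the graded geometry of
  \<open>G\<^sub>g\<close> is Riemannian geometry with indices added, and Koszul's argument gives
  \<open>\<nabla>\<^sup>L (e\<^sub>a X) (e\<^sub>b Y) = e\<^sub>a\<^sub>+\<^sub>b (\<nabla>\<^sup>g\<^sub>X Y)\<close>. The argument needs that a derivation orthogonal to all \<open>e\<^sub>a X\<close>
  vanishes; by non-degeneracy this reduces to the fact that, near a point, every derivation is a
  combination of Lie derivatives and interior products, which uses bump functions and Hadamard's
  lemma in a chart. Finally, since \<open>\<omega> \<and> \<omega> = 0\<close>, all terms quadratic in \<open>P\<close> drop out of \<open>R'\<close>, and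
  one general formula for \<open>R'(X, Y) Z\<close> on homogeneous arguments specializes to the six cases.
\<close>

section \<open>Smooth functions on open sets\<close>

text \<open>Locality is replaced by clearing denominators: a local frame is a global identity in
  which a function \<kappa> with \<kappa> p \<noteq> 0 stands where 1 would stand. A local statement
  near p thus becomes a global one multiplied by a power of \<kappa>, and the factor is cancelled
  pointwise. Euler's identity for such a frame lowers the degree of a form; this replaces writing a
  form as a sum of products of functions and differentials. The convention that indices n \<ge> 2
  give 0 is what makes the analogy with Riemannian geometry exact: the sign (-1)^(ab) is -1 only if
  a + b \<ge> 2, where the terms that it multiplies vanish. Koszul's argument therefore meets the
  same identities as in the ungraded case.\<close>

lemma Ck_on_cong:
  assumes "open S" "\<And>x. x \<in> S \<Longrightarrow> f x = g x"
  shows "Ck_on k S f \<longleftrightarrow> Ck_on k S g"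
proof -
  have *: "Ck_on k S g" if "Ck_on k S f" "\<And>x. x \<in> S \<Longrightarrow> f x = g x" for f g :: "'a \<Rightarrow> 'b"
    using that
  proof (induction k arbitrary: f g)
    case 0
    then show ?case by (simp cong: continuous_on_cong)
  next
    case (Suc k)
    \<comment> \<open>A derivative at x sees a whole neighbourhood of x; as S is open, f and g agree
      on one.\<close>
    have der: "(g has_derivative frechet_derivative f (at x)) (at x)" if "x \<in> S" for x
      using Suc.prems that assms(1)
      by (auto intro: has_derivative_transform_within_open simp: frechet_derivative_works)
    then have eq: "frechet_derivative g (at x) = frechet_derivative f (at x)" if "x \<in> S" for x
      using that by (metis frechet_derivative_at)
    have "Ck_on k S (\<lambda>x. frechet_derivative g (at x) v)" for v
    proof (rule Suc.IH)
      show "Ck_on k S (\<lambda>x. frechet_derivative f (at x) v)" using Suc.prems(1) by simp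
    qed (simp add: eq)
    then show ?case using der by (auto simp: differentiable_def)
  qed
  show ?thesis using *[of f g] *[of g f] assms(2) by auto
qed

lemma Ck_on_has_derivative:
  "Ck_on (Suc k) S f \<Longrightarrow> x \<in> S \<Longrightarrow> (f has_derivative frechet_derivative f (at x)) (at x)"
  by (simp add: frechet_derivative_works)

text \<open>Lets an explicit family \<open>f'\<close> stand in for
  \<open>frechet_derivative\<close>, so that the differentiation rules apply directly in inductions
  on k.\<close>

lemma Ck_on_SucI:
  assumes "open S" "\<And>x. x \<in> S \<Longrightarrow> (f has_derivative f' x) (at x)"
    "\<And>v. Ck_on k S (\<lambda>x. f' x v)"
  shows "Ck_on (Suc k) S f"
proof -
  have "frechet_derivative f (at x) = f' x" if "x \<in> S" for x
    using frechet_derivative_at[OF assms(2)[OF that]] by simp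
  then have "Ck_on k S (\<lambda>x. frechet_derivative f (at x) v)" for v
    using assms(3)[of v] Ck_on_cong[OF assms(1), of "\<lambda>x. frechet_derivative f (at x) v"] by simp
  then show ?thesis using assms(2) by (auto simp: differentiable_def)
qed

lemma Ck_on_subset: "Ck_on k S f \<Longrightarrow> T \<subseteq> S \<Longrightarrow> Ck_on k T f"
  by (induction k arbitrary: f) (auto intro: continuous_on_subset)

lemma Ck_on_Suc_imp: "Ck_on (Suc k) S f \<Longrightarrow> Ck_on k S f"
proof (induction k arbitrary: f)
  case 0
  then show ?case
    by (auto intro!: continuous_at_imp_continuous_on differentiable_imp_continuous_within)
next
  case (Suc k)
  then show ?case by (metis Ck_on.simps(2))
qed

lemma Ck_on_local:
  assumes "\<And>x. x \<in> S \<Longrightarrow> \<exists>T. open T \<and> x \<in> T \<and> Ck_on k T f"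
  shows "Ck_on k S f"
  using assms
proof (induction k arbitrary: f)
  case 0
  then show ?case
    by (auto intro!: continuous_at_imp_continuous_on simp: continuous_on_eq_continuous_at) 
      (metis continuous_on_eq_continuous_at)
next
  case (Suc k)
  have "Ck_on k S (\<lambda>x. frechet_derivative f (at x) v)" for v
    using Suc.prems by (intro Suc.IH) (metis Ck_on.simps(2))
  then show ?case using Suc.prems by auto
qed

lemma Ck_on_const: "Ck_on k S (\<lambda>x. c)"
  by (induction k arbitrary: c) auto

lemma Ck_on_add:
  assumes "open S" "Ck_on k S f" "Ck_on k S g"
  shows "Ck_on k S (\<lambda>x. f x + g x)"
  using assms(2,3)
proof (induction k arbitrary: f g)
  case 0
  then show ?case by (auto intro: continuous_on_add)
next
  case (Suc k)
  show ?case
    using Suc.prems Suc.IH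
    by (intro Ck_on_SucI[OF assms(1), where f' = "\<lambda>x v. frechet_derivative f (at x) v + frechet_derivative g (at x) v"])
      (auto simp del: Ck_on.simps intro!: has_derivative_add Ck_on_has_derivative, auto)
qed

lemma Ck_on_linear:
  assumes "bounded_linear l" "open S" "Ck_on k S f"
  shows "Ck_on k S (\<lambda>x. l (f x))"
  using assms(3)
proof (induction k arbitrary: f)
  case 0
  then show ?case using assms(1) by (auto intro: bounded_linear.continuous_on)
next
  case (Suc k)
  show ?case
    using Suc.prems Suc.IH
    by (intro Ck_on_SucI[OF assms(2), where f' = "\<lambda>x v. l (frechet_derivative f (at x) v)"])
      (auto simp del: Ck_on.simps intro!: bounded_linear.has_derivative[OF assms(1)] Ck_on_has_derivative, auto)
qed

lemma Ck_on_mult: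
  fixes f g :: "'a::real_normed_vector \<Rightarrow> real"
  assumes "open S" "Ck_on k S f" "Ck_on k S g"
  shows "Ck_on k S (\<lambda>x. f x * g x)"
  using assms(2,3)
proof (induction k arbitrary: f g)
  case 0
  then show ?case by (auto intro: continuous_on_mult)
next
  case (Suc k)
  have fg: "Ck_on k S f" "Ck_on k S g"
    using Suc.prems Ck_on_Suc_imp by blast+
  show ?case
  proof (rule Ck_on_SucI[OF assms(1), where f' = "\<lambda>x v. f x * frechet_derivative g (at x) v + frechet_derivative f (at x) v * g x"])
    show "((\<lambda>x. f x * g x) has_derivative (\<lambda>v. f x * frechet_derivative g (at x) v + frechet_derivative f (at x) v * g x)) (at x)"
      if "x \<in> S" for x
      using Suc.prems that by (auto simp del: Ck_on.simps intro!: has_derivative_mult Ck_on_has_derivative)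
    show "Ck_on k S (\<lambda>x. f x * frechet_derivative g (at x) v + frechet_derivative f (at x) v * g x)" for v
      using Suc.prems fg by (intro Ck_on_add assms(1) Suc.IH) auto
  qed
qed

lemma Ck_on_sum:
  assumes "open S" "\<And>i. i \<in> I \<Longrightarrow> Ck_on k S (f i)"
  shows "Ck_on k S (\<lambda>x. \<Sum>i\<in>I. f i x)"
  using assms(2)
  by (induction I rule: infinite_finite_induct) (auto intro!: Ck_on_const Ck_on_add assms(1))

text \<open>The chain rule evaluates the derivative of f in the direction Dg x v, which moves with
  x, whereas \<open>Ck_on\<close> speaks of fixed directions. Expanding Dg x v in
  \<open>Basis\<close> gives products whose factors are covered by the induction hypothesis and by
  the smoothness of g.\<close>

lemma Ck_on_compose:
  fixes g :: "'a::real_normed_vector \<Rightarrow> 'b::euclidean_space" and f :: "'b \<Rightarrow> real"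
  assumes "open S" "open T" "g ` S \<subseteq> T" "Ck_on k S g" "Ck_on k T f"
  shows "Ck_on k S (\<lambda>x. f (g x))"
  using assms(4,5)
proof (induction k arbitrary: f)
  case 0
  then show ?case using assms(3) by (auto intro: continuous_on_compose2)
next
  case (Suc k)
  let ?Df = "\<lambda>x. frechet_derivative f (at x)" and ?Dg = "\<lambda>x. frechet_derivative g (at x)"
  show ?case
  proof (rule Ck_on_SucI[OF assms(1), where f' = "\<lambda>x v. \<Sum>b\<in>Basis. (?Dg x v \<bullet> b) * ?Df (g x) b"])
    fix x assume x: "x \<in> S"
    have df: "(f has_derivative ?Df (g x)) (at (g x))"
      using Suc.prems x assms(3) by (blast intro: Ck_on_has_derivative)
    interpret bounded_linear "?Df (g x)" using df by (rule has_derivative_bounded_linear)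
    have "?Df (g x) (?Dg x v) = (\<Sum>b\<in>Basis. (?Dg x v \<bullet> b) * ?Df (g x) b)" for v
      by (subst euclidean_representation[of "?Dg x v", symmetric]) (simp add: sum scaleR)
    then show "((\<lambda>x. f (g x)) has_derivative (\<lambda>v. \<Sum>b\<in>Basis. (?Dg x v \<bullet> b) * ?Df (g x) b)) (at x)"
      using has_derivative_compose[OF Ck_on_has_derivative[OF Suc.prems(1) x] df] by simp
  next
    fix v
    have g: "Ck_on k S g" using Suc.prems Ck_on_Suc_imp by blast
    have "Ck_on k S (\<lambda>x. ?Df (g x) b)" for b
      using Suc.prems g by (intro Suc.IH) auto
    moreover have "Ck_on k S (\<lambda>x. ?Dg x v \<bullet> b)" for b
      using Suc.prems by (intro Ck_on_linear[OF bounded_linear_inner_left assms(1)]) auto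
    ultimately show "Ck_on k S (\<lambda>x. \<Sum>b\<in>Basis. (?Dg x v \<bullet> b) * ?Df (g x) b)"
      by (intro Ck_on_sum Ck_on_mult assms(1))
  qed
qed

section \<open>Bump functions and Hadamard's lemma\<close>

text \<open>The powers of \<open>t\<close> make the family closed under differentiation.\<close>

definition flat :: "nat \<Rightarrow> real \<Rightarrow> real" where
  "flat k t = (if t > 0 then exp (- (1/t)) / t ^ k else 0)"

lemma flat_has_derivative:
  "(flat k has_real_derivative (flat (k+2) t - k * flat (k+1) t)) (at t)"
proof (cases t "0 :: real" rule: linorder_cases)
  case less
  have "((\<lambda>t. 0) has_real_derivative 0) (at t)" by simp
  then have "(flat k has_real_derivative 0) (at t)"
    by (rule has_field_derivative_transform_within_open[where S = "{..<0}"]) (use less in \<open>auto simp: flat_def\<close>)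
  then show ?thesis using less by (simp add: flat_def)
next
  case greater
  have "((\<lambda>t. exp (- (1/t)) / t ^ k) has_real_derivative (flat (k+2) t - k * flat (k+1) t)) (at t)"
    using greater
    by (auto intro!: derivative_eq_intros simp: flat_def) (cases k; auto simp: field_simps power2_eq_square)
  then show ?thesis
    by (rule has_field_derivative_transform_within_open[where S = "{0<..}"]) (use greater in \<open>auto simp: flat_def\<close>)
next
  case equal
  \<comment> \<open>\<open>flat k t / t\<close> is the difference quotient at 0. Under t = 1/x its
    right limit becomes that of x^(k+1) / exp x at infinity; on the left it is identically
    0.\<close>
  have 1: "((\<lambda>t. flat k t / t) \<longlongrightarrow> 0) (at_right 0)"
  proof (rule Lim_transform_eventually)
    show "((\<lambda>x::real. exp (- (1/x)) / x ^ k / x) \<longlongrightarrow> 0) (at_right 0)"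
      using tendsto_power_div_exp_0[of "Suc k"]
      by (subst filterlim_at_right_to_top) (simp add: exp_minus field_simps)
  qed (auto simp: flat_def eventually_at_filter)
  have 2: "((\<lambda>t. flat k t / t) \<longlongrightarrow> 0) (at_left 0)"
    by (rule Lim_transform_eventually[OF tendsto_const]) (auto simp: flat_def eventually_at_filter)
  have "((\<lambda>t. flat k t / t) \<longlongrightarrow> 0) (at 0)"
    using 1 2 filterlim_split_at by blast
  then show ?thesis using equal by (simp add: has_field_derivative_iff flat_def)
qed

lemma Ck_on_flat: "Ck_on n UNIV (flat k)"
proof (induction n arbitrary: k)
  case 0
  have "isCont (flat k) t" for t using DERIV_isCont flat_has_derivative by blast
  then show ?case by (simp add: continuous_at_imp_continuous_on)
next
  case (Suc n)
  show ?case
  proof (rule Ck_on_SucI[where f' = "\<lambda>t v. v * flat (k+2) t + (- (v * k)) * flat (k+1) t"])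
    show "(flat k has_derivative (\<lambda>v. v * flat (k+2) t + (- (v * k)) * flat (k+1) t)) (at t)" for t
      using flat_has_derivative[of k t] unfolding has_field_derivative_def
      by (rule has_derivative_eq_rhs) (auto simp: fun_eq_iff algebra_simps)
    show "Ck_on n UNIV (\<lambda>t. v * flat (k+2) t + (- (v * k)) * flat (k+1) t)" for v
      by (intro Ck_on_add Ck_on_mult Ck_on_const Suc.IH open_UNIV)
  qed simp
qed

lemma Ck_on_id: "Ck_on k S (\<lambda>x. x)"
proof (cases k)
  case (Suc n)
  have "frechet_derivative (\<lambda>x. x) (at x) = (\<lambda>v. v)" for x :: 'a
    by (metis frechet_derivative_at has_derivative_ident)
  then show ?thesis using Suc by (auto intro: Ck_on_const simp: differentiable_def intro!: has_derivative_ident)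
qed simp

text \<open>The sum is the squared norm of y - a, written in coordinates so that smoothness follows
  from the rules for sums and products. For r > 0 the function is positive exactly on the open ball
  of radius r.\<close>

definition bump :: "'a::euclidean_space \<Rightarrow> real \<Rightarrow> 'a \<Rightarrow> real" where
  "bump a r y = flat 0 (r\<^sup>2 - (\<Sum>b\<in>Basis. ((y - a) \<bullet> b)\<^sup>2))"

lemma Ck_on_bump: "open S \<Longrightarrow> Ck_on k S (bump a r)"
proof -
  assume S: "open S"
  have [simp]: "Ck_on k S (\<lambda>y. (y - a) \<bullet> b)" for b
    using Ck_on_add[OF S Ck_on_linear[OF bounded_linear_inner_left[of b] S Ck_on_id] Ck_on_const[of k S "- (a \<bullet> b)"]]
    by (simp add: inner_diff_left)
  have "Ck_on k S (\<lambda>y. r\<^sup>2 + (-1) * (\<Sum>b\<in>Basis. ((y - a) \<bullet> b) * ((y - a) \<bullet> b)))"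
    by (intro Ck_on_add Ck_on_mult Ck_on_sum Ck_on_const S) auto
  from Ck_on_compose[OF S open_UNIV _ this Ck_on_flat[of k 0]]
  show ?thesis by (simp add: bump_def[abs_def] power2_eq_square)
qed

lemma bump_outside: "y \<notin> cball a r \<Longrightarrow> r > 0 \<Longrightarrow> bump a r y = 0"
proof -
  assume "y \<notin> cball a r" "r > 0"
  then have "r < norm (y - a)" by (auto simp: dist_norm norm_minus_commute)
  then have "r\<^sup>2 < (norm (y - a))\<^sup>2" using \<open>r > 0\<close> by (intro power_strict_mono) auto
  also have "\<dots> = (\<Sum>b\<in>Basis. ((y - a) \<bullet> b)\<^sup>2)"
    by (simp only: power2_norm_eq_inner) (subst euclidean_inner, simp add: power2_eq_square)
  finally show ?thesis by (simp add: bump_def flat_def)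
qed

lemma bump_centre: "r > 0 \<Longrightarrow> bump a r a > 0"
  by (simp add: bump_def flat_def)

text \<open>Differentiation under the integral sign. Each derivative in y brings out a factor t by
  the chain rule, hence the weight t^n: over all n and \<phi> these integrals form a family closed
  under differentiation.\<close>

lemma leibniz_ray:
  fixes \<phi> :: "'a::euclidean_space \<Rightarrow> real"
  assumes S: "open S" "convex S" "a \<in> S" and \<phi>: "Ck_on 1 S \<phi>" and y: "y \<in> S"
  shows "((\<lambda>y. integral {0..1} (\<lambda>t. t ^ n * \<phi> (a + t *\<^sub>R (y - a)))) has_derivative
     (\<lambda>v. integral {0..1} (\<lambda>t. t ^ Suc n * frechet_derivative \<phi> (at (a + t *\<^sub>R (y - a))) v))) (at y)"
proof -
  have in_S: "a + t *\<^sub>R (y - a) \<in> S" if "y \<in> S" "t \<in> cbox 0 1" for y and t :: real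
  proof -
    have "(1 - t) *\<^sub>R a + t *\<^sub>R y \<in> S" using S that by (auto simp: convex_def)
    then show ?thesis by (simp add: algebra_simps)
  qed
  have der: "(\<phi> has_derivative frechet_derivative \<phi> (at z)) (at z)" if "z \<in> S" for z
    using \<phi> that by (metis Ck_on_has_derivative One_nat_def)
  then have bl: "bounded_linear (frechet_derivative \<phi> (at z))" if "z \<in> S" for z
    using that has_derivative_bounded_linear by blast
  have cont: "continuous_on S \<phi>" 
    using der by (meson continuous_at_imp_continuous_on has_derivative_continuous)
  \<comment> \<open>The Leibniz rule wants the derivative as a jointly continuous family of bounded
    linear maps, hence \<open>Blinfun\<close>; its continuity is then checked on basis
    vectors.\<close>
  define fx where "fx = (\<lambda>y t. t ^ Suc n *\<^sub>R Blinfun (frechet_derivative \<phi> (at (a + t *\<^sub>R (y - a)))))"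
  have fx: "blinfun_apply (fx y t) = (\<lambda>v. t ^ Suc n * frechet_derivative \<phi> (at (a + t *\<^sub>R (y - a))) v)"
    if "y \<in> S" "t \<in> cbox 0 1" for y t
    using bl[OF in_S[OF that]] by (simp add: fx_def fun_eq_iff scaleR_blinfun.rep_eq bounded_linear_Blinfun_apply)
  have cfx: "continuous_on (S \<times> cbox 0 1) (\<lambda>(x, t). fx x t)"
  proof (rule continuous_on_blinfun_componentwise)
    fix b :: 'a
    have "continuous_on S (\<lambda>z. frechet_derivative \<phi> (at z) b)" using \<phi> by simp
    then have "continuous_on (S \<times> cbox 0 1) (\<lambda>p. frechet_derivative \<phi> (at (a + snd p *\<^sub>R (fst p - a))) b)"
      by (rule continuous_on_compose2) (use in_S in \<open>auto intro!: continuous_intros\<close>)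
    then have "continuous_on (S \<times> cbox 0 1) (\<lambda>p. snd p ^ Suc n * frechet_derivative \<phi> (at (a + snd p *\<^sub>R (fst p - a))) b)"
      by (intro continuous_intros)
    then show "continuous_on (S \<times> cbox 0 1) (\<lambda>x. blinfun_apply (case x of (x, t) \<Rightarrow> fx x t) b)"
      by (rule continuous_on_eq) (use fx in auto)
  qed
  have "((\<lambda>y. integral (cbox 0 1) (\<lambda>t. t ^ n * \<phi> (a + t *\<^sub>R (y - a)))) has_derivative
      integral (cbox 0 1) (fx y)) (at y within S)"
  proof (rule leibniz_rule[OF _ _ cfx y S(2)])
    fix y and t :: real assume yt: "y \<in> S" "t \<in> cbox 0 1"
    have "((\<lambda>y. \<phi> (a + t *\<^sub>R (y - a))) has_derivative
        (\<lambda>v. frechet_derivative \<phi> (at (a + t *\<^sub>R (y - a))) (t *\<^sub>R v))) (at y)"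
      by (rule has_derivative_compose[where f = "\<lambda>y. a + t *\<^sub>R (y - a)", OF _ der[OF in_S[OF yt]]]) (auto intro!: derivative_eq_intros)
    then have "((\<lambda>y. t ^ n * \<phi> (a + t *\<^sub>R (y - a))) has_derivative
        (\<lambda>v. t ^ n * frechet_derivative \<phi> (at (a + t *\<^sub>R (y - a))) (t *\<^sub>R v))) (at y)"
      by (rule has_derivative_mult_right)
    moreover have "(\<lambda>v. t ^ n * frechet_derivative \<phi> (at (a + t *\<^sub>R (y - a))) (t *\<^sub>R v)) = blinfun_apply (fx y t)"
      using linear_simps(5)[OF bl[OF in_S[OF yt]]] by (simp add: fx[OF yt] fun_eq_iff)
    ultimately show "((\<lambda>y. t ^ n * \<phi> (a + t *\<^sub>R (y - a))) has_derivative blinfun_apply (fx y t)) (at y within S)"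
      by (simp add: has_derivative_at_withinI)
  next
    fix y assume "y \<in> S"
    then show "(\<lambda>t. t ^ n * \<phi> (a + t *\<^sub>R (y - a))) integrable_on cbox 0 1"
      by (intro integrable_continuous continuous_intros continuous_on_compose2[OF cont]) (use in_S in auto)
  qed
  moreover have "blinfun_apply (integral (cbox 0 1) (fx y)) =
      (\<lambda>v. integral {0..1} (\<lambda>t. t ^ Suc n * frechet_derivative \<phi> (at (a + t *\<^sub>R (y - a))) v))"
  proof
    fix v
    have "continuous_on (cbox 0 1) (\<lambda>t. (\<lambda>(x, t). fx x t) (y, t))"
      by (rule continuous_on_compose2[OF cfx]) (use y in \<open>auto intro!: continuous_intros\<close>)
    then have "fx y integrable_on cbox 0 1" by (intro integrable_continuous) simp
    then have "blinfun_apply (integral (cbox 0 1) (fx y)) v = integral (cbox 0 1) (\<lambda>t. fx y t v)"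
      using integral_linear[of "fx y" "cbox 0 1" "\<lambda>l. blinfun_apply l v"] 
      by (simp add: o_def bounded_linear_intros)
    also have "\<dots> = integral (cbox 0 1) (\<lambda>t. t ^ Suc n * frechet_derivative \<phi> (at (a + t *\<^sub>R (y - a))) v)"
      by (rule integral_cong) (simp add: fx[OF y])
    finally show "blinfun_apply (integral (cbox 0 1) (fx y)) v =
      integral {0..1} (\<lambda>t. t ^ Suc n * frechet_derivative \<phi> (at (a + t *\<^sub>R (y - a))) v)" by simp
  qed
  ultimately show ?thesis unfolding at_within_open[OF y S(1)] by (simp only: cbox_interval)
qed

lemma Ck_on_ray_integral:
  fixes \<phi> :: "'a::euclidean_space \<Rightarrow> real"
  assumes S: "open S" "convex S" "a \<in> S" and \<phi>: "smooth_on S \<phi>"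
  shows "Ck_on k S (\<lambda>y. integral {0..1} (\<lambda>t. t ^ n * \<phi> (a + t *\<^sub>R (y - a))))"
  using \<phi>
proof (induction k arbitrary: n \<phi>)
  case 0
  then have "Ck_on 1 S \<phi>" by (simp add: smooth_on_def)
  from leibniz_ray[OF S this] show ?case
    by (auto intro!: continuous_at_imp_continuous_on has_derivative_continuous)
next
  case (Suc k)
  then have "Ck_on 1 S \<phi>" by (simp add: smooth_on_def)
  from leibniz_ray[OF S this] show ?case
  proof (rule Ck_on_SucI[OF S(1)])
    fix v
    have "smooth_on S (\<lambda>z. frechet_derivative \<phi> (at z) v)"
      using Suc.prems unfolding smooth_on_def by (metis Ck_on.simps(2))
    from Suc.IH[OF this] show "Ck_on k S (\<lambda>y. integral {0..1} (\<lambda>t. t ^ Suc n * frechet_derivative \<phi> (at (a + t *\<^sub>R (y - a))) v))" .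
  qed
qed

text \<open>h b is the mean of the b-th partial derivative over the segment from a to y. The
  expansion is the fundamental theorem of calculus along that segment, which convexity keeps inside
  S.\<close>

lemma hadamard:
  fixes f :: "'a::euclidean_space \<Rightarrow> real"
  assumes S: "open S" "convex S" "a \<in> S" and f: "smooth_on S f"
  obtains h where "\<And>b. smooth_on S (h b)" "\<And>b. h b a = frechet_derivative f (at a) b"
    "\<And>y. y \<in> S \<Longrightarrow> f y = f a + (\<Sum>b\<in>Basis. ((y - a) \<bullet> b) * h b y)"
proof
  \<comment> \<open>The factor t^0 makes this an instance of the weighted integrals of
    \<open>Ck_on_ray_integral\<close>.\<close>
  let ?h = "\<lambda>b y. integral {0..1} (\<lambda>t. t ^ 0 * frechet_derivative f (at (a + t *\<^sub>R (y - a))) b)"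
  have smooth: "smooth_on S (\<lambda>z. frechet_derivative f (at z) v)" for v
    using f unfolding smooth_on_def by (metis Ck_on.simps(2))
  show "smooth_on S (?h b)" for b
    unfolding smooth_on_def using Ck_on_ray_integral[OF S smooth] by blast
  show "?h b a = frechet_derivative f (at a) b" for b by simp
  fix y assume y: "y \<in> S"
  have in_S: "a + t *\<^sub>R (y - a) \<in> S" if "t \<in> {0..1}" for t :: real
  proof -
    have "(1 - t) *\<^sub>R a + t *\<^sub>R y \<in> S" using S that y by (auto simp: convex_def)
    then show ?thesis by (simp add: algebra_simps)
  qed
  have der: "(f has_derivative frechet_derivative f (at z)) (at z)" if "z \<in> S" for z
    using f that unfolding smooth_on_def by (metis Ck_on_has_derivative)
  have rep: "frechet_derivative f (at z) (y - a) = (\<Sum>b\<in>Basis. ((y - a) \<bullet> b) * frechet_derivative f (at z) b)"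
    if "z \<in> S" for z
  proof -
    interpret bounded_linear "frechet_derivative f (at z)" using der[OF that] by (rule has_derivative_bounded_linear)
    show ?thesis by (subst euclidean_representation[of "y - a", symmetric]) (simp only: sum scaleR real_scaleR_def)
  qed
  have int: "(\<lambda>t. frechet_derivative f (at (a + t *\<^sub>R (y - a))) b) integrable_on {0..1}" for b
  proof -
    have c: "continuous_on S (\<lambda>z. frechet_derivative f (at z) b)"
      using smooth[of b] unfolding smooth_on_def by (metis Ck_on.simps(1))
    show ?thesis
      by (intro integrable_continuous_real continuous_on_compose2[OF c]) (use in_S in \<open>auto intro!: continuous_intros\<close>)
  qed
  have "((\<lambda>t. frechet_derivative f (at (a + t *\<^sub>R (y - a))) (y - a)) has_integral
      f (a + 1 *\<^sub>R (y - a)) - f (a + 0 *\<^sub>R (y - a))) {0..1}"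
  proof (rule fundamental_theorem_of_calculus)
    fix t :: real assume t: "t \<in> {0..1}"
    have "((\<lambda>t. f (a + t *\<^sub>R (y - a))) has_derivative
        (\<lambda>s. frechet_derivative f (at (a + t *\<^sub>R (y - a))) (s *\<^sub>R (y - a)))) (at t)"
      by (rule has_derivative_compose[where f = "\<lambda>t. a + t *\<^sub>R (y - a)", OF _ der[OF in_S[OF t]]])
        (auto intro!: derivative_eq_intros)
    moreover have "bounded_linear (frechet_derivative f (at (a + t *\<^sub>R (y - a))))"
      using der[OF in_S[OF t]] has_derivative_bounded_linear by blast
    ultimately show "((\<lambda>t. f (a + t *\<^sub>R (y - a))) has_vector_derivative
        frechet_derivative f (at (a + t *\<^sub>R (y - a))) (y - a)) (at t within {0..1})"
      by (simp add: has_vector_derivative_def linear_simps has_derivative_at_withinI)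
  qed simp
  then have "f y - f a = integral {0..1} (\<lambda>t. frechet_derivative f (at (a + t *\<^sub>R (y - a))) (y - a))"
    by (simp add: integral_unique)
  also have "\<dots> = integral {0..1} (\<lambda>t. \<Sum>b\<in>Basis. ((y - a) \<bullet> b) * frechet_derivative f (at (a + t *\<^sub>R (y - a))) b)"
    by (rule integral_cong) (simp add: rep in_S)
  also have "\<dots> = (\<Sum>b\<in>Basis. ((y - a) \<bullet> b) * ?h b y)"
    using int by (subst integral_sum) (auto simp: integrable_on_mult_right)
  finally show "f y = f a + (\<Sum>b\<in>Basis. ((y - a) \<bullet> b) * ?h b y)" by simp
qed

section \<open>Manifolds and local frames\<close>

lemma smooth_on_const: "smooth_on S (\<lambda>x. c)"
  by (simp add: smooth_on_def Ck_on_const)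

lemma smooth_on_add: "open S \<Longrightarrow> smooth_on S f \<Longrightarrow> smooth_on S g \<Longrightarrow> smooth_on S (\<lambda>x. f x + g x)"
  by (simp add: smooth_on_def Ck_on_add)

lemma smooth_on_mult:
  fixes f g :: "_ \<Rightarrow> real"
  shows "open S \<Longrightarrow> smooth_on S f \<Longrightarrow> smooth_on S g \<Longrightarrow> smooth_on S (\<lambda>x. f x * g x)"
  by (simp add: smooth_on_def Ck_on_mult)

lemma smooth_on_subset: "smooth_on S f \<Longrightarrow> T \<subseteq> S \<Longrightarrow> smooth_on T f"
  by (auto simp: smooth_on_def intro: Ck_on_subset)

lemma smooth_on_frechet_derivative: "smooth_on S f \<Longrightarrow> smooth_on S (\<lambda>x. frechet_derivative f (at x) v)"
  unfolding smooth_on_def by (metis Ck_on.simps(2))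

lemma smooth_on_has_derivative:
  "smooth_on S f \<Longrightarrow> x \<in> S \<Longrightarrow> (f has_derivative frechet_derivative f (at x)) (at x)"
  unfolding smooth_on_def by (metis Ck_on_has_derivative)

lemma smooth_on_compose:
  fixes g :: "'a::real_normed_vector \<Rightarrow> 'b::euclidean_space" and f :: "'b \<Rightarrow> real"
  shows "open S \<Longrightarrow> open T \<Longrightarrow> g ` S \<subseteq> T \<Longrightarrow> smooth_on S g \<Longrightarrow> smooth_on T f \<Longrightarrow> smooth_on S (\<lambda>x. f (g x))"
  by (simp add: smooth_on_def Ck_on_compose)

lemma smooth_on_local:
  "(\<And>x. x \<in> S \<Longrightarrow> \<exists>T. open T \<and> x \<in> T \<and> smooth_on T f) \<Longrightarrow> smooth_on S f"
  unfolding smooth_on_def using Ck_on_local by metis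

lemma smooth_on_cong: "open S \<Longrightarrow> (\<And>x. x \<in> S \<Longrightarrow> f x = g x) \<Longrightarrow> smooth_on S f = smooth_on S g"
  unfolding smooth_on_def using Ck_on_cong by metis

lemma smooth_on_bump: "open S \<Longrightarrow> smooth_on S (bump a r)"
  by (simp add: smooth_on_def Ck_on_bump)

lemma smooth_on_inner: "open S \<Longrightarrow> smooth_on S (\<lambda>y. (y - a) \<bullet> b)"
  using smooth_on_add[of S "\<lambda>y. y \<bullet> b" "\<lambda>y. - (a \<bullet> b)"]
    Ck_on_linear[OF bounded_linear_inner_left[of b] _ Ck_on_id, of S]
  by (simp add: smooth_on_def Ck_on_const inner_diff_left)

lemma sum_fun_apply: "sum f I x = (\<Sum>i\<in>I. f i x)"
  by (induction I rule: infinite_finite_induct) auto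

section \<open>The ring of smooth functions and tangent vectors as derivations of it\<close>

locale manifold =
  fixes A :: "('p::{t2_space, second_countable_topology}, 'e::euclidean_space) atlas"
  assumes smooth_manifold: "smooth_manifold A"
begin

abbreviation "C \<equiv> smooth_functions A"

lemma chart:
  assumes "(W, \<phi>) \<in> A"
  shows "open W" "open (\<phi> ` W)" "homeomorphism W (\<phi> ` W) \<phi> (inv_into W \<phi>)"
    "q \<in> W \<Longrightarrow> inv_into W \<phi> (\<phi> q) = q"
  using smooth_manifold assms unfolding smooth_manifold_def homeomorphism_def by auto

lemma chart_exists: "\<exists>W \<phi>. (W, \<phi>) \<in> A \<and> q \<in> W"
proof -
  have "q \<in> (\<Union>(W, \<phi>)\<in>A. W)" using smooth_manifold unfolding smooth_manifold_def by simp
  then show ?thesis by auto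
qed

lemma chart_open_image:
  assumes "(W, \<phi>) \<in> A" "open T"
  shows "open (\<phi> ` (W \<inter> T))"
proof -
  have "openin (top_of_set (\<phi> ` W)) (\<phi> ` (W \<inter> T))"
    by (rule homeomorphism_imp_open_map[OF chart(3)[OF assms(1)]]) (use assms in auto)
  then show ?thesis using chart(2)[OF assms(1)] by (simp add: openin_open_eq)
qed

lemma smooth_functionsD:
  "f \<in> C \<Longrightarrow> (W, \<phi>) \<in> A \<Longrightarrow> smooth_on (\<phi> ` W) (f \<circ> inv_into W \<phi>)"
  by (auto simp: smooth_functions_def)

lemma smooth_functions_const: "(\<lambda>p. c) \<in> C"
  by (auto simp: smooth_functions_def o_def smooth_on_const)

lemma smooth_functions_add: "f \<in> C \<Longrightarrow> h \<in> C \<Longrightarrow> f + h \<in> C"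
  using chart(2) by (auto simp: smooth_functions_def o_def intro!: smooth_on_add)

lemma smooth_functions_mult: "f \<in> C \<Longrightarrow> h \<in> C \<Longrightarrow> f * h \<in> C"
  using chart(2) by (auto simp: smooth_functions_def o_def intro!: smooth_on_mult)

lemma smooth_functions_scale: "f \<in> C \<Longrightarrow> (\<lambda>p. c * f p) \<in> C"
  using smooth_functions_mult[OF smooth_functions_const[of c], of f] by (simp add: times_fun_def)

lemma smooth_functions_zero: "0 \<in> C"
  using smooth_functions_const[of 0] by (simp add: zero_fun_def)

lemma smooth_functions_uminus: "f \<in> C \<Longrightarrow> - f \<in> C"
  using smooth_functions_scale[of f "-1"] by (simp add: fun_Compl_def)

lemma smooth_functions_diff: "f \<in> C \<Longrightarrow> h \<in> C \<Longrightarrow> f - h \<in> C"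
  using smooth_functions_add[OF _ smooth_functions_uminus, of f h] by simp

lemma smooth_functions_sum: "(\<And>i. i \<in> I \<Longrightarrow> f i \<in> C) \<Longrightarrow> sum f I \<in> C"
  by (induction I rule: infinite_finite_induct) (auto simp: smooth_functions_zero smooth_functions_add)

lemma tangent_add: "v \<in> tangent_space A p \<Longrightarrow> f \<in> C \<Longrightarrow> h \<in> C \<Longrightarrow> v (f + h) = v f + v h"
  and tangent_scale: "v \<in> tangent_space A p \<Longrightarrow> f \<in> C \<Longrightarrow> v (\<lambda>q. c * f q) = c * v f"
  and tangent_mult: "v \<in> tangent_space A p \<Longrightarrow> f \<in> C \<Longrightarrow> h \<in> C \<Longrightarrow> v (f * h) = v f * h p + f p * v h"
  and tangent_outside: "v \<in> tangent_space A p \<Longrightarrow> f \<notin> C \<Longrightarrow> v f = 0"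
  by (auto simp: tangent_space_def)

lemma tangent_zero: "v \<in> tangent_space A p \<Longrightarrow> v 0 = 0"
  using tangent_add[of v p 0 0] smooth_functions_zero by simp

lemma tangent_uminus: "v \<in> tangent_space A p \<Longrightarrow> f \<in> C \<Longrightarrow> v (- f) = - v f"
  using tangent_add[of v p f "- f"] smooth_functions_uminus tangent_zero by fastforce

lemma tangent_diff: "v \<in> tangent_space A p \<Longrightarrow> f \<in> C \<Longrightarrow> h \<in> C \<Longrightarrow> v (f - h) = v f - v h"
  using tangent_add[of v p f "- h"] smooth_functions_uminus tangent_uminus by fastforce

lemma tangent_sum:
  "v \<in> tangent_space A p \<Longrightarrow> (\<And>i. i \<in> I \<Longrightarrow> f i \<in> C) \<Longrightarrow> v (sum f I) = (\<Sum>i\<in>I. v (f i))"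
  by (induction I rule: infinite_finite_induct)
    (auto simp: tangent_zero tangent_add smooth_functions_sum)

lemma tangent_const: "v \<in> tangent_space A p \<Longrightarrow> v (\<lambda>q. c) = 0"
  using tangent_mult[of v p "\<lambda>q. 1" "\<lambda>q. 1"] tangent_scale[of v p "\<lambda>q. 1" c] smooth_functions_const[of 1]
  by (simp add: times_fun_def)

section \<open>Passing between a chart and the whole manifold\<close>

definition extend where
  "extend W \<phi> S u = (\<lambda>q. if q \<in> W \<and> \<phi> q \<in> S then u (\<phi> q) else (0::real))"

text \<open>Two open sets cover the manifold: the preimage of S, where the extension is u in
  coordinates, and the complement of the preimage of K, where it is 0. The second is open because a
  compact subset of a Hausdorff space is closed.\<close>

lemma extend_smooth:
  assumes A: "(W, \<phi>) \<in> A" and S: "open S" "S \<subseteq> \<phi> ` W" and K: "compact K" "K \<subseteq> S"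
    and u: "smooth_on S u" "\<And>y. y \<in> S \<Longrightarrow> y \<notin> K \<Longrightarrow> u y = 0"
  shows "extend W \<phi> S u \<in> C"
  unfolding smooth_functions_def
proof (clarify, rule smooth_on_local)
  fix V \<psi> y assume V: "(V, \<psi>) \<in> A" "y \<in> \<psi> ` V"
  let ?i = "inv_into V \<psi>" and ?j = "inv_into W \<phi>"
  have Vi: "?i z \<in> V" "\<psi> (?i z) = z" if "z \<in> \<psi> ` V" for z
    using that by (auto simp: inv_into_into f_inv_into_f)
  have j: "?j z \<in> W" "\<phi> (?j z) = z" if "z \<in> \<phi> ` W" for z
    using that by (auto simp: inv_into_into f_inv_into_f)
  define O1 where "O1 = ?j ` S"
  have hom: "homeomorphism (\<phi> ` W) W ?j \<phi>" using chart(3)[OF A] by (rule homeomorphism_symD)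
  have O1: "open O1"
  proof -
    have "openin (top_of_set W) (?j ` S)"
      by (rule homeomorphism_imp_open_map[OF hom]) (use S in \<open>auto intro: open_subset\<close>)
    then show ?thesis using chart(1)[OF A] by (simp add: openin_open_eq O1_def)
  qed
  have O1_iff: "q \<in> O1 \<longleftrightarrow> q \<in> W \<and> \<phi> q \<in> S" for q
    using j S(2) chart(4)[OF A, of q] unfolding O1_def by (force simp: image_iff subset_iff)
  define K1 where "K1 = ?j ` K"
  have "continuous_on K ?j" using hom K S(2) unfolding homeomorphism_def by (meson continuous_on_subset subset_trans)
  then have "closed K1" using K compact_continuous_image compact_imp_closed unfolding K1_def by blast
  have K1_iff: "q \<in> K1 \<longleftrightarrow> q \<in> W \<and> \<phi> q \<in> K" for q
    using j subset_trans[OF K(2) S(2)] chart(4)[OF A, of q] unfolding K1_def by (force simp: image_iff subset_iff)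
  show "\<exists>T. open T \<and> y \<in> T \<and> smooth_on T (extend W \<phi> S u \<circ> ?i)"
  proof (cases "?i y \<in> O1")
    case True
    let ?T = "\<psi> ` (V \<inter> O1)"
    have T: "open ?T" using chart_open_image[OF V(1) O1] .
    have "y \<in> ?T" using True Vi[OF V(2)] by (metis IntI image_eqI)
    moreover have "smooth_on ?T (\<lambda>z. u ((\<phi> \<circ> ?i) z))"
    proof (rule smooth_on_compose[OF T S(1) _ _ u(1)])
      show "(\<phi> \<circ> ?i) ` ?T \<subseteq> S" using chart(4)[OF V(1)] O1_iff by auto
      have "smooth_on (\<psi> ` (V \<inter> W)) (\<phi> \<circ> ?i)"
        using smooth_manifold V(1) A unfolding smooth_manifold_def by blast
      then show "smooth_on ?T (\<phi> \<circ> ?i)" by (rule smooth_on_subset) (use O1_iff in auto)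
    qed
    then have "smooth_on ?T (extend W \<phi> S u \<circ> ?i)"
      by (subst smooth_on_cong[OF T, where g = "\<lambda>z. u ((\<phi> \<circ> ?i) z)"])
        (use chart(4)[OF V(1)] O1_iff in \<open>auto simp: extend_def\<close>)
    ultimately show ?thesis using T by blast
  next
    case False
    let ?T = "\<psi> ` (V \<inter> - K1)"
    have T: "open ?T" using chart_open_image[OF V(1)] \<open>closed K1\<close> by auto
    have "?i y \<notin> K1" using False K1_iff O1_iff K(2) by blast
    then have "y \<in> ?T" using Vi[OF V(2)] by (metis IntI image_eqI ComplI)
    moreover have "smooth_on ?T (extend W \<phi> S u \<circ> ?i)"
      by (subst smooth_on_cong[OF T, where g = "\<lambda>z. 0"])
        (use chart(4)[OF V(1)] K1_iff u(2) in \<open>auto simp: extend_def smooth_on_const\<close>)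
    ultimately show ?thesis using T by blast
  qed
qed

lemma extend_inv_into:
  assumes "(W, \<phi>) \<in> A" "open S" "S \<subseteq> \<phi> ` W" "y \<in> S"
  shows "extend W \<phi> S u (inv_into W \<phi> y) = u y"
    and "smooth_on S u \<Longrightarrow>
      frechet_derivative (extend W \<phi> S u \<circ> inv_into W \<phi>) (at y) = frechet_derivative u (at y)"
proof -
  have *: "extend W \<phi> S u (inv_into W \<phi> y) = u y" if "y \<in> S" for y
    using that assms(3) by (auto simp: extend_def f_inv_into_f inv_into_into subset_iff)
  show "extend W \<phi> S u (inv_into W \<phi> y) = u y" using * assms by blast
  have "(extend W \<phi> S u \<circ> inv_into W \<phi> has_derivative frechet_derivative u (at y)) (at y)"
    if "smooth_on S u"
    by (rule has_derivative_transform_within_open[OF smooth_on_has_derivative[OF that assms(4)] assms(2,4)])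
      (simp add: *)
  then show "frechet_derivative (extend W \<phi> S u \<circ> inv_into W \<phi>) (at y) = frechet_derivative u (at y)"
    if "smooth_on S u" using frechet_derivative_at that by metis
qed

text \<open>A tangent vector is a derivation of global functions, so the coordinates and the
  Hadamard coefficients of f must first be cut off by a bump function before v can be applied to
  them.\<close>

lemma tangent_coordinates:
  assumes A: "(W, \<phi>) \<in> A" and q: "q \<in> W" and v: "v \<in> tangent_space A q"
  obtains w where "\<And>f. f \<in> C \<Longrightarrow>
    v f = (\<Sum>b\<in>Basis. w b * frechet_derivative (f \<circ> inv_into W \<phi>) (at (\<phi> q)) b)"
proof -
  obtain R where R: "R > 0" "ball (\<phi> q) R \<subseteq> \<phi> ` W"
    using chart(2)[OF A] q by (meson image_eqI open_contains_ball)
  define S where "S = ball (\<phi> q) R"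
  define r where "r = R / 2"
  have S: "open S" "convex S" "\<phi> q \<in> S" "S \<subseteq> \<phi> ` W" using R by (auto simp: S_def)
  have r: "r > 0" "cball (\<phi> q) r \<subseteq> S" using R by (auto simp: r_def S_def)
  let ?\<eta> = "bump (\<phi> q) r"
  define ex where "ex = (\<lambda>u. extend W \<phi> S (\<lambda>y. ?\<eta> y * u y))"
  have ex: "ex u \<in> C" if "smooth_on S u" for u
    unfolding ex_def
    by (rule extend_smooth[OF A S(1,4) compact_cball r(2)])
      (use that S(1) r(1) in \<open>auto intro!: smooth_on_mult smooth_on_bump simp: bump_outside\<close>)
  have ex_q: "ex u q = ?\<eta> (\<phi> q) * u (\<phi> q)" for u
    using q S(3) by (simp add: ex_def extend_def)
  let ?X = "\<lambda>b. ex (\<lambda>y. (y - \<phi> q) \<bullet> b)"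
  have X: "?X b \<in> C" for b by (intro ex smooth_on_inner S)
  show ?thesis
  proof (rule that[where w = "\<lambda>b. v (?X b) / ?\<eta> (\<phi> q)"])
    fix f assume f: "f \<in> C"
    have fS: "smooth_on S (f \<circ> inv_into W \<phi>)"
      using smooth_functionsD[OF f A] S(4) by (rule smooth_on_subset)
    obtain h where h: "\<And>b. smooth_on S (h b)"
      "\<And>b. h b (\<phi> q) = frechet_derivative (f \<circ> inv_into W \<phi>) (at (\<phi> q)) b"
      "\<And>y. y \<in> S \<Longrightarrow> (f \<circ> inv_into W \<phi>) y = (f \<circ> inv_into W \<phi>) (\<phi> q) + (\<Sum>b\<in>Basis. ((y - \<phi> q) \<bullet> b) * h b y)"
      by (rule hadamard[OF S(1-3) fS]) (rule that)
    let ?N = "ex (\<lambda>y. 1)"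
    have N: "?N \<in> C" by (intro ex smooth_on_const)
    let ?F = "f - (\<lambda>p. f q)"
    have F: "?F \<in> C" by (intro smooth_functions_diff f smooth_functions_const)
    have H: "ex (h b) \<in> C" for b by (intro ex h)
    \<comment> \<open>Hadamard's expansion holds only on the chart ball. One factor
      \<open>?N\<close> for the coordinates and one for the coefficients make both sides vanish
      elsewhere.\<close>
    have eq: "(?N * ?N) * ?F = (\<Sum>b\<in>Basis. ?X b * ex (h b))"
    proof
      fix p
      show "((?N * ?N) * ?F) p = (\<Sum>b\<in>Basis. ?X b * ex (h b)) p"
      proof (cases "p \<in> W \<and> \<phi> p \<in> S")
        case True
        then have "f p = f q + (\<Sum>b\<in>Basis. ((\<phi> p - \<phi> q) \<bullet> b) * h b (\<phi> p))"
          using h(3)[of "\<phi> p"] chart(4)[OF A] q by simp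
        then show ?thesis using True by (simp add: sum_fun_apply ex_def extend_def sum_distrib_left mult_ac)
      next
        case False
        then have "ex u p = 0" for u by (auto simp: ex_def extend_def)
        then show ?thesis by (simp add: sum_fun_apply)
      qed
    qed
    \<comment> \<open>\<open>?F\<close> and all \<open>?X b\<close> vanish at q, so only one term of
      each Leibniz expansion survives.\<close>
    have "v ((?N * ?N) * ?F) = ?\<eta> (\<phi> q) * ?\<eta> (\<phi> q) * v f"
      using tangent_mult[OF v smooth_functions_mult[OF N N] F] tangent_diff[OF v f smooth_functions_const]
        tangent_const[OF v] by (simp add: ex_q)
    moreover have "v (\<Sum>b\<in>Basis. ?X b * ex (h b)) = (\<Sum>b\<in>Basis. v (?X b) * (?\<eta> (\<phi> q) * h b (\<phi> q)))"
      by (subst tangent_sum[OF v]) (auto intro!: sum.cong smooth_functions_mult X H simp: tangent_mult[OF v X H] ex_q)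
    ultimately have "?\<eta> (\<phi> q) * (?\<eta> (\<phi> q) * v f) = ?\<eta> (\<phi> q) * (\<Sum>b\<in>Basis. v (?X b) * h b (\<phi> q))"
      using eq by (simp add: sum_distrib_left mult_ac)
    moreover have "?\<eta> (\<phi> q) > 0" using r(1) by (rule bump_centre)
    ultimately have "v f = (\<Sum>b\<in>Basis. v (?X b) * h b (\<phi> q)) / ?\<eta> (\<phi> q)"
      by (simp add: field_simps)
    then show "v f = (\<Sum>b\<in>Basis. v (?X b) / ?\<eta> (\<phi> q) * frechet_derivative (f \<circ> inv_into W \<phi>) (at (\<phi> q)) b)"
      by (simp add: sum_divide_distrib h(2))
  qed
qed

text \<open>The field u \<partial>_b of the chart, extended by zero. The value 0 on functions that
  are not smooth is the convention of \<open>tangent_space\<close>.\<close>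

definition coord_field where
  "coord_field W \<phi> S u b = (\<lambda>q f. if f \<in> C then
     extend W \<phi> S (\<lambda>y. u y * frechet_derivative (f \<circ> inv_into W \<phi>) (at y) b) q else 0)"

lemma coord_field:
  assumes A: "(W, \<phi>) \<in> A" and S: "open S" "S \<subseteq> \<phi> ` W" and K: "compact K" "K \<subseteq> S"
    and u: "smooth_on S u" "\<And>y. y \<in> S \<Longrightarrow> y \<notin> K \<Longrightarrow> u y = 0"
  shows "coord_field W \<phi> S u b \<in> vfields A"
  unfolding vfields_def tangent_space_def
proof (intro CollectI conjI allI ballI impI)
  let ?D = "\<lambda>f q. frechet_derivative (f \<circ> inv_into W \<phi>) (at (\<phi> q)) b"
  have der: "(f \<circ> inv_into W \<phi> has_derivative frechet_derivative (f \<circ> inv_into W \<phi>) (at (\<phi> q))) (at (\<phi> q))"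
    if "f \<in> C" "q \<in> W" for f q
    using smooth_on_has_derivative[OF smooth_functionsD[OF that(1) A]] that(2) by blast
  note at = frechet_derivative_at[symmetric]
  fix q c f h
  show "coord_field W \<phi> S u b q (f + h) = coord_field W \<phi> S u b q f + coord_field W \<phi> S u b q h"
    if "f \<in> C" "h \<in> C"
  proof (cases "q \<in> W")
    case True
    have "?D (f + h) q = ?D f q + ?D h q"
      using at[OF has_derivative_add[OF der der, OF that(1) True that(2) True]]
      by (simp add: o_def plus_fun_def)
    then show ?thesis using that by (simp add: coord_field_def extend_def smooth_functions_add algebra_simps)
  qed (use that in \<open>simp add: coord_field_def extend_def smooth_functions_add\<close>)
  show "coord_field W \<phi> S u b q (\<lambda>q. c * f q) = c * coord_field W \<phi> S u b q f" if "f \<in> C"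
  proof (cases "q \<in> W")
    case True
    have "?D (\<lambda>q. c * f q) q = c * ?D f q"
      using at[OF has_derivative_mult_right[OF der, OF that True, of c]] by (simp add: o_def)
    then show ?thesis using that by (simp add: coord_field_def extend_def smooth_functions_scale)
  qed (use that in \<open>simp add: coord_field_def extend_def smooth_functions_scale\<close>)
  show "coord_field W \<phi> S u b q (f * h) = coord_field W \<phi> S u b q f * h q + f q * coord_field W \<phi> S u b q h"
    if "f \<in> C" "h \<in> C"
  proof (cases "q \<in> W")
    case True
    have "?D (f * h) q = f q * ?D h q + ?D f q * h q"
      using at[OF has_derivative_mult[OF der der, OF that(1) True that(2) True]] chart(4)[OF A True]
      by (simp add: o_def times_fun_def)
    then show ?thesis using that by (simp add: coord_field_def extend_def smooth_functions_mult algebra_simps)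
  qed (use that in \<open>simp add: coord_field_def extend_def smooth_functions_mult\<close>)
  show "coord_field W \<phi> S u b q f = 0" if "f \<notin> C" using that by (simp add: coord_field_def)
  show "(\<lambda>p. coord_field W \<phi> S u b p f) \<in> C" if "f \<in> C"
  proof -
    have "extend W \<phi> S (\<lambda>y. u y * frechet_derivative (f \<circ> inv_into W \<phi>) (at y) b) \<in> C"
      by (rule extend_smooth[OF A S K])
        (use u S smooth_functionsD[OF that A] in
          \<open>auto intro!: smooth_on_mult smooth_on_frechet_derivative intro: smooth_on_subset\<close>)
    then show ?thesis using that by (simp add: coord_field_def)
  qed
qed

text \<open>The identity \<Sum> dx_j \<otimes> E_j = \<kappa> id, valid on the whole manifold. Where
  \<kappa> is nonzero the \<open>E j\<close> span the tangent space; linear independence is not part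
  of the notion.\<close>

definition frame where
  "frame \<kappa> I x E \<longleftrightarrow> \<kappa> \<in> C \<and> finite I \<and> (\<forall>j\<in>I. x j \<in> C \<and> E j \<in> vfields A) \<and>
    (\<forall>q. \<forall>v\<in>tangent_space A q. \<forall>f\<in>C. \<kappa> q * v f = (\<Sum>j\<in>I. v (x j) * E j q f))"

text \<open>
  With one bump function \<open>\<rho>\<close> and coordinates \<open>y\<^sub>b\<close>, the functions \<open>x\<close> are \<open>\<rho> y\<^sub>b\<close> and \<open>\<rho>\<close>, with the fields
  \<open>\<rho> \<partial>\<^sub>b\<close> and \<open>- \<rho> y\<^sub>b \<partial>\<^sub>b\<close>, and \<open>\<kappa> = \<rho>\<^sup>2\<close>: since \<open>v (\<rho> y\<^sub>b) - y\<^sub>b v \<rho> = \<rho> v y\<^sub>b\<close>, no second bump function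
  that equals \<open>1\<close> on the support of \<open>\<rho>\<close> is needed.
\<close>

lemma local_frame: "\<exists>\<kappa> (I :: ('e \<times> bool) set) x E. frame \<kappa> I x E \<and> \<kappa> p \<noteq> 0"
proof -
  obtain W \<phi> where A: "(W, \<phi>) \<in> A" and p: "p \<in> W" using chart_exists by blast
  obtain R where R: "R > 0" "ball (\<phi> p) R \<subseteq> \<phi> ` W"
    using chart(2)[OF A] p by (meson image_eqI open_contains_ball)
  define S where "S = ball (\<phi> p) R"
  define r where "r = R / 2"
  have S: "open S" "\<phi> p \<in> S" "S \<subseteq> \<phi> ` W" using R by (auto simp: S_def)
  have r: "r > 0" "cball (\<phi> p) r \<subseteq> S" using R by (auto simp: r_def S_def)
  let ?\<rho> = "bump (\<phi> p) r"
  let ?y = "\<lambda>b y. (y - \<phi> p) \<bullet> b"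
  have \<rho>: "smooth_on S ?\<rho>" "\<And>b. smooth_on S (\<lambda>y. ?\<rho> y * ?y b y)"
    by (intro smooth_on_mult smooth_on_bump smooth_on_inner S)+
  have out: "?\<rho> y = 0" if "y \<notin> cball (\<phi> p) r" for y using that r(1) by (simp add: bump_outside)
  define e where "e = extend W \<phi> S"
  \<comment> \<open>For each b, \<open>True\<close> marks the main pair of \<rho> y_b and \<rho>
    \<partial>_b, and \<open>False\<close> the correction that cancels the derivative of
    \<rho>.\<close>
  define x where "x = (\<lambda>(b, t). if t then e (\<lambda>y. ?\<rho> y * ?y b y) else e ?\<rho>)"
  define E where "E = (\<lambda>(b, t). coord_field W \<phi> S (\<lambda>y. if t then ?\<rho> y else - 1 * (?\<rho> y * ?y b y)) b)"
  define \<kappa> where "\<kappa> = e ?\<rho> * e ?\<rho>"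
  have e_smooth: "e u \<in> C" if "smooth_on S u" "\<And>y. y \<in> S \<Longrightarrow> y \<notin> cball (\<phi> p) r \<Longrightarrow> u y = 0" for u
    unfolding e_def using that by (intro extend_smooth[OF A S(1,3) compact_cball r(2)]) auto
  have x: "x j \<in> C" for j
    by (cases j) (auto simp: x_def out intro!: e_smooth \<rho>)
  have E: "E j \<in> vfields A" for j
  proof (cases j)
    case (Pair b t)
    have "smooth_on S (\<lambda>y. if t then ?\<rho> y else - 1 * (?\<rho> y * ?y b y))"
      by (cases t) (auto intro!: \<rho> smooth_on_mult[OF S(1) smooth_on_const[of S "-1"], simplified])
    then show ?thesis
      unfolding E_def Pair prod.case by (intro coord_field[OF A S(1,3) compact_cball r(2)]) (auto simp: out)
  qed
  have main: "\<kappa> q * v f = (\<Sum>j\<in>Basis \<times> UNIV. v (x j) * E j q f)"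
    if v: "v \<in> tangent_space A q" and f: "f \<in> C" for q v f
  proof -
    have split: "(\<Sum>j\<in>Basis \<times> UNIV. v (x j) * E j q f) =
      (\<Sum>b\<in>Basis. v (x (b, True)) * E (b, True) q f + v (x (b, False)) * E (b, False) q f)"
      by (simp add: sum.cartesian_product' UNIV_bool add.commute)
    show ?thesis
    proof (cases "q \<in> W \<and> \<phi> q \<in> S")
      case False
      then have "\<kappa> q = 0" "E j q f = 0" for j
        by (auto simp: \<kappa>_def e_def E_def coord_field_def extend_def split: prod.splits)
      then show ?thesis by simp
    next
      case True
      then have q: "q \<in> W" "\<phi> q \<in> S" by auto
      obtain w where w: "\<And>f. f \<in> C \<Longrightarrow>
          v f = (\<Sum>b\<in>Basis. w b * frechet_derivative (f \<circ> inv_into W \<phi>) (at (\<phi> q)) b)"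
        by (rule tangent_coordinates[OF A q(1) v]) (rule that)
      let ?D = "frechet_derivative ?\<rho> (at (\<phi> q))"
      have vF: "v (e ?\<rho>) = (\<Sum>c\<in>Basis. w c * ?D c)"
        using w[of "e ?\<rho>"] e_smooth[OF \<rho>(1) out] extend_inv_into(2)[OF A S(1,3) q(2) \<rho>(1)]
        by (simp add: e_def)
      have vT: "v (e (\<lambda>y. ?\<rho> y * ?y b y)) = ?y b (\<phi> q) * v (e ?\<rho>) + ?\<rho> (\<phi> q) * w b" if b: "b \<in> Basis" for b
      proof -
        have "((\<lambda>y. ?\<rho> y * ?y b y) has_derivative (\<lambda>c. ?\<rho> (\<phi> q) * (c \<bullet> b) + ?D c * ?y b (\<phi> q))) (at (\<phi> q))"
          by (rule has_derivative_mult[OF smooth_on_has_derivative[OF \<rho>(1) q(2)]])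
            (auto intro!: derivative_eq_intros)
        from frechet_derivative_at[OF this] have D: "frechet_derivative (\<lambda>y. ?\<rho> y * ?y b y) (at (\<phi> q)) = (\<lambda>c. ?\<rho> (\<phi> q) * (c \<bullet> b) + ?D c * ?y b (\<phi> q))"
          by (rule sym)
        have "e (\<lambda>y. ?\<rho> y * ?y b y) \<in> C" by (rule e_smooth[OF \<rho>(2)]) (simp add: out)
        then have "v (e (\<lambda>y. ?\<rho> y * ?y b y)) = (\<Sum>c\<in>Basis. w c * (?\<rho> (\<phi> q) * (c \<bullet> b) + ?D c * ?y b (\<phi> q)))"
          using w extend_inv_into(2)[OF A S(1,3) q(2) \<rho>(2)] D by (simp add: e_def)
        also have "\<dots> = ?\<rho> (\<phi> q) * (\<Sum>c\<in>Basis. w c * (c \<bullet> b)) + ?y b (\<phi> q) * v (e ?\<rho>)"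
          by (simp add: vF sum_distrib_left sum.distrib distrib_left mult_ac)
        also have "(\<Sum>c\<in>Basis. w c * (c \<bullet> b)) = w b"
          using b by (simp add: inner_Basis if_distrib sum.delta cong: if_cong)
        finally show ?thesis by simp
      qed
      have \<kappa>q: "\<kappa> q = ?\<rho> (\<phi> q) * ?\<rho> (\<phi> q)" using q by (simp add: \<kappa>_def e_def extend_def)
      show ?thesis
        unfolding split \<kappa>q w[OF f] sum_distrib_left
      proof (rule sum.cong[OF refl])
        fix b :: 'e assume b: "b \<in> Basis"
        show "?\<rho> (\<phi> q) * ?\<rho> (\<phi> q) * (w b * frechet_derivative (f \<circ> inv_into W \<phi>) (at (\<phi> q)) b) =
          v (x (b, True)) * E (b, True) q f + v (x (b, False)) * E (b, False) q f"
        proof -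
          let ?d = "frechet_derivative (f \<circ> inv_into W \<phi>) (at (\<phi> q)) b"
          have "E (b, True) q f = ?\<rho> (\<phi> q) * ?d" "E (b, False) q f = - (?\<rho> (\<phi> q) * ?y b (\<phi> q) * ?d)"
            using q f by (simp_all add: E_def coord_field_def extend_def)
          moreover have "v (x (b, True)) = ?y b (\<phi> q) * v (e ?\<rho>) + ?\<rho> (\<phi> q) * w b" "v (x (b, False)) = v (e ?\<rho>)"
            using vT[OF b] by (simp_all add: x_def)
          ultimately show ?thesis by algebra
        qed
      qed
    qed
  qed
  have "\<kappa> \<in> C" unfolding \<kappa>_def by (intro smooth_functions_mult e_smooth[OF \<rho>(1) out])
  then have "frame \<kappa> (Basis \<times> UNIV) x E" using x E main by (simp add: frame_def)
  moreover have "\<kappa> p \<noteq> 0" using p S(2) bump_centre[OF r(1), of "\<phi> p"] by (simp add: \<kappa>_def e_def extend_def)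
  ultimately show ?thesis by (intro exI conjI)
qed

end

section \<open>The algebra of forms\<close>

lemma ksign_simps [simp]:
  "ksign n (0::'a::ab_group_add) = 0" "ksign 0 x = x" "ksign (Suc n) x = - ksign n x"
  "ksign n (- x) = - ksign n x" "ksign m (ksign n x) = ksign (m + n) x"
  for x :: "'a::ab_group_add"
  by (auto simp: ksign_def)

lemma ksign_add: "ksign n (x + y) = ksign n x + ksign n y"
  by (auto simp: ksign_def)

lemma ksign_diff: "ksign n (x - y) = ksign n x - ksign n y"
  by (auto simp: ksign_def)

lemma ksign_cong: "even (m + n) \<Longrightarrow> ksign m x = ksign n x"
  by (auto simp: ksign_def)

lemma ksign_apply: "ksign n f x = ksign n (f x)"
  by (auto simp: ksign_def)

text \<open>The interior product without the guard of \<open>int_prod\<close>, so that its algebra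
  holds for arbitrary functions of lists, independently of an atlas.\<close>

definition contr :: "'p vfield \<Rightarrow> 'p form \<Rightarrow> 'p form" where
  "contr X \<alpha> = (\<lambda>Xs. \<alpha> (X # Xs))"

text \<open>The grading involution. With it contraction has a Leibniz rule even when the first
  factor is inhomogeneous.\<close>

definition grade :: "'p form \<Rightarrow> 'p form" where
  "grade \<alpha> = (\<lambda>Xs. ksign (length Xs) (\<alpha> Xs))"

definition smul :: "('p \<Rightarrow> real) \<Rightarrow> 'p form \<Rightarrow> 'p form" where
  "smul f \<alpha> = (\<lambda>Xs. f * \<alpha> Xs)"

definition parity :: "nat \<Rightarrow> 'p form \<Rightarrow> bool" where
  "parity a \<alpha> \<longleftrightarrow> (\<forall>Xs. odd (length Xs + a) \<longrightarrow> \<alpha> Xs = 0)"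

lemma wedge_Nil: "(\<alpha> \<^bold>\<and> \<beta>) [] = \<alpha> [] * \<beta> []"
  by (auto simp: wedge_def shuffle_sign_def)

text \<open>Splits the shuffles of n + 1 arguments by the factor that receives the first
  argument.\<close>

lemma sum_Pow_lessThan_Suc:
  fixes F :: "nat set \<Rightarrow> 'a::comm_monoid_add"
  shows "(\<Sum>S\<in>Pow {..<Suc n}. F S) = (\<Sum>T\<in>Pow {..<n}. F (insert 0 (Suc ` T)) + F (Suc ` T))"
proof -
  have "Pow {..<Suc n} = (image Suc ` Pow {..<n}) \<union> (insert 0 ` image Suc ` Pow {..<n})"
    unfolding lessThan_Suc_eq_insert_0 Pow_insert image_Pow_surj[OF refl] by simp
  moreover have "(\<Sum>S\<in>(image Suc ` Pow {..<n}) \<union> (insert 0 ` image Suc ` Pow {..<n}). F S) =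
     (\<Sum>S\<in>image Suc ` Pow {..<n}. F S) + (\<Sum>S\<in>insert 0 ` image Suc ` Pow {..<n}. F S)"
    by (rule sum.union_disjoint) auto
  moreover have "inj_on (image Suc) (Pow {..<n})"
    by (auto simp: inj_on_def inj_image_eq_iff)
  moreover have "inj_on (insert 0) (image Suc ` Pow {..<n})"
    by (auto simp: inj_on_def insert_ident)
  ultimately show ?thesis
    by (simp add: sum.reindex sum.distrib o_def add.commute)
qed

lemma shuffle_sign_insert: "shuffle_sign (Suc n) (insert 0 (Suc ` T)) = shuffle_sign n T"
proof -
  have "{(i, j). i < j \<and> j < Suc n \<and> i \<notin> insert 0 (Suc ` T) \<and> j \<in> insert 0 (Suc ` T)} =
      map_prod Suc Suc ` {(i, j). i < j \<and> j < n \<and> i \<notin> T \<and> j \<in> T}" (is "?L = ?R")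
  proof (intro equalityI subsetI)
    fix z assume "z \<in> ?L"
    then obtain i j where "z = (Suc i, Suc j)" "i < j" "j < n" "i \<notin> T" "j \<in> T"
      by (cases z; cases "fst z"; cases "snd z") (auto simp: image_iff)
    then show "z \<in> ?R" by force
  qed auto
  moreover have "inj_on (map_prod Suc Suc) B" for B by (auto simp: inj_on_def)
  ultimately show ?thesis by (simp add: shuffle_sign_def card_image)
qed

text \<open>Position 0 now belongs to the second factor and forms one inversion with every element
  of T.\<close>

lemma shuffle_sign_Suc_image:
  assumes "T \<subseteq> {..<n}"
  shows "shuffle_sign (Suc n) (Suc ` T) = (-1) ^ card T * shuffle_sign n T"
proof -
  let ?P = "{(i, j). i < j \<and> j < n \<and> i \<notin> T \<and> j \<in> T}"
  have "{(i, j). i < j \<and> j < Suc n \<and> i \<notin> Suc ` T \<and> j \<in> Suc ` T} =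
      (\<lambda>j. (0, Suc j)) ` T \<union> map_prod Suc Suc ` ?P" (is "?L = ?R")
  proof (intro equalityI subsetI)
    fix z assume "z \<in> ?L"
    then obtain i j where z: "z = (i, Suc j)" "i < Suc j" "j < n" "i \<notin> Suc ` T" "j \<in> T"
      by (cases z; cases "snd z") (auto simp: image_iff)
    then show "z \<in> ?R" by (cases i) force+
  qed (use assms in auto)
  moreover have "inj_on (map_prod Suc Suc) B" "inj_on (\<lambda>j. (0::nat, Suc j)) B'" for B B'
    by (auto simp: inj_on_def)
  moreover have "finite ?P" by (rule finite_subset[of _ "{..<n} \<times> {..<n}"]) auto
  moreover have "finite T" using assms finite_subset by blast
  ultimately have "card {(i, j). i < j \<and> j < Suc n \<and> i \<notin> Suc ` T \<and> j \<in> Suc ` T} = card T + card ?P"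
    by (simp add: card_image) (subst card_Un_disjoint, auto simp: card_image)
  then show ?thesis by (simp add: shuffle_sign_def power_add)
qed

text \<open>
  Together with the value on \<open>[]\<close> this recursion determines the wedge product, and all its
  algebraic laws are proved by induction on the list of arguments.
\<close>

lemma contr_wedge: "contr X (\<alpha> \<^bold>\<and> \<beta>) = contr X \<alpha> \<^bold>\<and> \<beta> + grade \<alpha> \<^bold>\<and> contr X \<beta>"
proof (intro ext)
  fix Xs :: "'a vfield list" and p
  have len: "length (nths Xs T) = card T" if "T \<subseteq> {..<length Xs}" for T
    using that by (auto simp: length_nths intro!: arg_cong[where f = card])
  have sg: "ksign k r = (-1) ^ k * r" for k and r :: real by (auto simp: ksign_def)
  have Compl: "nths (X # Xs) (- insert 0 (Suc ` T)) = nths Xs (- T)"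
    "nths (X # Xs) (- (Suc ` T)) = X # nths Xs (- T)"
    "nths (X # Xs) (insert 0 (Suc ` T)) = X # nths Xs T"
    "nths (X # Xs) (Suc ` T) = nths Xs T" for T and X :: "'a vfield" and Xs
    by (auto simp: nths_Cons image_iff intro!: arg_cong[where f = "nths Xs"])
  show "contr X (\<alpha> \<^bold>\<and> \<beta>) Xs p = (contr X \<alpha> \<^bold>\<and> \<beta> + grade \<alpha> \<^bold>\<and> contr X \<beta>) Xs p"
    unfolding contr_def wedge_def grade_def
    by (auto simp: sum_Pow_lessThan_Suc sum.distrib[symmetric] shuffle_sign_insert shuffle_sign_Suc_image
      Compl len ksign_apply sg intro!: sum.cong)
qed

lemma wedge_Cons: "(\<alpha> \<^bold>\<and> \<beta>) (X # Xs) = (contr X \<alpha> \<^bold>\<and> \<beta>) Xs + (grade \<alpha> \<^bold>\<and> contr X \<beta>) Xs"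
  using fun_cong[OF contr_wedge[of X \<alpha> \<beta>], of Xs] by (simp add: contr_def)

section \<open>Bilinearity, grading and associativity of the wedge product\<close>

lemma wedge_add_left: "(\<alpha> + \<beta>) \<^bold>\<and> \<gamma> = \<alpha> \<^bold>\<and> \<gamma> + \<beta> \<^bold>\<and> \<gamma>"
  and wedge_add_right: "\<gamma> \<^bold>\<and> (\<alpha> + \<beta>) = \<gamma> \<^bold>\<and> \<alpha> + \<gamma> \<^bold>\<and> \<beta>"
  and wedge_minus_left [simp]: "(- \<alpha>) \<^bold>\<and> \<gamma> = - (\<alpha> \<^bold>\<and> \<gamma>)"
  and wedge_minus_right [simp]: "\<gamma> \<^bold>\<and> (- \<alpha>) = - (\<gamma> \<^bold>\<and> \<alpha>)"
  and wedge_zero_left [simp]: "0 \<^bold>\<and> \<gamma> = 0"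
  and wedge_zero_right [simp]: "\<gamma> \<^bold>\<and> 0 = 0"
  and wedge_smul_left: "smul f \<alpha> \<^bold>\<and> \<gamma> = smul f (\<alpha> \<^bold>\<and> \<gamma>)"
  and wedge_smul_right: "\<gamma> \<^bold>\<and> smul f \<alpha> = smul f (\<gamma> \<^bold>\<and> \<alpha>)"
  by (auto simp: fun_eq_iff wedge_def smul_def algebra_simps sum.distrib sum_negf sum_distrib_left)

lemma wedge_diff_left: "(\<alpha> - \<beta>) \<^bold>\<and> \<gamma> = \<alpha> \<^bold>\<and> \<gamma> - \<beta> \<^bold>\<and> \<gamma>"
  and wedge_diff_right: "\<gamma> \<^bold>\<and> (\<alpha> - \<beta>) = \<gamma> \<^bold>\<and> \<alpha> - \<gamma> \<^bold>\<and> \<beta>"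
  using wedge_add_left[of \<alpha> "- \<beta>" \<gamma>] wedge_add_right[of \<gamma> \<alpha> "- \<beta>"] by simp_all

lemma wedge_ksign_left: "ksign n \<alpha> \<^bold>\<and> \<beta> = ksign n (\<alpha> \<^bold>\<and> \<beta>)"
  and wedge_ksign_right: "\<alpha> \<^bold>\<and> ksign n \<beta> = ksign n (\<alpha> \<^bold>\<and> \<beta>)"
  by (auto simp: ksign_def)

lemma contr_simps [simp]:
  "contr X (\<alpha> + \<beta>) = contr X \<alpha> + contr X \<beta>" "contr X (- \<alpha>) = - contr X \<alpha>" "contr X 0 = 0"
  "contr X (\<alpha> - \<beta>) = contr X \<alpha> - contr X \<beta>" "contr X (smul f \<alpha>) = smul f (contr X \<alpha>)"
  "contr X (grade \<alpha>) = - grade (contr X \<alpha>)" "contr X (func_form f) = 0"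
  by (auto simp: contr_def fun_eq_iff smul_def grade_def func_form_def ksign_apply)

lemma grade_simps [simp]:
  "grade (\<alpha> + \<beta>) = grade \<alpha> + grade \<beta>" "grade (- \<alpha>) = - grade \<alpha>" "grade 0 = 0"
  "grade (\<alpha> - \<beta>) = grade \<alpha> - grade \<beta>" "grade (smul f \<alpha>) = smul f (grade \<alpha>)" "grade (grade \<alpha>) = \<alpha>"
  "grade (func_form f) = func_form f"
  by (auto simp: grade_def fun_eq_iff smul_def ksign_def func_form_def)

lemma smul_simps:
  "smul f (\<alpha> + \<beta>) = smul f \<alpha> + smul f \<beta>" "smul f (- \<alpha>) = - smul f \<alpha>" "smul f 0 = 0"
  "smul f (\<alpha> - \<beta>) = smul f \<alpha> - smul f \<beta>" "smul (f + h) \<alpha> = smul f \<alpha> + smul h \<alpha>"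
  by (auto simp: smul_def fun_eq_iff algebra_simps)

lemma grade_wedge: "grade (\<alpha> \<^bold>\<and> \<beta>) = grade \<alpha> \<^bold>\<and> grade \<beta>"
proof
  show "grade (\<alpha> \<^bold>\<and> \<beta>) Xs = (grade \<alpha> \<^bold>\<and> grade \<beta>) Xs" for Xs
  proof (induction Xs arbitrary: \<alpha> \<beta>)
    case Nil
    then show ?case by (simp add: grade_def wedge_Nil)
  next
    case (Cons X Xs)
    have "grade (\<alpha> \<^bold>\<and> \<beta>) (X # Xs) = - grade (contr X \<alpha> \<^bold>\<and> \<beta>) Xs - grade (grade \<alpha> \<^bold>\<and> contr X \<beta>) Xs"
      by (simp add: grade_def wedge_Cons[of \<alpha> \<beta>] ksign_add)
    also have "\<dots> = (grade \<alpha> \<^bold>\<and> grade \<beta>) (X # Xs)"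
      by (simp only: Cons.IH) (simp add: wedge_Cons)
    finally show ?case .
  qed
qed

lemma wedge_assoc: "(\<alpha> \<^bold>\<and> \<beta>) \<^bold>\<and> \<gamma> = \<alpha> \<^bold>\<and> (\<beta> \<^bold>\<and> \<gamma>)"
proof
  show "((\<alpha> \<^bold>\<and> \<beta>) \<^bold>\<and> \<gamma>) Xs = (\<alpha> \<^bold>\<and> (\<beta> \<^bold>\<and> \<gamma>)) Xs" for Xs
  proof (induction Xs arbitrary: \<alpha> \<beta> \<gamma>)
    case Nil
    then show ?case by (simp add: wedge_Nil mult.assoc)
  next
    case (Cons X Xs)
    show ?case
      by (simp add: wedge_Cons[of _ _ X] contr_wedge grade_wedge wedge_add_left wedge_add_right Cons.IH add.assoc)
  qed
qed

section \<open>Parity and graded commutativity\<close>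

lemma parity_contr: "parity a \<alpha> \<Longrightarrow> parity (Suc a) (contr X \<alpha>)"
  by (auto simp: parity_def contr_def)

lemma parity_grade: "parity a \<alpha> \<Longrightarrow> grade \<alpha> = ksign a \<alpha>"
proof
  fix Xs assume "parity a \<alpha>"
  then show "grade \<alpha> Xs = ksign a \<alpha> Xs"
    by (cases "even (length Xs + a)") (auto simp: parity_def grade_def ksign_def)
qed

lemma parity_ksign: "parity a \<alpha> \<Longrightarrow> parity a (ksign n \<alpha>)"
  by (auto simp: parity_def ksign_def)

lemma parity_wedge: "parity a \<alpha> \<Longrightarrow> parity b \<beta> \<Longrightarrow> parity (a + b) (\<alpha> \<^bold>\<and> \<beta>)"
proof -
  have "(\<alpha> \<^bold>\<and> \<beta>) Xs = 0" if "odd (length Xs + a + b)" "parity a \<alpha>" "parity b \<beta>" for Xs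
    using that
  proof (induction Xs arbitrary: a b \<alpha> \<beta>)
    case Nil
    then have "\<alpha> [] = 0 \<or> \<beta> [] = 0" by (auto simp: parity_def)
    then show ?case by (auto simp: wedge_Nil)
  next
    case (Cons X Xs)
    have "(contr X \<alpha> \<^bold>\<and> \<beta>) Xs = 0"
      by (rule Cons.IH[of "Suc a" b]) (use Cons.prems in \<open>auto intro: parity_contr\<close>)
    moreover have "(grade \<alpha> \<^bold>\<and> contr X \<beta>) Xs = 0"
      unfolding parity_grade[OF Cons.prems(2)]
      by (rule Cons.IH[of a "Suc b"]) (use Cons.prems in \<open>auto intro: parity_contr parity_ksign\<close>)
    ultimately show ?case by (simp add: wedge_Cons)
  qed
  then show "parity a \<alpha> \<Longrightarrow> parity b \<beta> \<Longrightarrow> parity (a + b) (\<alpha> \<^bold>\<and> \<beta>)"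
    by (auto simp: parity_def add.assoc)
qed

lemma wedge_commute:
  assumes "parity a \<alpha>" "parity b \<beta>"
  shows "\<alpha> \<^bold>\<and> \<beta> = ksign (a * b) (\<beta> \<^bold>\<and> \<alpha>)"
proof
  show "(\<alpha> \<^bold>\<and> \<beta>) Xs = ksign (a * b) (\<beta> \<^bold>\<and> \<alpha>) Xs" for Xs
    using assms
  proof (induction Xs arbitrary: a b \<alpha> \<beta>)
    case Nil
    then have "odd (a * b) \<Longrightarrow> \<alpha> [] = 0" by (auto simp: parity_def)
    then show ?case by (auto simp: wedge_Nil ksign_def mult.commute)
  next
    case (Cons X Xs)
    have 1: "(contr X \<alpha> \<^bold>\<and> \<beta>) Xs = ksign (Suc a * b) (\<beta> \<^bold>\<and> contr X \<alpha>) Xs"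
      by (rule Cons.IH) (use Cons.prems in \<open>auto intro: parity_contr\<close>)
    have 2: "(\<alpha> \<^bold>\<and> contr X \<beta>) Xs = ksign (a * Suc b) (contr X \<beta> \<^bold>\<and> \<alpha>) Xs"
      by (rule Cons.IH) (use Cons.prems in \<open>auto intro: parity_contr\<close>)
    show ?case
      using 1 2 by (cases "even a"; cases "even b")
        (simp_all add: ksign_apply wedge_Cons parity_grade[OF Cons.prems(1)] parity_grade[OF Cons.prems(2)]
          wedge_ksign_left ksign_def add.commute)
  qed
qed

lemma func_form_wedge: "func_form f \<^bold>\<and> \<beta> = smul f \<beta>"
proof
  show "(func_form f \<^bold>\<and> \<beta>) Xs = smul f \<beta> Xs" for Xs
  proof (induction Xs arbitrary: \<beta>)
    case Nil
    show ?case by (simp add: wedge_Nil smul_def func_form_def)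
  next
    case (Cons X Xs)
    then show ?case by (simp add: wedge_Cons) (simp add: smul_def contr_def)
  qed
qed

section \<open>Vector fields and forms on a manifold\<close>

text \<open>The function X f. It turns the pointwise conditions on tangent vectors into identities
  between functions on the manifold.\<close>

definition vapp :: "'p vfield \<Rightarrow> ('p \<Rightarrow> real) \<Rightarrow> 'p \<Rightarrow> real" where
  "vapp X f = (\<lambda>p. X p f)"

lemma vapp_bracket: "vapp (vbracket X Y) f = vapp X (vapp Y f) - vapp Y (vapp X f)"
  by (auto simp: vapp_def vbracket_def)

lemma vapp_add_left: "vapp (X + Y) f = vapp X f + vapp Y f"
  and vapp_diff_left: "vapp (X - Y) f = vapp X f - vapp Y f"
  and vapp_scale_left: "vapp (vscale h X) f = h * vapp X f"
  by (auto simp: vapp_def vscale_def)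

lemma vfield_eqI: "(\<And>f. vapp X f = vapp Y f) \<Longrightarrow> X = Y"
  by (intro ext) (metis vapp_def)

context manifold
begin

abbreviation "V \<equiv> vfields A"

section \<open>Vector fields as derivations of the smooth functions\<close>

lemma vfield_tangent: "X \<in> V \<Longrightarrow> X p \<in> tangent_space A p"
  and vapp_smooth: "X \<in> V \<Longrightarrow> f \<in> C \<Longrightarrow> vapp X f \<in> C"
  by (auto simp: vfields_def vapp_def)

lemma vapp_add: "X \<in> V \<Longrightarrow> f \<in> C \<Longrightarrow> h \<in> C \<Longrightarrow> vapp X (f + h) = vapp X f + vapp X h"
  and vapp_diff: "X \<in> V \<Longrightarrow> f \<in> C \<Longrightarrow> h \<in> C \<Longrightarrow> vapp X (f - h) = vapp X f - vapp X h"
  and vapp_mult: "X \<in> V \<Longrightarrow> f \<in> C \<Longrightarrow> h \<in> C \<Longrightarrow> vapp X (f * h) = vapp X f * h + f * vapp X h"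
  and vapp_zero: "X \<in> V \<Longrightarrow> vapp X 0 = 0"
  and vapp_const: "X \<in> V \<Longrightarrow> vapp X (\<lambda>p. c) = 0"
  and vapp_scale: "X \<in> V \<Longrightarrow> f \<in> C \<Longrightarrow> vapp X (\<lambda>p. c * f p) = (\<lambda>p. c * vapp X f p)"
  and vapp_outside: "X \<in> V \<Longrightarrow> f \<notin> C \<Longrightarrow> vapp X f = 0"
  by (auto simp: fun_eq_iff vapp_def
      dest: tangent_add[OF vfield_tangent] tangent_mult[OF vfield_tangent] tangent_zero[OF vfield_tangent] tangent_const[OF vfield_tangent]
      tangent_scale[OF vfield_tangent] tangent_outside[OF vfield_tangent] tangent_diff[OF vfield_tangent])

lemma vfieldsI:
  assumes "\<And>f. f \<in> C \<Longrightarrow> vapp X f \<in> C"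
    "\<And>f h. f \<in> C \<Longrightarrow> h \<in> C \<Longrightarrow> vapp X (f + h) = vapp X f + vapp X h"
    "\<And>c f. f \<in> C \<Longrightarrow> vapp X (\<lambda>p. c * f p) = (\<lambda>p. c * vapp X f p)"
    "\<And>f h. f \<in> C \<Longrightarrow> h \<in> C \<Longrightarrow> vapp X (f * h) = vapp X f * h + f * vapp X h"
    "\<And>f. f \<notin> C \<Longrightarrow> vapp X f = 0"
  shows "X \<in> V"
  using assms by (auto simp: vfields_def tangent_space_def vapp_def fun_eq_iff)

lemma vfields_add: "X \<in> V \<Longrightarrow> Y \<in> V \<Longrightarrow> X + Y \<in> V"
proof (rule vfieldsI)
  assume XY: "X \<in> V" "Y \<in> V"
  show "vapp (X + Y) f \<in> C" if "f \<in> C" for f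
    using XY that by (simp add: vapp_add_left vapp_smooth smooth_functions_add)
  show "vapp (X + Y) (f + h) = vapp (X + Y) f + vapp (X + Y) h" if "f \<in> C" "h \<in> C" for f h
    using XY that by (simp add: vapp_add_left vapp_add)
  show "vapp (X + Y) (\<lambda>p. c * f p) = (\<lambda>p. c * vapp (X + Y) f p)" if "f \<in> C" for c f
    using XY that by (simp add: vapp_add_left vapp_scale fun_eq_iff distrib_left)
  show "vapp (X + Y) (f * h) = vapp (X + Y) f * h + f * vapp (X + Y) h" if "f \<in> C" "h \<in> C" for f h
    using XY that by (simp add: vapp_add_left vapp_mult distrib_left distrib_right)
  show "vapp (X + Y) f = 0" if "f \<notin> C" for f
    using XY that by (simp add: vapp_add_left vapp_outside)
qed

lemma vfields_vscale: "X \<in> V \<Longrightarrow> k \<in> C \<Longrightarrow> vscale k X \<in> V"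
proof (rule vfieldsI)
  assume XY: "X \<in> V" "k \<in> C"
  show "vapp (vscale k X) f \<in> C" if "f \<in> C" for f
    using XY that by (simp add: vapp_scale_left vapp_smooth smooth_functions_mult)
  show "vapp (vscale k X) (f + h) = vapp (vscale k X) f + vapp (vscale k X) h" if "f \<in> C" "h \<in> C" for f h
    using XY that by (simp add: vapp_scale_left vapp_add distrib_left)
  show "vapp (vscale k X) (\<lambda>p. c * f p) = (\<lambda>p. c * vapp (vscale k X) f p)" if "f \<in> C" for c f
    using XY that by (simp add: vapp_scale_left vapp_scale fun_eq_iff)
  show "vapp (vscale k X) (f * h) = vapp (vscale k X) f * h + f * vapp (vscale k X) h" if "f \<in> C" "h \<in> C" for f h
    using XY that by (simp add: vapp_scale_left vapp_mult distrib_left mult_ac)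
  show "vapp (vscale k X) f = 0" if "f \<notin> C" for f
    using XY that by (simp add: vapp_scale_left vapp_outside)
qed

lemma vfields_diff: "X \<in> V \<Longrightarrow> Y \<in> V \<Longrightarrow> X - Y \<in> V"
proof -
  assume "X \<in> V" "Y \<in> V"
  moreover have "X - Y = X + vscale (\<lambda>p. - 1) Y" by (auto simp: vscale_def fun_eq_iff)
  ultimately show ?thesis using vfields_add vfields_vscale smooth_functions_const by metis
qed

lemma vfields_bracket: "X \<in> V \<Longrightarrow> Y \<in> V \<Longrightarrow> vbracket X Y \<in> V"
proof (rule vfieldsI)
  assume XY: "X \<in> V" "Y \<in> V"
  note s = vapp_bracket vapp_smooth[OF XY(1)] vapp_smooth[OF XY(2)] smooth_functions_diff smooth_functions_add
    smooth_functions_mult smooth_functions_scale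
  note l = vapp_add[OF XY(1)] vapp_add[OF XY(2)] vapp_mult[OF XY(1)] vapp_mult[OF XY(2)]
    vapp_scale[OF XY(1)] vapp_scale[OF XY(2)] vapp_outside[OF XY(1)] vapp_outside[OF XY(2)]
    vapp_zero[OF XY(1)] vapp_zero[OF XY(2)]
  show "vapp (vbracket X Y) f \<in> C" if "f \<in> C" for f using that by (simp add: s)
  show "vapp (vbracket X Y) (f + h) = vapp (vbracket X Y) f + vapp (vbracket X Y) h" if "f \<in> C" "h \<in> C" for f h
    using that by (simp add: s l)
  show "vapp (vbracket X Y) (\<lambda>p. c * f p) = (\<lambda>p. c * vapp (vbracket X Y) f p)" if "f \<in> C" for c f
    using that by (simp add: s l fun_eq_iff algebra_simps)
  show "vapp (vbracket X Y) (f * h) = vapp (vbracket X Y) f * h + f * vapp (vbracket X Y) h" if "f \<in> C" "h \<in> C" for f h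
    using that by (simp add: s l algebra_simps)
  show "vapp (vbracket X Y) f = 0" if "f \<notin> C" for f
    using that by (simp add: s l)
qed

lemma vbracket_add: "X \<in> V \<Longrightarrow> Y \<in> V \<Longrightarrow> Z \<in> V \<Longrightarrow> vbracket X (Y + Z) = vbracket X Y + vbracket X Z"
proof (rule vfield_eqI)
  fix f assume "X \<in> V" "Y \<in> V" "Z \<in> V"
  then show "vapp (vbracket X (Y + Z)) f = vapp (vbracket X Y + vbracket X Z) f"
    by (cases "f \<in> C") (simp_all add: vapp_bracket vapp_add_left vapp_smooth vapp_add vapp_outside vapp_zero)
qed

lemma vbracket_vscale:
  "X \<in> V \<Longrightarrow> Y \<in> V \<Longrightarrow> f \<in> C \<Longrightarrow> vbracket X (vscale f Y) = vscale (vapp X f) Y + vscale f (vbracket X Y)"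
proof (rule vfield_eqI)
  fix h assume "X \<in> V" "Y \<in> V" "f \<in> C"
  then show "vapp (vbracket X (vscale f Y)) h = vapp (vscale (vapp X f) Y + vscale f (vbracket X Y)) h"
    by (cases "h \<in> C") (simp_all add: vapp_bracket vapp_add_left vapp_scale_left vapp_smooth vapp_mult
        vapp_outside vapp_zero algebra_simps)
qed

lemma vbracket_jacobi:
  assumes "X \<in> V" "Y \<in> V" "Z \<in> V"
  shows "vbracket (vbracket X Y) Z = vbracket X (vbracket Y Z) - vbracket Y (vbracket X Z)"
proof (rule vfield_eqI)
  fix f
  show "vapp (vbracket (vbracket X Y) Z) f = vapp (vbracket X (vbracket Y Z) - vbracket Y (vbracket X Z)) f"
    using assms by (cases "f \<in> C")
      (simp_all add: vapp_bracket vapp_diff_left vapp_smooth vapp_diff vapp_outside vapp_zero)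
qed

section \<open>Forms and their closure under the algebraic operations\<close>

lemma formsD:
  assumes "\<omega> \<in> forms A"
  shows "Xs \<in> lists V \<Longrightarrow> \<omega> Xs \<in> C" "Xs \<notin> lists V \<Longrightarrow> \<omega> Xs = 0"
    "Xs \<in> lists V \<Longrightarrow> Ys \<in> lists V \<Longrightarrow> X \<in> V \<Longrightarrow> Y \<in> V \<Longrightarrow>
        \<omega> (Xs @ (X + Y) # Ys) = \<omega> (Xs @ X # Ys) + \<omega> (Xs @ Y # Ys)"
    "Xs \<in> lists V \<Longrightarrow> Ys \<in> lists V \<Longrightarrow> X \<in> V \<Longrightarrow> f \<in> C \<Longrightarrow>
        \<omega> (Xs @ vscale f X # Ys) = f * \<omega> (Xs @ X # Ys)"
    "Xs \<in> lists V \<Longrightarrow> Ys \<in> lists V \<Longrightarrow> Zs \<in> lists V \<Longrightarrow> X \<in> V \<Longrightarrow> \<omega> (Xs @ X # Ys @ X # Zs) = 0"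
    "\<exists>N. \<forall>Xs. length Xs \<ge> N \<longrightarrow> \<omega> Xs = 0"
proof -
  obtain N where N: "\<And>Xs. length Xs > N \<Longrightarrow> \<omega> Xs = 0" using assms by (auto simp: forms_def)
  then show "\<exists>N. \<forall>Xs. length Xs \<ge> N \<longrightarrow> \<omega> Xs = 0" by (intro exI[of _ "Suc N"]) auto
qed (use assms in \<open>auto simp: forms_def\<close>)

text \<open>Alternation need only be checked for neighbouring arguments: expanding at X + Y gives
  skew symmetry in neighbours, and this moves one copy of X next to the other.\<close>

lemma formsI:
  assumes smooth: "\<And>Xs. Xs \<in> lists V \<Longrightarrow> \<omega> Xs \<in> C"
    and outside: "\<And>Xs. Xs \<notin> lists V \<Longrightarrow> \<omega> Xs = 0"
    and add: "\<And>Xs Ys X Y. Xs \<in> lists V \<Longrightarrow> Ys \<in> lists V \<Longrightarrow> X \<in> V \<Longrightarrow> Y \<in> V \<Longrightarrow>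
        \<omega> (Xs @ (X + Y) # Ys) = \<omega> (Xs @ X # Ys) + \<omega> (Xs @ Y # Ys)"
    and scale: "\<And>Xs Ys X f. Xs \<in> lists V \<Longrightarrow> Ys \<in> lists V \<Longrightarrow> X \<in> V \<Longrightarrow> f \<in> C \<Longrightarrow>
        \<omega> (Xs @ vscale f X # Ys) = f * \<omega> (Xs @ X # Ys)"
    and alt: "\<And>Xs Ys X. Xs \<in> lists V \<Longrightarrow> Ys \<in> lists V \<Longrightarrow> X \<in> V \<Longrightarrow> \<omega> (Xs @ X # X # Ys) = 0"
    and bound: "\<exists>N. \<forall>Xs. length Xs \<ge> N \<longrightarrow> \<omega> Xs = 0"
  shows "\<omega> \<in> forms A"
proof -
  have swap: "\<omega> (Xs @ X # Y # Ys) = - \<omega> (Xs @ Y # X # Ys)"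
    if "Xs \<in> lists V" "Ys \<in> lists V" "X \<in> V" "Y \<in> V" for Xs Ys X Y
  proof -
    have "0 = \<omega> (Xs @ (X + Y) # (X + Y) # Ys)" using alt that vfields_add by simp
    also have "\<dots> = \<omega> (Xs @ X # (X + Y) # Ys) + \<omega> (Xs @ Y # (X + Y) # Ys)"
      using add that vfields_add by (simp add: lists.Cons)
    also have "\<dots> = \<omega> (Xs @ X # Y # Ys) + \<omega> (Xs @ Y # X # Ys)"
      using add[of "Xs @ [X]" Ys X Y] add[of "Xs @ [Y]" Ys X Y] alt that by simp
    finally show ?thesis by (simp add: eq_neg_iff_add_eq_0)
  qed
  have alt': "\<omega> (Xs @ X # Ys @ X # Zs) = 0"
    if "Xs \<in> lists V" "Ys \<in> lists V" "Zs \<in> lists V" "X \<in> V" for Xs Ys Zs X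
    using that
  proof (induction Ys arbitrary: Xs)
    case Nil
    then show ?case using alt by simp
  next
    case (Cons Y Ys)
    have "\<omega> (Xs @ X # Y # Ys @ X # Zs) = - \<omega> (Xs @ Y # X # Ys @ X # Zs)"
      using Cons.prems by (intro swap) auto
    also have "\<omega> (Xs @ Y # X # Ys @ X # Zs) = 0" using Cons.IH[of "Xs @ [Y]"] Cons.prems by (simp add: zero_fun_def)
    finally show ?case by simp
  qed
  obtain N where N: "\<And>Xs. length Xs \<ge> N \<Longrightarrow> \<omega> Xs = 0" using bound by blast
  have "\<exists>N. \<forall>Xs. length Xs > N \<longrightarrow> \<omega> Xs = 0" by (intro exI[of _ N]) (simp add: N)
  then show ?thesis unfolding forms_def
    by (intro CollectI conjI ballI allI impI; simp add: smooth outside add scale alt')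
qed

lemma forms_zero: "0 \<in> forms A"
  by (rule formsI) (auto simp: smooth_functions_zero)

lemma forms_add: "\<alpha> \<in> forms A \<Longrightarrow> \<beta> \<in> forms A \<Longrightarrow> \<alpha> + \<beta> \<in> forms A"
proof (rule formsI)
  assume a: "\<alpha> \<in> forms A" "\<beta> \<in> forms A"
  obtain N M where "\<And>Xs. length Xs \<ge> N \<Longrightarrow> \<alpha> Xs = 0" "\<And>Xs. length Xs \<ge> M \<Longrightarrow> \<beta> Xs = 0"
    using a[THEN formsD(6)] by blast
  then show "\<exists>N. \<forall>Xs. N \<le> length Xs \<longrightarrow> (\<alpha> + \<beta>) Xs = 0" by (intro exI[of _ "max N M"]) auto
  show "(\<alpha> + \<beta>) (Xs @ X # X # Ys) = 0" if "Xs \<in> lists V" "Ys \<in> lists V" "X \<in> V" for Xs Ys X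
    using a[THEN formsD(5), of Xs "[]" Ys X] that by simp
qed (auto simp: formsD smooth_functions_add algebra_simps)

lemma forms_smul: "\<alpha> \<in> forms A \<Longrightarrow> f \<in> C \<Longrightarrow> smul f \<alpha> \<in> forms A"
proof (rule formsI)
  assume a: "\<alpha> \<in> forms A" "f \<in> C"
  obtain N where N: "\<And>Xs. length Xs \<ge> N \<Longrightarrow> \<alpha> Xs = 0" using formsD(6)[OF a(1)] by blast
  show "\<exists>N. \<forall>Xs. N \<le> length Xs \<longrightarrow> smul f \<alpha> Xs = 0"
    by (rule exI[of _ N]) (simp add: smul_def N)
  fix Xs Ys X
  show "smul f \<alpha> Xs \<in> C" if "Xs \<in> lists V"
    using formsD(1)[OF a(1) that] a(2) by (simp add: smul_def smooth_functions_mult)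
  show "smul f \<alpha> Xs = 0" if "Xs \<notin> lists V"
    using formsD(2)[OF a(1) that] by (simp add: smul_def fun_eq_iff)
  assume *: "Xs \<in> lists V" "Ys \<in> lists V" "X \<in> V"
  show "smul f \<alpha> (Xs @ X # X # Ys) = 0" 
    using formsD(5)[OF a(1) *(1) _ *(2,3), of "[]"] by (simp add: smul_def fun_eq_iff)
  show "smul f \<alpha> (Xs @ (X + Y) # Ys) = smul f \<alpha> (Xs @ X # Ys) + smul f \<alpha> (Xs @ Y # Ys)" if "Y \<in> V" for Y
    using formsD(3)[OF a(1) * that] by (simp add: smul_def distrib_left)
  show "smul f \<alpha> (Xs @ vscale h X # Ys) = h * smul f \<alpha> (Xs @ X # Ys)" if "h \<in> C" for h
    using formsD(4)[OF a(1) * that] by (simp add: smul_def fun_eq_iff)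
qed

lemma scale_eq_smul: "(\<lambda>Xs p. c * \<alpha> Xs p) = smul (\<lambda>p. c) \<alpha>"
  by (auto simp: smul_def fun_eq_iff)

lemma forms_uminus: "\<alpha> \<in> forms A \<Longrightarrow> - \<alpha> \<in> forms A"
proof -
  assume "\<alpha> \<in> forms A"
  then have "smul (\<lambda>p. - 1) \<alpha> \<in> forms A" by (intro forms_smul smooth_functions_const)
  moreover have "smul (\<lambda>p. - 1) \<alpha> = - \<alpha>" by (auto simp: smul_def fun_eq_iff)
  ultimately show ?thesis by simp
qed

lemma forms_diff: "\<alpha> \<in> forms A \<Longrightarrow> \<beta> \<in> forms A \<Longrightarrow> \<alpha> - \<beta> \<in> forms A"
  using forms_add[of \<alpha> "- \<beta>"] forms_uminus by simp

lemma forms_sum: "(\<And>i. i \<in> I \<Longrightarrow> \<alpha> i \<in> forms A) \<Longrightarrow> sum \<alpha> I \<in> forms A"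
  by (induction I rule: infinite_finite_induct) (auto simp: forms_zero forms_add)

lemma forms_filter_degrees:
  assumes "\<alpha> \<in> forms A"
  shows "(\<lambda>Xs. if P (length Xs) then \<alpha> Xs else 0) \<in> forms A"
proof (rule formsI)
  show "\<exists>N. \<forall>Xs. N \<le> length Xs \<longrightarrow> (if P (length Xs) then \<alpha> Xs else 0) = 0"
    using formsD(6)[OF assms] by auto
  show "(if P (length (Xs @ X # X # Ys)) then \<alpha> (Xs @ X # X # Ys) else 0) = 0"
    if "Xs \<in> lists V" "Ys \<in> lists V" "X \<in> V" for Xs Ys X
    using formsD(5)[OF assms, of Xs "[]" Ys X] that by simp
qed (auto simp: formsD[OF assms] smooth_functions_zero)

lemma forms_fpart: "\<alpha> \<in> forms A \<Longrightarrow> fpart a \<alpha> \<in> forms A"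
  unfolding fpart_def by (rule forms_filter_degrees)

lemma grade_eq: "grade \<alpha> = fpart 0 \<alpha> - fpart 1 \<alpha>"
  by (auto simp: grade_def fpart_def ksign_def fun_eq_iff)

lemma forms_grade: "\<alpha> \<in> forms A \<Longrightarrow> grade \<alpha> \<in> forms A"
  unfolding grade_eq by (intro forms_diff forms_fpart)

lemma forms_contr: "\<alpha> \<in> forms A \<Longrightarrow> X \<in> V \<Longrightarrow> contr X \<alpha> \<in> forms A"
proof (rule formsI)
  assume a: "\<alpha> \<in> forms A" "X \<in> V"
  obtain N where N: "\<And>Xs. length Xs \<ge> N \<Longrightarrow> \<alpha> Xs = 0" using formsD(6)[OF a(1)] by blast
  show "\<exists>N. \<forall>Xs. N \<le> length Xs \<longrightarrow> contr X \<alpha> Xs = 0"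
    by (rule exI[of _ N]) (auto simp: contr_def intro: N)
  show "contr X \<alpha> (Xs @ Y # Y # Ys) = 0" if "Xs \<in> lists V" "Ys \<in> lists V" "Y \<in> V" for Xs Ys Y
    using formsD(5)[OF a(1), of "X # Xs" "[]" Ys Y] that a by (simp add: contr_def)
  fix Xs Ys Y
  assume "Xs \<in> lists V" "Ys \<in> lists V" "Y \<in> V"
  then show "contr X \<alpha> (Xs @ (Y + Z) # Ys) = contr X \<alpha> (Xs @ Y # Ys) + contr X \<alpha> (Xs @ Z # Ys)" if "Z \<in> V" for Z
    using formsD(3)[OF a(1), of "X # Xs" Ys Y Z] that a by (simp add: contr_def)
  show "contr X \<alpha> (Xs @ vscale f Y # Ys) = f * contr X \<alpha> (Xs @ Y # Ys)" if "f \<in> C" for f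
    using formsD(4)[OF a(1), of "X # Xs" Ys Y f] that a \<open>Xs \<in> _\<close> \<open>Ys \<in> _\<close> \<open>Y \<in> _\<close> by (simp add: contr_def)
qed (auto simp: contr_def formsD)

lemma contr_outside: "\<alpha> \<in> forms A \<Longrightarrow> X \<notin> V \<Longrightarrow> contr X \<alpha> = 0"
  by (auto simp: contr_def formsD fun_eq_iff)

lemma contr_add_field: "\<alpha> \<in> forms A \<Longrightarrow> X \<in> V \<Longrightarrow> Y \<in> V \<Longrightarrow> contr (X + Y) \<alpha> = contr X \<alpha> + contr Y \<alpha>"
proof
  fix Xs assume "\<alpha> \<in> forms A" "X \<in> V" "Y \<in> V"
  then show "contr (X + Y) \<alpha> Xs = (contr X \<alpha> + contr Y \<alpha>) Xs"
    using formsD(3)[of \<alpha> "[]" Xs X Y] by (cases "Xs \<in> lists V") (auto simp: contr_def formsD(2))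
qed

lemma contr_vscale: "\<alpha> \<in> forms A \<Longrightarrow> X \<in> V \<Longrightarrow> f \<in> C \<Longrightarrow> contr (vscale f X) \<alpha> = smul f (contr X \<alpha>)"
proof
  fix Xs assume "\<alpha> \<in> forms A" "X \<in> V" "f \<in> C"
  then show "contr (vscale f X) \<alpha> Xs = smul f (contr X \<alpha>) Xs"
    using formsD(4)[of \<alpha> "[]" Xs X f] by (cases "Xs \<in> lists V") (auto simp: contr_def smul_def formsD(2))
qed

lemma contr_contr_same: "\<alpha> \<in> forms A \<Longrightarrow> contr X (contr X \<alpha>) = 0"
proof
  fix Xs assume a: "\<alpha> \<in> forms A"
  show "contr X (contr X \<alpha>) Xs = 0 Xs"
  proof (cases "X # X # Xs \<in> lists V")
    case True
    then show ?thesis using formsD(5)[OF a, of "[]" "[]" Xs X] by (simp add: contr_def zero_fun_def)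
  next
    case False
    then show ?thesis using formsD(2)[OF a False] by (simp add: contr_def zero_fun_def)
  qed
qed

lemma contr_swap: "\<alpha> \<in> forms A \<Longrightarrow> contr X (contr Y \<alpha>) = - contr Y (contr X \<alpha>)"
proof (cases "X \<in> V \<and> Y \<in> V")
  case True
  assume a: "\<alpha> \<in> forms A"
  have "0 = contr (X + Y) (contr (X + Y) \<alpha>)" using a contr_contr_same by simp
  also have "\<dots> = contr X (contr Y \<alpha>) + contr Y (contr X \<alpha>)"
    using a True by (simp add: contr_add_field forms_contr vfields_add forms_add contr_contr_same)
  finally show ?thesis by (simp add: eq_neg_iff_add_eq_0)
next
  case False
  assume a: "\<alpha> \<in> forms A"
  have "contr X (contr Y \<alpha>) = 0" "contr Y (contr X \<alpha>) = 0"
    using a False by (auto simp: contr_def formsD(2) fun_eq_iff)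
  then show ?thesis by simp
qed

text \<open>Contracting both sides reduces an identity of forms to one in lower degree, and finally
  to one of functions.\<close>

lemma form_eqI:
  assumes "\<alpha> \<in> forms A" "\<beta> \<in> forms A" "\<alpha> [] = \<beta> []" "\<And>X. X \<in> V \<Longrightarrow> contr X \<alpha> = contr X \<beta>"
  shows "\<alpha> = \<beta>"
proof
  fix Xs show "\<alpha> Xs = \<beta> Xs"
  proof (cases Xs)
    case (Cons X Ys)
    have "contr X \<alpha> = contr X \<beta>" using assms contr_outside by (cases "X \<in> V") auto
    from fun_cong[OF this, of Ys] show ?thesis by (simp add: Cons contr_def)
  qed (use assms in simp)
qed

lemma func_form_forms: "f \<in> C \<Longrightarrow> func_form f \<in> forms A"
proof (rule formsI)
  show "\<exists>N. \<forall>Xs. N \<le> length Xs \<longrightarrow> func_form f Xs = 0"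
    by (rule exI[of _ 1]) (auto simp: func_form_def)
qed (auto simp: func_form_def smooth_functions_zero)

lemma forms_wedge:
  assumes "\<alpha> \<in> forms A" "\<beta> \<in> forms A"
  shows "\<alpha> \<^bold>\<and> \<beta> \<in> forms A"
proof (rule formsI)
  fix Xs
  show "(\<alpha> \<^bold>\<and> \<beta>) Xs \<in> C" if "Xs \<in> lists V"
    using that assms
    by (induction Xs arbitrary: \<alpha> \<beta>)
      (auto simp: wedge_Nil wedge_Cons formsD forms_contr forms_grade intro!: smooth_functions_mult smooth_functions_add)
  show "(\<alpha> \<^bold>\<and> \<beta>) Xs = 0" if "Xs \<notin> lists V"
    using that assms
  proof (induction Xs arbitrary: \<alpha> \<beta>)
    case (Cons X Xs)
    show ?case
    proof (cases "X \<in> V")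
      case True
      then show ?thesis using Cons by (simp add: wedge_Cons forms_contr forms_grade)
    qed (use Cons.prems in \<open>simp add: wedge_Cons contr_outside\<close>)
  qed simp
  fix Ys X Y f
  assume Xs: "Xs \<in> lists V" and Ys: "Ys \<in> lists V" and X: "X \<in> V"
  show "(\<alpha> \<^bold>\<and> \<beta>) (Xs @ (X + Y) # Ys) = (\<alpha> \<^bold>\<and> \<beta>) (Xs @ X # Ys) + (\<alpha> \<^bold>\<and> \<beta>) (Xs @ Y # Ys)" if "Y \<in> V"
    using Xs assms
    by (induction Xs arbitrary: \<alpha> \<beta>)
      (use that X in \<open>auto simp: wedge_Cons contr_add_field wedge_add_left wedge_add_right forms_contr forms_grade\<close>)
  show "(\<alpha> \<^bold>\<and> \<beta>) (Xs @ vscale f X # Ys) = f * (\<alpha> \<^bold>\<and> \<beta>) (Xs @ X # Ys)" if "f \<in> C"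
    using Xs assms
  proof (induction Xs arbitrary: \<alpha> \<beta>)
    case Nil
    then show ?case
      using that X by (simp add: wedge_Cons contr_vscale wedge_smul_left wedge_smul_right)
        (simp add: smul_def distrib_left)
  next
    case (Cons Z Zs)
    then show ?case by (simp add: wedge_Cons forms_contr forms_grade distrib_left)
  qed
  show "(\<alpha> \<^bold>\<and> \<beta>) (Xs @ X # X # Ys) = 0"
    using Xs assms
  proof (induction Xs arbitrary: \<alpha> \<beta>)
    case Nil
    then have "contr X (contr X (\<alpha> \<^bold>\<and> \<beta>)) = 0"
      by (simp add: contr_wedge contr_contr_same)
    from fun_cong[OF this, of Ys] show ?case by (simp add: contr_def)
  next
    case (Cons Z Zs)
    then show ?case by (simp add: wedge_Cons[of _ _ Z] forms_contr forms_grade)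
  qed
next
  \<comment> \<open>A contraction lowers the bound of one factor by one, and a factor with bound 0
    is zero; so N + M is a bound that the induction can carry.\<close>
  have "(\<alpha> \<^bold>\<and> \<beta>) Xs = 0" 
    if "\<And>Xs. length Xs \<ge> N \<Longrightarrow> \<alpha> Xs = 0" "\<And>Xs. length Xs \<ge> M \<Longrightarrow> \<beta> Xs = 0" "length Xs \<ge> N + M" for N M Xs
    using that
  proof (induction Xs arbitrary: \<alpha> \<beta> N M)
    case Nil
    have "\<alpha> [] = 0" using Nil.prems(1)[of "[]"] Nil.prems(3) by (simp add: zero_fun_def)
    then show ?case by (simp only: wedge_Nil mult_zero_left)
  next
    case (Cons X Xs)
    have "(contr X \<alpha> \<^bold>\<and> \<beta>) Xs = 0"
    proof (cases N)
      case 0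
      then have "contr X \<alpha> = 0" using Cons.prems(1) by (auto simp: contr_def fun_eq_iff)
      then show ?thesis by simp
    next
      case (Suc n)
      show ?thesis by (rule Cons.IH[of n _ M]) (use Cons.prems Suc in \<open>auto simp: contr_def\<close>)
    qed
    moreover have "(grade \<alpha> \<^bold>\<and> contr X \<beta>) Xs = 0"
    proof (cases M)
      case 0
      then have "contr X \<beta> = 0" using Cons.prems(2) by (auto simp: contr_def fun_eq_iff)
      then show ?thesis by simp
    next
      case (Suc m)
      show ?thesis by (rule Cons.IH[of N _ m]) (use Cons.prems Suc in \<open>auto simp: contr_def grade_def ksign_def fun_eq_iff\<close>)
    qed
    ultimately show ?case by (simp add: wedge_Cons)
  qed
  then show "\<exists>N. \<forall>Xs. N \<le> length Xs \<longrightarrow> (\<alpha> \<^bold>\<and> \<beta>) Xs = 0"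
    using formsD(6)[OF assms(1)] formsD(6)[OF assms(2)] by metis
qed

section \<open>Homogeneous forms and the projections to them\<close>

lemma pforms_iff: "\<alpha> \<in> pforms A a \<longleftrightarrow> \<alpha> \<in> forms A \<and> parity a \<alpha>"
  by (auto simp: pforms_def parity_def)

lemma pforms_wedge: "\<alpha> \<in> pforms A a \<Longrightarrow> \<beta> \<in> pforms A b \<Longrightarrow> \<alpha> \<^bold>\<and> \<beta> \<in> pforms A (a + b)"
  by (simp add: pforms_iff forms_wedge parity_wedge)

lemma pforms_cong: "even (a + b) \<Longrightarrow> pforms A a = pforms A b"
  unfolding pforms_def by fastforce

lemma pforms_add: "\<alpha> \<in> pforms A a \<Longrightarrow> \<beta> \<in> pforms A a \<Longrightarrow> \<alpha> + \<beta> \<in> pforms A a"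
  by (auto simp: pforms_iff forms_add parity_def)

lemma pforms_uminus: "\<alpha> \<in> pforms A a \<Longrightarrow> - \<alpha> \<in> pforms A a"
  by (auto simp: pforms_iff forms_uminus parity_def)

lemma pforms_zero: "0 \<in> pforms A a"
  by (simp add: pforms_iff forms_zero parity_def)

lemma func_form_pforms: "f \<in> C \<Longrightarrow> func_form f \<in> pforms A 0"
  unfolding pforms_iff using func_form_forms by (auto simp: parity_def func_form_def)

lemma pforms_fpart: "\<alpha> \<in> forms A \<Longrightarrow> fpart a \<alpha> \<in> pforms A a"
  by (auto simp: pforms_iff forms_fpart) (auto simp: parity_def fpart_def)

lemma fpart_pforms: "\<alpha> \<in> pforms A a \<Longrightarrow> fpart b \<alpha> = (if even (a + b) then \<alpha> else 0)"
  by (auto simp: pforms_def fpart_def fun_eq_iff)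

lemma fpart_decompose: "fpart 0 \<alpha> + fpart (Suc 0) \<alpha> = \<alpha>"
  by (auto simp: fpart_def fun_eq_iff)

section \<open>Graded derivations\<close>

lemma pders_pforms: "D \<in> pders A a \<Longrightarrow> \<alpha> \<in> pforms A b \<Longrightarrow> D \<alpha> \<in> pforms A (a + b)"
  and pders_add_arg: "D \<in> pders A a \<Longrightarrow> \<alpha> \<in> forms A \<Longrightarrow> \<beta> \<in> forms A \<Longrightarrow> D (\<alpha> + \<beta>) = D \<alpha> + D \<beta>"
  and pders_outside: "D \<in> pders A a \<Longrightarrow> \<gamma> \<notin> forms A \<Longrightarrow> D \<gamma> = 0"
  by (auto simp: pders_def)

lemma pders_smul_const: "D \<in> pders A a \<Longrightarrow> \<alpha> \<in> forms A \<Longrightarrow> D (smul (\<lambda>p. c) \<alpha>) = smul (\<lambda>p. c) (D \<alpha>)"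
  unfolding scale_eq_smul[symmetric] by (simp add: pders_def)

lemma pders_wedge: "D \<in> pders A a \<Longrightarrow> \<alpha> \<in> pforms A b \<Longrightarrow> \<beta> \<in> forms A \<Longrightarrow>
    D (\<alpha> \<^bold>\<and> \<beta>) = D \<alpha> \<^bold>\<and> \<beta> + ksign (a * b) (\<alpha> \<^bold>\<and> D \<beta>)"
  by (simp add: pders_def ksign_def)

lemma pdersI:
  assumes "\<And>b \<alpha>. \<alpha> \<in> pforms A b \<Longrightarrow> D \<alpha> \<in> pforms A (a + b)"
    "\<And>\<alpha> \<beta>. \<alpha> \<in> forms A \<Longrightarrow> \<beta> \<in> forms A \<Longrightarrow> D (\<alpha> + \<beta>) = D \<alpha> + D \<beta>"
    "\<And>c \<alpha>. \<alpha> \<in> forms A \<Longrightarrow> D (smul (\<lambda>p. c) \<alpha>) = smul (\<lambda>p. c) (D \<alpha>)"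
    "\<And>b \<alpha> \<beta>. \<alpha> \<in> pforms A b \<Longrightarrow> \<beta> \<in> forms A \<Longrightarrow> D (\<alpha> \<^bold>\<and> \<beta>) = D \<alpha> \<^bold>\<and> \<beta> + ksign (a * b) (\<alpha> \<^bold>\<and> D \<beta>)"
    "\<And>\<alpha>. \<alpha> \<notin> forms A \<Longrightarrow> D \<alpha> = 0"
  shows "D \<in> pders A a"
  unfolding pders_def using assms by (intro CollectI conjI allI ballI impI; simp add: scale_eq_smul ksign_def)

lemma pders_zero_arg: "D \<in> pders A a \<Longrightarrow> D 0 = 0"
  using pders_add_arg[of D a 0 0] forms_zero by simp

lemma pders_uminus_arg: "D \<in> pders A a \<Longrightarrow> \<alpha> \<in> forms A \<Longrightarrow> D (- \<alpha>) = - D \<alpha>"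
  using pders_add_arg[of D a \<alpha> "- \<alpha>"] forms_uminus[of \<alpha>] pders_zero_arg[of D a]
  by (simp add: eq_neg_iff_add_eq_0 add.commute)

lemma pders_diff_arg: "D \<in> pders A a \<Longrightarrow> \<alpha> \<in> forms A \<Longrightarrow> \<beta> \<in> forms A \<Longrightarrow> D (\<alpha> - \<beta>) = D \<alpha> - D \<beta>"
  using pders_add_arg[of D a \<alpha> "- \<beta>"] forms_uminus[of \<beta>] pders_uminus_arg[of D a \<beta>] by simp

lemma pders_sum_arg: "D \<in> pders A a \<Longrightarrow> (\<And>i. i \<in> I \<Longrightarrow> \<alpha> i \<in> forms A) \<Longrightarrow> D (sum \<alpha> I) = (\<Sum>i\<in>I. D (\<alpha> i))"
proof -
  assume D: "D \<in> pders A a"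
  show "(\<And>i. i \<in> I \<Longrightarrow> \<alpha> i \<in> forms A) \<Longrightarrow> D (sum \<alpha> I) = (\<Sum>i\<in>I. D (\<alpha> i))"
    by (induction I rule: infinite_finite_induct)
      (simp_all add: pders_zero_arg[OF D] pders_add_arg[OF D] forms_sum)
qed

lemma pders_smul: "D \<in> pders A a \<Longrightarrow> f \<in> C \<Longrightarrow> \<alpha> \<in> forms A \<Longrightarrow>
    D (smul f \<alpha>) = D (func_form f) \<^bold>\<and> \<alpha> + smul f (D \<alpha>)"
  using pders_wedge[of D a "func_form f" 0 \<alpha>] func_form_pforms[of f] by (simp add: func_form_wedge)

lemma pders_cong: "even (a + b) \<Longrightarrow> pders A a = pders A b"
proof -
  have "pders A a \<subseteq> pders A b" if "even (a + b)" for a b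
  proof
    fix D assume D: "D \<in> pders A a"
    show "D \<in> pders A b"
    proof (rule pdersI)
      fix c \<alpha> assume "\<alpha> \<in> pforms A c"
      moreover have "pforms A (a + c) = pforms A (b + c)" using that by (intro pforms_cong) simp
      ultimately show "D \<alpha> \<in> pforms A (b + c)" using pders_pforms[OF D] by blast
    next
      fix c \<alpha> \<beta> assume "\<alpha> \<in> pforms A c" "\<beta> \<in> forms A"
      moreover have "ksign (a * c) x = ksign (b * c) x" for x :: "'p form" using that by (intro ksign_cong) auto
      ultimately show "D (\<alpha> \<^bold>\<and> \<beta>) = D \<alpha> \<^bold>\<and> \<beta> + ksign (b * c) (\<alpha> \<^bold>\<and> D \<beta>)"
        using pders_wedge[OF D] by metis
    qed (simp_all add: pders_add_arg[OF D] pders_smul_const[OF D] pders_outside[OF D])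
  qed
  from this[of a b] this[of b a] show "even (a + b) \<Longrightarrow> pders A a = pders A b" by (auto simp: add.commute)
qed

lemma pders_zero: "0 \<in> pders A a"
  by (rule pdersI) (auto simp: pforms_zero smul_simps)

lemma pders_add: "D \<in> pders A a \<Longrightarrow> E \<in> pders A a \<Longrightarrow> D + E \<in> pders A a"
proof (rule pdersI)
  assume D: "D \<in> pders A a" and E: "E \<in> pders A a"
  note pders_add_arg[OF D] pders_add_arg[OF E] pders_smul_const[OF D] pders_smul_const[OF E] pders_wedge[OF D] pders_wedge[OF E]
    pders_outside[OF D] pders_outside[OF E] pders_pforms[OF D] pders_pforms[OF E]
  note [simp] = this
  show "(D + E) \<alpha> \<in> pforms A (a + b)" if "\<alpha> \<in> pforms A b" for \<alpha> b using that by (simp add: pforms_add)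
  show "(D + E) (\<alpha> + \<beta>) = (D + E) \<alpha> + (D + E) \<beta>" if "\<alpha> \<in> forms A" "\<beta> \<in> forms A" for \<alpha> \<beta> using that by simp
  show "(D + E) (smul (\<lambda>p. c) \<alpha>) = smul (\<lambda>p. c) ((D + E) \<alpha>)" if "\<alpha> \<in> forms A" for \<alpha> c using that by (simp add: smul_simps)
  show "(D + E) (\<alpha> \<^bold>\<and> \<beta>) = (D + E) \<alpha> \<^bold>\<and> \<beta> + ksign (a * b) (\<alpha> \<^bold>\<and> (D + E) \<beta>)"
    if "\<alpha> \<in> pforms A b" "\<beta> \<in> forms A" for \<alpha> \<beta> b
    using that by (simp add: wedge_add_left wedge_add_right ksign_add)
  show "(D + E) \<alpha> = 0" if "\<alpha> \<notin> forms A" for \<alpha> using that by simp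
qed

lemma pders_uminus: "D \<in> pders A a \<Longrightarrow> - D \<in> pders A a"
proof (rule pdersI)
  assume D: "D \<in> pders A a"
  note [simp] = pders_add_arg[OF D] pders_smul_const[OF D] pders_wedge[OF D] pders_outside[OF D] pders_pforms[OF D]
  show "(- D) \<alpha> \<in> pforms A (a + b)" if "\<alpha> \<in> pforms A b" for \<alpha> b using that by (simp add: pforms_uminus)
  show "(- D) (\<alpha> + \<beta>) = (- D) \<alpha> + (- D) \<beta>" if "\<alpha> \<in> forms A" "\<beta> \<in> forms A" for \<alpha> \<beta> using that by simp
  show "(- D) (smul (\<lambda>p. c) \<alpha>) = smul (\<lambda>p. c) ((- D) \<alpha>)" if "\<alpha> \<in> forms A" for \<alpha> c using that by (simp add: smul_simps)
  show "(- D) (\<alpha> \<^bold>\<and> \<beta>) = (- D) \<alpha> \<^bold>\<and> \<beta> + ksign (a * b) (\<alpha> \<^bold>\<and> (- D) \<beta>)"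
    if "\<alpha> \<in> pforms A b" "\<beta> \<in> forms A" for \<alpha> \<beta> b
    using that by simp
  show "(- D) \<alpha> = 0" if "\<alpha> \<notin> forms A" for \<alpha> using that by simp
qed

lemma pders_diff: "D \<in> pders A a \<Longrightarrow> E \<in> pders A a \<Longrightarrow> D - E \<in> pders A a"
  using pders_add[of D a "- E"] pders_uminus by simp

lemma pders_ksign: "D \<in> pders A a \<Longrightarrow> ksign n D \<in> pders A a"
  by (simp add: ksign_def pders_uminus)

lemma pders_sum: "(\<And>i. i \<in> I \<Longrightarrow> D i \<in> pders A a) \<Longrightarrow> sum D I \<in> pders A a"
  by (induction I rule: infinite_finite_induct) (auto simp: pders_zero pders_add)

lemma pders_lmult:
  assumes \<alpha>: "\<alpha> \<in> pforms A a" and D: "D \<in> pders A b"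
  shows "\<alpha> \<cdot> D \<in> pders A (a + b)"
proof (rule pdersI)
  fix c \<beta> assume "\<beta> \<in> pforms A c"
  then show "(\<alpha> \<cdot> D) \<beta> \<in> pforms A (a + b + c)"
    using pforms_wedge[OF \<alpha> pders_pforms[OF D]] by (simp add: lmult_def add.assoc)
next
  fix c \<beta> \<gamma> assume \<beta>: "\<beta> \<in> pforms A c" and \<gamma>: "\<gamma> \<in> forms A"
  have "\<alpha> \<^bold>\<and> \<beta> = ksign (a * c) (\<beta> \<^bold>\<and> \<alpha>)" using \<alpha> \<beta> by (auto simp: pforms_iff intro: wedge_commute)
  then have "\<alpha> \<^bold>\<and> \<beta> \<^bold>\<and> D \<gamma> = ksign (a * c) (\<beta> \<^bold>\<and> \<alpha> \<^bold>\<and> D \<gamma>)"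
    by (metis wedge_assoc wedge_ksign_left)
  then show "(\<alpha> \<cdot> D) (\<beta> \<^bold>\<and> \<gamma>) = (\<alpha> \<cdot> D) \<beta> \<^bold>\<and> \<gamma> + ksign ((a + b) * c) (\<beta> \<^bold>\<and> (\<alpha> \<cdot> D) \<gamma>)"
    by (simp add: lmult_def pders_wedge[OF D \<beta> \<gamma>] wedge_add_right wedge_assoc wedge_ksign_right distrib_right add.commute)
qed (auto simp: lmult_def pders_add_arg[OF D] wedge_add_right pders_smul_const[OF D] wedge_smul_right pders_outside[OF D])

lemma lmult_simps:
  "(\<alpha> + \<beta>) \<cdot> D = \<alpha> \<cdot> D + \<beta> \<cdot> D" "\<alpha> \<cdot> (D + E) = \<alpha> \<cdot> D + \<alpha> \<cdot> E" "(- \<alpha>) \<cdot> D = - (\<alpha> \<cdot> D)" "\<alpha> \<cdot> (- D) = - (\<alpha> \<cdot> D)"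
  "(\<alpha> - \<beta>) \<cdot> D = \<alpha> \<cdot> D - \<beta> \<cdot> D" "\<alpha> \<cdot> (D - E) = \<alpha> \<cdot> D - \<alpha> \<cdot> E" "0 \<cdot> D = 0" "\<alpha> \<cdot> (0 :: 'b der) = 0"
  "\<alpha> \<cdot> \<beta> \<cdot> D = (\<alpha> \<^bold>\<and> \<beta>) \<cdot> D"
  "ksign n \<alpha> \<cdot> D = ksign n (\<alpha> \<cdot> D)" "\<alpha> \<cdot> ksign n D = ksign n (\<alpha> \<cdot> D)"
  for \<alpha> \<beta> :: "'b form"
  by (auto simp: lmult_def fun_eq_iff wedge_add_left wedge_add_right wedge_diff_left wedge_diff_right wedge_assoc ksign_def
      wedge_minus_left wedge_minus_right)

lemma pders_ders: "D \<in> pders A a \<Longrightarrow> D \<in> ders A"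
proof -
  assume D: "D \<in> pders A a"
  consider "D \<in> pders A 0" | "D \<in> pders A 1" using D pders_cong[of a 0] pders_cong[of a 1] by fastforce
  then show ?thesis
  proof cases
    case 1
    then have "D + 0 \<in> ders A" unfolding ders_def using pders_zero by blast
    then show ?thesis by simp
  next
    case 2
    then have "0 + D \<in> ders A" unfolding ders_def using pders_zero by blast
    then show ?thesis by simp
  qed
qed

section \<open>Sign formulas for homogeneous derivations\<close>

lemma dpart_pders: "D \<in> pders A a \<Longrightarrow> dpart A b D = (if even (a + b) then D else 0)"
proof
  fix \<alpha> assume D: "D \<in> pders A a"
  have even_shift: "even (a + b) \<longleftrightarrow> even (a + c + (b + c))" for c by presburger
  show "dpart A b D \<alpha> = (if even (a + b) then D else 0) \<alpha>"
  proof (cases "\<alpha> \<in> forms A")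
    case True
    have "fpart (b + c) (D (fpart c \<alpha>)) = (if even (a + b) then D (fpart c \<alpha>) else 0)" for c
      unfolding even_shift[of c]
      using fpart_pforms[OF pders_pforms[OF D pforms_fpart[OF True, of c]], of "b + c"] by blast
    moreover have "D (fpart 0 \<alpha>) + D (fpart (Suc 0) \<alpha>) = D \<alpha>"
      using pders_add_arg[OF D forms_fpart forms_fpart, OF True True, of 0 "Suc 0"] by (simp add: fpart_decompose)
    ultimately show ?thesis using True by (simp add: dpart_def numeral_2_eq_2 lessThan_Suc add.commute)
  qed (simp add: dpart_def pders_outside[OF D])
qed

lemma sum_lessThan_2: "(\<Sum>a<(2::nat). f a) = f 0 + f 1"
  by (simp add: numeral_2_eq_2)

text \<open>Exactly one of the two homogeneous parts of a homogeneous argument survives. This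
  collapses the sums in \<open>rmult\<close>, \<open>gcommutator\<close> and
  \<open>graded_curvature\<close>.\<close>

lemma sum_parity: 
  assumes "\<And>b. odd (a + b) \<Longrightarrow> f b = 0" "\<And>b. even (a + b) \<Longrightarrow> f b = c"
  shows "(\<Sum>b<(2::nat). f b) = (c :: 'b :: comm_monoid_add)"
proof (cases "even a")
  case True
  then show ?thesis using assms(1)[of 1] assms(2)[of 0] by (simp add: sum_lessThan_2)
next
  case False
  then show ?thesis using assms(1)[of 0] assms(2)[of 1] by (simp add: sum_lessThan_2)
qed

lemma rmult_pders:
  assumes "X \<in> pders A a" "\<alpha> \<in> pforms A b"
  shows "rmult A X \<alpha> = ksign (a * b) (\<alpha> \<cdot> X)"
  unfolding rmult_def
proof (rule sum_parity[of a])
  fix a' assume "even (a + a')"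
  show "(\<Sum>b<2. ksign (a' * b) (fpart b \<alpha> \<cdot> dpart A a' X)) = ksign (a * b) (\<alpha> \<cdot> X)"
  proof (rule sum_parity[of b])
    fix b' assume "even (b + b')"
    then show "ksign (a' * b') (fpart b' \<alpha> \<cdot> dpart A a' X) = ksign (a * b) (\<alpha> \<cdot> X)"
      using \<open>even (a + a')\<close> by (simp add: fpart_pforms[OF assms(2)] dpart_pders[OF assms(1)]) (rule ksign_cong, auto)
  qed (simp add: fpart_pforms[OF assms(2)] lmult_simps)
qed (simp add: dpart_pders[OF assms(1)] lmult_simps)

lemma gcommutator_pders:
  assumes X: "X \<in> pders A a" and Y: "Y \<in> pders A b"
  shows "gcommutator A X Y = (X \<circ> Y) - ksign (a * b) (Y \<circ> X)"
proof -
  have z: "X \<circ> 0 = 0" "Y \<circ> 0 = 0" "0 \<circ> F = 0" for F :: "'p der"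
    using pders_zero_arg[OF X] pders_zero_arg[OF Y] by (auto simp: fun_eq_iff)
  have inner: "(\<Sum>b<2. (dpart A a' X \<circ> dpart A b Y) - ksign (a' * b) (dpart A b Y \<circ> dpart A a' X)) =
      (X \<circ> Y) - ksign (a * b) (Y \<circ> X)" if "even (a + a')" for a'
  proof (rule sum_parity[of b])
    fix b' assume "even (b + b')"
    then show "(dpart A a' X \<circ> dpart A b' Y) - ksign (a' * b') (dpart A b' Y \<circ> dpart A a' X) = (X \<circ> Y) - ksign (a * b) (Y \<circ> X)"
      using that by (auto simp: dpart_pders[OF X] dpart_pders[OF Y] ksign_def)
  next
    fix b' assume "odd (b + b')"
    then show "(dpart A a' X \<circ> dpart A b' Y) - ksign (a' * b') (dpart A b' Y \<circ> dpart A a' X) = 0"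
      using that by (simp add: dpart_pders[OF X] dpart_pders[OF Y] z)
  qed
  have outer: "(\<Sum>b<2. (dpart A a' X \<circ> dpart A b Y) - ksign (a' * b) (dpart A b Y \<circ> dpart A a' X)) = 0"
    if "odd (a + a')" for a'
    using that by (auto simp: sum_lessThan_2 dpart_pders[OF X] dpart_pders[OF Y] z)
  show ?thesis
    unfolding gcommutator_def by (rule sum_parity[of a]) (use inner outer in auto)
qed

section \<open>Interior products, Lie derivatives and exterior derivatives\<close>

abbreviation "L \<equiv> lie_der A"
abbreviation "i \<equiv> int_prod A"

section \<open>Interior products\<close>

lemma int_prod_eq: "\<omega> \<in> forms A \<Longrightarrow> i X \<omega> = contr X \<omega>"
  by (simp add: int_prod_def contr_def)

lemma int_prod_pders: "X \<in> V \<Longrightarrow> i X \<in> pders A 1"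
proof (rule pdersI)
  assume X: "X \<in> V"
  show "i X \<alpha> \<in> pforms A (1 + b)" if "\<alpha> \<in> pforms A b" for \<alpha> b
    using that X parity_contr[of b \<alpha> X] by (simp add: pforms_iff int_prod_eq forms_contr)
  show "i X (\<alpha> \<^bold>\<and> \<beta>) = i X \<alpha> \<^bold>\<and> \<beta> + ksign (1 * b) (\<alpha> \<^bold>\<and> i X \<beta>)"
    if "\<alpha> \<in> pforms A b" "\<beta> \<in> forms A" for \<alpha> \<beta> b
    using that by (simp add: pforms_iff int_prod_eq forms_wedge contr_wedge parity_grade[of b \<alpha>] wedge_ksign_left)
  show "i X (\<alpha> + \<beta>) = i X \<alpha> + i X \<beta>" if "\<alpha> \<in> forms A" "\<beta> \<in> forms A" for \<alpha> \<beta>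
    using that by (simp add: int_prod_eq forms_add)
  show "i X (smul (\<lambda>p. c) \<alpha>) = smul (\<lambda>p. c) (i X \<alpha>)" if "\<alpha> \<in> forms A" for c \<alpha>
    using that by (simp add: int_prod_eq forms_smul smooth_functions_const)
  show "i X \<alpha> = 0" if "\<alpha> \<notin> forms A" for \<alpha> using that by (simp add: int_prod_def)
qed

section \<open>Lie derivatives\<close>

lemma lie_der_Nil: "\<omega> \<in> forms A \<Longrightarrow> L X \<omega> [] = vapp X (\<omega> [])"
  by (auto simp: lie_der_def vapp_def)

lemma lie_der_not_form: "\<omega> \<notin> forms A \<Longrightarrow> L X \<omega> = 0"
  by (simp add: lie_der_def)

lemma lie_der_outside: "Xs \<notin> lists V \<Longrightarrow> L X \<omega> Xs = 0"
  by (auto simp: lie_der_def)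

text \<open>Cartan's relation [L_X, i_Y] = i_[X,Y], read as a recursion for the Lie derivative on
  the first argument. It plays the role that \<open>contr_wedge\<close> plays for the wedge
  product.\<close>

lemma contr_lie_der:
  assumes "\<omega> \<in> forms A" "X \<in> V" "Y \<in> V"
  shows "contr Y (L X \<omega>) = L X (contr Y \<omega>) - contr (vbracket X Y) \<omega>"
proof
  fix Xs
  show "contr Y (L X \<omega>) Xs = (L X (contr Y \<omega>) - contr (vbracket X Y) \<omega>) Xs"
  proof (cases "Xs \<in> lists V")
    case True
    have "(\<Sum>i<length (Y # Xs). \<omega> ((Y # Xs)[i := vbracket X ((Y # Xs) ! i)]) p) =
        \<omega> (vbracket X Y # Xs) p + (\<Sum>i<length Xs. \<omega> (Y # Xs[i := vbracket X (Xs ! i)]) p)" for p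
      by (simp add: sum.lessThan_Suc_shift del: sum.lessThan_Suc)
    then show ?thesis
      using assms True forms_contr[OF assms(1,3)] by (auto simp: fun_eq_iff contr_def lie_der_def)
  next
    case False
    then show ?thesis
      using assms formsD(2)[OF assms(1), of "vbracket X Y # Xs"] lie_der_outside[of "Y # Xs"]
      by (simp add: lie_der_outside contr_def)
  qed
qed

lemma lie_der_add: "\<alpha> \<in> forms A \<Longrightarrow> \<beta> \<in> forms A \<Longrightarrow> X \<in> V \<Longrightarrow> L X (\<alpha> + \<beta>) = L X \<alpha> + L X \<beta>"
proof (intro ext)
  fix Xs p assume a: "\<alpha> \<in> forms A" "\<beta> \<in> forms A" "X \<in> V"
  show "L X (\<alpha> + \<beta>) Xs p = (L X \<alpha> + L X \<beta>) Xs p"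
    using a forms_add[OF a(1,2)] fun_cong[OF vapp_add[OF a(3) formsD(1)[OF a(1)] formsD(1)[OF a(2)]], of Xs Xs p]
    by (cases "Xs \<in> lists V") (auto simp: lie_der_def vapp_def sum.distrib)
qed

lemma lie_der_smul: "\<alpha> \<in> forms A \<Longrightarrow> f \<in> C \<Longrightarrow> X \<in> V \<Longrightarrow> L X (smul f \<alpha>) = smul (vapp X f) \<alpha> + smul f (L X \<alpha>)"
proof (intro ext)
  fix Xs p assume a: "\<alpha> \<in> forms A" "f \<in> C" "X \<in> V"
  show "L X (smul f \<alpha>) Xs p = (smul (vapp X f) \<alpha> + smul f (L X \<alpha>)) Xs p"
    using a forms_smul[OF a(1,2)] fun_cong[OF vapp_mult[OF a(3,2) formsD(1)[OF a(1)]], of Xs p] formsD(2)[OF a(1), of Xs]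
    by (cases "Xs \<in> lists V") (auto simp: lie_der_def vapp_def smul_def sum_distrib_left right_diff_distrib)
qed

lemma lie_der_smul_const: "\<alpha> \<in> forms A \<Longrightarrow> X \<in> V \<Longrightarrow> L X (smul (\<lambda>p. c) \<alpha>) = smul (\<lambda>p. c) (L X \<alpha>)"
  using lie_der_smul[OF _ smooth_functions_const[of c], of \<alpha> X] vapp_const[of X c]
  by (simp add: smul_def zero_fun_def plus_fun_def times_fun_def)

lemma lie_der_zero: "X \<in> V \<Longrightarrow> L X 0 = 0"
  using lie_der_add[of 0 0 X] forms_zero by simp

lemma lie_der_uminus: "\<alpha> \<in> forms A \<Longrightarrow> X \<in> V \<Longrightarrow> L X (- \<alpha>) = - L X \<alpha>"
  using lie_der_add[of \<alpha> "- \<alpha>" X] forms_uminus[of \<alpha>] lie_der_zero[of X]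
  by (simp add: eq_neg_iff_add_eq_0 add.commute)

lemma lie_der_diff: "\<alpha> \<in> forms A \<Longrightarrow> \<beta> \<in> forms A \<Longrightarrow> X \<in> V \<Longrightarrow> L X (\<alpha> - \<beta>) = L X \<alpha> - L X \<beta>"
  using lie_der_add[of \<alpha> "- \<beta>" X] forms_uminus[of \<beta>] lie_der_uminus[of \<beta> X] by simp

lemma lie_der_Cons:
  assumes "\<omega> \<in> forms A" "X \<in> V" "Y \<in> V"
  shows "L X \<omega> (Y # Xs) = L X (contr Y \<omega>) Xs - \<omega> (vbracket X Y # Xs)"
  using fun_cong[OF contr_lie_der[OF assms], of Xs] by (simp add: contr_def)

text \<open>The conditions on a slot go by induction on the arguments to its left; only the base
  case touches the slot. There the term with X f from \<open>lie_der_smul\<close> cancels the one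
  from [X, f Y], and alternation follows from the skew symmetry of contractions.\<close>

lemma forms_lie_der:
  assumes \<omega>: "\<omega> \<in> forms A" and X: "X \<in> V"
  shows "L X \<omega> \<in> forms A"
proof (rule formsI)
  fix Xs
  show "L X \<omega> Xs = 0" if "Xs \<notin> lists V" using that by (rule lie_der_outside)
  show "L X \<omega> Xs \<in> C" if "Xs \<in> lists V"
    using that \<omega>
  proof (induction Xs arbitrary: \<omega>)
    case Nil
    then show ?case using X by (simp add: lie_der_Nil vapp_smooth formsD)
  next
    case (Cons Y Ys)
    then have "L X (contr Y \<omega>) Ys \<in> C" "\<omega> (vbracket X Y # Ys) \<in> C"
      using X by (simp_all add: forms_contr vfields_bracket formsD(1))
    then have "L X (contr Y \<omega>) Ys - \<omega> (vbracket X Y # Ys) \<in> C" by (rule smooth_functions_diff)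
    moreover have "Y \<in> V" using Cons.hyps by simp
    ultimately show ?case by (subst lie_der_Cons[OF Cons.prems(1) X]) auto
  qed
  fix Ys Y
  assume Xs: "Xs \<in> lists V" and Ys: "Ys \<in> lists V" and Y: "Y \<in> V"
  note facts = X Y Ys
  show "L X \<omega> (Xs @ (Y + Z) # Ys) = L X \<omega> (Xs @ Y # Ys) + L X \<omega> (Xs @ Z # Ys)" if "Z \<in> V" for Z
    using Xs \<omega>
  proof (induction Xs arbitrary: \<omega>)
    case Nil
    then have "contr (Y + Z) (L X \<omega>) = contr Y (L X \<omega>) + contr Z (L X \<omega>)"
      using facts that
      by (simp add: contr_lie_der vfields_add contr_add_field lie_der_add forms_contr vbracket_add vfields_bracket)
    from fun_cong[OF this, of Ys] show ?case by (simp add: contr_def plus_fun_def)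
  next
    case (Cons W Ws)
    then show ?case
      using facts that formsD(3)[OF Cons.prems(1), of "vbracket X W # Ws" Ys Y Z]
      by (simp add: lie_der_Cons forms_contr vfields_bracket plus_fun_def fun_diff_def algebra_simps)
  qed
  show "L X \<omega> (Xs @ vscale f Y # Ys) = f * L X \<omega> (Xs @ Y # Ys)" if "f \<in> C" for f
    using Xs \<omega>
  proof (induction Xs arbitrary: \<omega>)
    case Nil
    then have "contr (vscale f Y) (L X \<omega>) = smul f (contr Y (L X \<omega>))"
      using facts that
      by (simp add: contr_lie_der vfields_vscale contr_vscale contr_add_field lie_der_smul forms_contr
          vbracket_vscale vfields_bracket vapp_smooth smul_simps)
    from fun_cong[OF this, of Ys] show ?case by (simp add: contr_def smul_def)
  next
    case (Cons W Ws)
    then show ?case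
      using facts that formsD(4)[OF Cons.prems(1), of "vbracket X W # Ws" Ys Y f]
      by (simp add: lie_der_Cons forms_contr vfields_bracket right_diff_distrib)
  qed
  show "L X \<omega> (Xs @ Y # Y # Ys) = 0"
    using Xs \<omega>
  proof (induction Xs arbitrary: \<omega>)
    case Nil
    have "contr Y (contr Y (L X \<omega>)) = - contr (vbracket X Y) (contr Y \<omega>) - contr Y (contr (vbracket X Y) \<omega>)"
      using facts Nil by (simp add: contr_lie_der forms_contr contr_contr_same lie_der_zero)
    also have "\<dots> = 0" using contr_swap[OF Nil(1), of Y "vbracket X Y"] by simp
    finally have "contr Y (contr Y (L X \<omega>)) = 0" .
    from fun_cong[OF this, of Ys] show ?case by (simp add: contr_def)
  next
    case (Cons W Ws)
    then show ?case
      using facts formsD(5)[OF Cons.prems(1), of "vbracket X W # Ws" "[]" Ys Y]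
      by (simp add: lie_der_Cons forms_contr vfields_bracket)
  qed
next
  obtain N where N: "\<And>Xs. length Xs \<ge> N \<Longrightarrow> \<omega> Xs = 0" using formsD(6)[OF \<omega>] by blast
  have "L X \<omega> Xs = 0" if "length Xs \<ge> N" for Xs
    by (rule ext) (use that in \<open>simp add: lie_der_def N tangent_zero[OF vfield_tangent[OF X]]\<close>)
  then show "\<exists>N. \<forall>Xs. N \<le> length Xs \<longrightarrow> L X \<omega> Xs = 0" by blast
qed

lemma parity_lie_der: "\<omega> \<in> pforms A b \<Longrightarrow> X \<in> V \<Longrightarrow> parity b (L X \<omega>)"
  unfolding parity_def
proof (intro allI impI)
  fix Xs :: "'p vfield list" assume a: "\<omega> \<in> pforms A b" "X \<in> V" "odd (length Xs + b)"
  have *: "\<omega> Ys = 0" if "length Ys = length Xs" for Ys using a that by (simp add: pforms_def)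
  show "L X \<omega> Xs = 0"
    by (rule ext) (simp add: lie_der_def * tangent_zero[OF vfield_tangent[OF a(2)]])
qed

lemma lie_der_grade: "\<omega> \<in> forms A \<Longrightarrow> X \<in> V \<Longrightarrow> L X (grade \<omega>) = grade (L X \<omega>)"
proof -
  assume a: "\<omega> \<in> forms A" "X \<in> V"
  have "grade (L X (fpart 0 \<omega>)) = L X (fpart 0 \<omega>)" "grade (L X (fpart 1 \<omega>)) = - L X (fpart 1 \<omega>)"
    using parity_grade[OF parity_lie_der[OF pforms_fpart[OF a(1)] a(2)], of 0]
      parity_grade[OF parity_lie_der[OF pforms_fpart[OF a(1)] a(2)], of 1] by simp_all
  moreover have "L X \<omega> = L X (fpart 0 \<omega>) + L X (fpart 1 \<omega>)"
    using lie_der_add[OF forms_fpart forms_fpart, OF a(1) a(1) a(2), of 0 "Suc 0"] by (simp add: fpart_decompose)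
  ultimately show ?thesis
    using lie_der_diff[OF forms_fpart forms_fpart, OF a(1) a(1) a(2), of 0 1] by (simp add: grade_eq[of \<omega>])
qed

text \<open>Contracting with Y turns the rule for \<alpha>, \<beta> into the rules for
  \<open>contr Y \<alpha>\<close>, \<beta> and for \<open>grade \<alpha>\<close>,
  \<open>contr Y \<beta>\<close>. The bracket terms match because contraction with [X, Y] obeys the
  graded Leibniz rule too.\<close>

lemma lie_der_wedge:
  assumes "\<alpha> \<in> forms A" "\<beta> \<in> forms A" "X \<in> V"
  shows "L X (\<alpha> \<^bold>\<and> \<beta>) = L X \<alpha> \<^bold>\<and> \<beta> + \<alpha> \<^bold>\<and> L X \<beta>"
proof
  fix Xs
  show "L X (\<alpha> \<^bold>\<and> \<beta>) Xs = (L X \<alpha> \<^bold>\<and> \<beta> + \<alpha> \<^bold>\<and> L X \<beta>) Xs"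
  proof (cases "Xs \<in> lists V")
    case True
    then show ?thesis
      using assms(1,2)
    proof (induction Xs arbitrary: \<alpha> \<beta>)
      case Nil
      then show ?case
        using assms(3) by (simp add: lie_der_Nil forms_wedge wedge_Nil vapp_mult formsD)
    next
      case (Cons Y Ys)
      note fs = assms(3) Cons.prems forms_contr forms_grade forms_wedge forms_lie_der
      have Y: "Y \<in> V" "Ys \<in> lists V" using Cons.hyps by auto
      have 1: "contr Y (L X (\<alpha> \<^bold>\<and> \<beta>)) = L X (contr Y \<alpha> \<^bold>\<and> \<beta>) + L X (grade \<alpha> \<^bold>\<and> contr Y \<beta>)
          - (contr (vbracket X Y) \<alpha> \<^bold>\<and> \<beta> + grade \<alpha> \<^bold>\<and> contr (vbracket X Y) \<beta>)"
        by (simp add: contr_lie_der fs Y contr_wedge lie_der_add)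
      have 2: "contr Y (L X \<alpha> \<^bold>\<and> \<beta> + \<alpha> \<^bold>\<and> L X \<beta>) =
          (L X (contr Y \<alpha>) \<^bold>\<and> \<beta> + contr Y \<alpha> \<^bold>\<and> L X \<beta>) + (L X (grade \<alpha>) \<^bold>\<and> contr Y \<beta> + grade \<alpha> \<^bold>\<and> L X (contr Y \<beta>))
          - (contr (vbracket X Y) \<alpha> \<^bold>\<and> \<beta> + grade \<alpha> \<^bold>\<and> contr (vbracket X Y) \<beta>)"
        by (simp add: contr_lie_der fs Y contr_wedge wedge_diff_left wedge_diff_right lie_der_grade)
      have "contr Y (L X (\<alpha> \<^bold>\<and> \<beta>)) Ys = contr Y (L X \<alpha> \<^bold>\<and> \<beta> + \<alpha> \<^bold>\<and> L X \<beta>) Ys"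
        unfolding 1 2 by (simp add: Cons.IH fs Y plus_fun_def add.assoc)
      then show ?case by (simp add: contr_def)
    qed
  next
    case False
    then show ?thesis
      using formsD(2)[OF forms_wedge[OF forms_lie_der[OF assms(1,3)] assms(2)]]
        formsD(2)[OF forms_wedge[OF assms(1) forms_lie_der[OF assms(2,3)]]] by (simp add: lie_der_outside)
  qed
qed

lemma lie_der_pders: "X \<in> V \<Longrightarrow> L X \<in> pders A 0"
proof (rule pdersI)
  assume X: "X \<in> V"
  show "L X \<alpha> \<in> pforms A (0 + b)" if "\<alpha> \<in> pforms A b" for \<alpha> b
    using that X by (simp add: pforms_iff forms_lie_der parity_lie_der)
  show "L X (\<alpha> \<^bold>\<and> \<beta>) = L X \<alpha> \<^bold>\<and> \<beta> + ksign (0 * b) (\<alpha> \<^bold>\<and> L X \<beta>)"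
    if "\<alpha> \<in> pforms A b" "\<beta> \<in> forms A" for \<alpha> \<beta> b
    using that X by (simp add: pforms_iff lie_der_wedge)
  show "L X \<alpha> = 0" if "\<alpha> \<notin> forms A" for \<alpha> using that by (simp add: lie_der_def)
qed (auto simp: lie_der_add lie_der_smul_const)

text \<open>The differential of a function as a form supported on lists of length one; the theorem
  applies the exterior derivative to functions g(X, Y).\<close>

definition d0 :: "('p \<Rightarrow> real) \<Rightarrow> 'p form" where
  "d0 f = (\<lambda>Xs. if Xs \<in> lists V \<and> length Xs = 1 then vapp (hd Xs) f else 0)"

lemma ext_deriv_func_form:
  assumes f: "f \<in> C"
  shows "ext_deriv A (func_form f) = d0 f"
proof (intro ext)
  fix Xs p
  show "ext_deriv A (func_form f) Xs p = d0 f Xs p"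
  proof (cases "Xs \<in> lists V")
    case True
    have "(\<Sum>i<length Xs. (-1) ^ i * (Xs ! i) p (func_form f (nths Xs (- {i})))) = d0 f Xs p"
    proof (cases "length Xs = 1")
      case len: True
      then obtain X where "Xs = [X]" by (cases Xs) auto
      then show ?thesis using True by (simp add: d0_def vapp_def func_form_def nths_Cons)
    next
      case len: False
      have "(Xs ! i) p (func_form f (nths Xs (- {i}))) = 0" if i: "i < length Xs" for i
      proof -
        have "length (nths Xs (- {i})) = card {j. j < length Xs \<and> j \<noteq> i}"
          by (simp add: length_nths)
        also have "{j. j < length Xs \<and> j \<noteq> i} = {..<length Xs} - {i}" by auto
        also have "card \<dots> = length Xs - 1" using i by simp
        finally have "nths Xs (- {i}) \<noteq> []" using len i by auto
        moreover have "Xs ! i \<in> V" using True i by auto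
        ultimately show ?thesis using tangent_zero[OF vfield_tangent] by (simp add: func_form_def)
      qed
      then show ?thesis using len by (simp add: d0_def)
    qed
    then show ?thesis using True by (simp add: ext_deriv_def func_form_def[of f, THEN fun_cong, of "_ # _"])
  qed (simp add: ext_deriv_def d0_def)
qed

lemma contr_d0: "X \<in> V \<Longrightarrow> contr X (d0 f) = func_form (vapp X f)"
  by (auto simp: contr_def d0_def func_form_def fun_eq_iff)

lemma d0_Nil: "d0 f [] = 0"
  by (simp add: d0_def)

lemma d0_forms: "f \<in> C \<Longrightarrow> d0 f \<in> forms A"
proof (rule formsI)
  assume f: "f \<in> C"
  fix Xs
  show "d0 f Xs \<in> C" if "Xs \<in> lists V"
    using that f by (cases Xs) (auto simp: d0_def vapp_smooth smooth_functions_zero)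
  show "d0 f Xs = 0" if "Xs \<notin> lists V" using that by (auto simp: d0_def)
  fix Ys X
  assume *: "Xs \<in> lists V" "Ys \<in> lists V" "X \<in> V"
  show "d0 f (Xs @ (X + Y) # Ys) = d0 f (Xs @ X # Ys) + d0 f (Xs @ Y # Ys)" if "Y \<in> V" for Y
    using * that vfields_add by (cases Xs) (auto simp: d0_def vapp_add_left)
  show "d0 f (Xs @ vscale h X # Ys) = h * d0 f (Xs @ X # Ys)" if "h \<in> C" for h
    using * that vfields_vscale by (cases Xs) (auto simp: d0_def vapp_scale_left)
  show "d0 f (Xs @ X # X # Ys) = 0" by (auto simp: d0_def)
next
  show "\<exists>N. \<forall>Xs. N \<le> length Xs \<longrightarrow> d0 f Xs = 0" by (intro exI[of _ 2]) (auto simp: d0_def)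
qed

lemma d0_pforms: "f \<in> C \<Longrightarrow> d0 f \<in> pforms A 1"
  unfolding pforms_iff using d0_forms by (auto simp: parity_def d0_def)

lemma d0_add: "f \<in> C \<Longrightarrow> h \<in> C \<Longrightarrow> d0 (f + h) = d0 f + d0 h"
  by (rule form_eqI) (auto simp: d0_forms smooth_functions_add forms_add d0_Nil contr_d0 vapp_add func_form_def fun_eq_iff)

lemma lie_der_func_form: "f \<in> C \<Longrightarrow> X \<in> V \<Longrightarrow> L X (func_form f) = func_form (vapp X f)"
  by (rule form_eqI)
    (auto simp: forms_lie_der func_form_forms vapp_smooth lie_der_Nil contr_lie_der lie_der_zero, simp add: func_form_def)

lemma lie_der_d0: "f \<in> C \<Longrightarrow> X \<in> V \<Longrightarrow> L X (d0 f) = d0 (vapp X f)"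
proof (rule form_eqI)
  assume f: "f \<in> C" and X: "X \<in> V"
  show "L X (d0 f) [] = d0 (vapp X f) []" using f X by (simp add: lie_der_Nil d0_forms d0_Nil vapp_zero)
  fix Y assume Y: "Y \<in> V"
  have "contr Y (L X (d0 f)) = func_form (vapp X (vapp Y f)) - func_form (vapp (vbracket X Y) f)"
    using f X Y by (simp add: contr_lie_der d0_forms contr_d0 lie_der_func_form vapp_smooth vfields_bracket)
  also have "\<dots> = contr Y (d0 (vapp X f))"
    using f X Y by (simp add: contr_d0 vapp_smooth vapp_bracket) (auto simp: func_form_def fun_eq_iff)
  finally show "contr Y (L X (d0 f)) = contr Y (d0 (vapp X f))" .
qed (auto simp: forms_lie_der d0_forms vapp_smooth)

text \<open>Contracting with Z gives the same claim for \<open>contr Z \<omega>\<close>, up to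
  bracket terms that match by the Jacobi identity.\<close>

lemma lie_der_lie_der:
  assumes "\<omega> \<in> forms A" "X \<in> V" "Y \<in> V"
  shows "L X (L Y \<omega>) - L Y (L X \<omega>) = L (vbracket X Y) \<omega>"
proof
  fix Xs
  show "(L X (L Y \<omega>) - L Y (L X \<omega>)) Xs = L (vbracket X Y) \<omega> Xs"
  proof (cases "Xs \<in> lists V")
    case True
    then show ?thesis
      using assms(1)
    proof (induction Xs arbitrary: \<omega>)
      case Nil
      then show ?case using assms by (simp add: lie_der_Nil forms_lie_der vapp_bracket)
    next
      case (Cons Z Zs)
      note fs = assms(2,3) Cons.prems(1) forms_lie_der forms_contr vfields_bracket
      have Z: "Z \<in> V" using Cons.hyps by simp
      let ?XY = "vbracket X Y"
      have XYZ: "contr (vbracket X (vbracket Y Z)) \<omega> = contr (vbracket ?XY Z) \<omega> + contr (vbracket Y (vbracket X Z)) \<omega>"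
        using contr_add_field[OF Cons.prems(1), of "vbracket ?XY Z" "vbracket Y (vbracket X Z)"]
        using vbracket_jacobi[OF assms(2,3) Z] by (simp add: fs Z vfields_diff)
      have "contr Z (L X (L Y \<omega>) - L Y (L X \<omega>)) =
          L X (L Y (contr Z \<omega>)) - L Y (L X (contr Z \<omega>)) - contr (vbracket ?XY Z) \<omega>"
        by (simp add: contr_lie_der fs Z lie_der_diff XYZ)
      also have "\<dots> = contr Z (L ?XY \<omega>) + (L X (L Y (contr Z \<omega>)) - L Y (L X (contr Z \<omega>)) - L ?XY (contr Z \<omega>))"
        by (simp add: contr_lie_der fs Z)
      finally have "contr Z (L X (L Y \<omega>) - L Y (L X \<omega>)) Zs = contr Z (L ?XY \<omega>) Zs"
        using Cons.IH[OF forms_contr[OF Cons.prems(1) Z]] by (simp add: fs) (simp add: fun_eq_iff)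
      then show ?case by (simp add: contr_def)
    qed
  qed (simp add: lie_der_outside)
qed

section \<open>Commutators of Lie derivatives and interior products\<close>

lemma gcommutator_lie_lie: "X \<in> V \<Longrightarrow> Y \<in> V \<Longrightarrow> gcommutator A (L X) (L Y) = L (vbracket X Y)"
  unfolding gcommutator_pders[OF lie_der_pders lie_der_pders]
proof
  fix \<omega> assume XY: "X \<in> V" "Y \<in> V"
  show "((L X \<circ> L Y) - ksign (0 * 0) (L Y \<circ> L X)) \<omega> = L (vbracket X Y) \<omega>"
    using lie_der_lie_der[of \<omega> X Y] XY lie_der_zero by (cases "\<omega> \<in> forms A") (auto simp: lie_der_not_form)
qed

lemma gcommutator_lie_int: "X \<in> V \<Longrightarrow> Y \<in> V \<Longrightarrow> gcommutator A (L X) (i Y) = i (vbracket X Y)"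
  unfolding gcommutator_pders[OF lie_der_pders int_prod_pders]
proof
  fix \<omega> assume XY: "X \<in> V" "Y \<in> V"
  show "((L X \<circ> i Y) - ksign (0 * 1) (i Y \<circ> L X)) \<omega> = i (vbracket X Y) \<omega>"
  proof (cases "\<omega> \<in> forms A")
    case True
    then show ?thesis using XY by (simp add: int_prod_eq forms_lie_der contr_lie_der)
  next
    case False
    then show ?thesis using XY lie_der_zero forms_zero
      by (simp add: lie_der_not_form int_prod_def zero_fun_def[symmetric])
  qed
qed

lemma gcommutator_int_lie: "X \<in> V \<Longrightarrow> Y \<in> V \<Longrightarrow> gcommutator A (i X) (L Y) = i (vbracket X Y)"
  unfolding gcommutator_pders[OF int_prod_pders lie_der_pders]
proof
  fix \<omega> assume XY: "X \<in> V" "Y \<in> V"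
  show "((i X \<circ> L Y) - ksign (1 * 0) (L Y \<circ> i X)) \<omega> = i (vbracket X Y) \<omega>"
  proof (cases "\<omega> \<in> forms A")
    case True
    \<comment> \<open>Cartan's relation yields contraction with [Y, X]; antisymmetry of the bracket
      and additivity of contraction turn it into that with [X, Y].\<close>
    have "vbracket Y X + vbracket X Y = 0" by (auto simp: vbracket_def fun_eq_iff)
    moreover have "contr 0 \<omega> = 0" 
      using contr_vscale[OF True XY(1) smooth_functions_zero] by (simp add: vscale_def smul_def zero_fun_def times_fun_def)
    ultimately have "contr (vbracket Y X) \<omega> + contr (vbracket X Y) \<omega> = 0"
      using contr_add_field[OF True vfields_bracket vfields_bracket, OF XY(2,1,1,2)] by simp
    then show ?thesis using XY True by (simp add: int_prod_eq forms_lie_der contr_lie_der) (metis minus_unique)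
  next
    case False
    then show ?thesis using XY lie_der_zero forms_zero
      by (simp add: lie_der_not_form int_prod_def zero_fun_def[symmetric])
  qed
qed

lemma gcommutator_int_int: "X \<in> V \<Longrightarrow> Y \<in> V \<Longrightarrow> gcommutator A (i X) (i Y) = 0"
  unfolding gcommutator_pders[OF int_prod_pders int_prod_pders]
proof
  fix \<omega> assume XY: "X \<in> V" "Y \<in> V"
  show "((i X \<circ> i Y) - ksign (1 * 1) (i Y \<circ> i X)) \<omega> = 0 \<omega>"
  proof (cases "\<omega> \<in> forms A")
    case True
    then show ?thesis using XY contr_swap[OF True, of X Y] by (simp add: int_prod_eq forms_contr)
  next
    case False
    then show ?thesis using forms_zero by (simp add: int_prod_def fun_eq_iff)
  qed
qed

end

section \<open>Derivations in a local frame\<close>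

lemma func_form_simps:
  "func_form (f + h) = func_form f + func_form h" "func_form (f * h) = smul f (func_form h)"
  "func_form 0 = 0"
  by (auto simp: func_form_def smul_def fun_eq_iff)

lemma sum_hom:
  assumes "h 0 = 0" "\<And>x y. h (x + y) = h x + h y"
  shows "h (sum f I) = (\<Sum>j\<in>I. h (f j))"
  using sum_comp_morphism[of h f I, OF assms] by (simp add: o_def)

lemma sum_hom_on:
  assumes "P 0" "\<And>x y. P x \<Longrightarrow> P y \<Longrightarrow> P (x + y)" "h 0 = 0" "\<And>x y. P x \<Longrightarrow> P y \<Longrightarrow> h (x + y) = h x + h y"
    "\<And>j. j \<in> I \<Longrightarrow> P (f j)"
  shows "h (sum f I) = (\<Sum>j\<in>I. h (f j))"
proof -
  have "P (sum f I) \<and> h (sum f I) = (\<Sum>j\<in>I. h (f j))"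
    using assms(5) by (induction I rule: infinite_finite_induct) (simp_all add: assms(1-4))
  then show ?thesis by blast
qed

lemma func_form_sum: "func_form (sum f I) = (\<Sum>j\<in>I. func_form (f j))"
  by (rule sum_hom[of func_form]) (simp_all add: func_form_simps)

lemma wedge_func_form: "\<alpha> \<^bold>\<and> func_form f = smul f \<alpha>"
proof
  show "(\<alpha> \<^bold>\<and> func_form f) Xs = smul f \<alpha> Xs" for Xs
  proof (induction Xs arbitrary: \<alpha>)
    case Nil
    show ?case by (simp add: wedge_Nil smul_def func_form_def mult.commute)
  next
    case (Cons X Xs)
    then show ?case by (simp add: wedge_Cons) (simp add: smul_def contr_def)
  qed
qed

lemma contr_sum: "contr X (sum \<alpha> I) = (\<Sum>j\<in>I. contr X (\<alpha> j))"
  by (rule sum_hom[of "contr X"]) simp_all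

lemma smul_sum: "smul f (sum \<alpha> I) = (\<Sum>j\<in>I. smul f (\<alpha> j))"
  by (rule sum_hom[of "smul f"]) (simp_all add: smul_simps)

lemma vapp_sum_left: "vapp (sum X I) f = (\<Sum>j\<in>I. vapp (X j) f)"
  by (simp add: vapp_def fun_eq_iff sum_fun_apply)

context manifold
begin

lemma frameD:
  assumes "frame \<kappa> I x E"
  shows "\<kappa> \<in> C" "finite I" "j \<in> I \<Longrightarrow> x j \<in> C" "j \<in> I \<Longrightarrow> E j \<in> V"
    "v \<in> tangent_space A q \<Longrightarrow> f \<in> C \<Longrightarrow> \<kappa> q * v f = (\<Sum>j\<in>I. v (x j) * E j q f)"
  using assms by (auto simp: frame_def)

lemma frame_vapp:
  assumes F: "frame \<kappa> I x E" and X: "X \<in> V" and f: "f \<in> C"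
  shows "\<kappa> * vapp X f = (\<Sum>j\<in>I. vapp X (x j) * vapp (E j) f)"
  using frameD(5)[OF F vfield_tangent[OF X] f] by (simp add: vapp_def fun_eq_iff sum_fun_apply)

lemma frame_field:
  assumes F: "frame \<kappa> I x E" and X: "X \<in> V"
  shows "vscale \<kappa> X = (\<Sum>j\<in>I. vscale (vapp X (x j)) (E j))"
proof (rule vfield_eqI)
  fix f
  show "vapp (vscale \<kappa> X) f = vapp (\<Sum>j\<in>I. vscale (vapp X (x j)) (E j)) f"
  proof (cases "f \<in> C")
    case True
    then show ?thesis using frame_vapp[OF F X True] by (simp add: vapp_sum_left vapp_scale_left)
  next
    case False
    then have "vapp X f = 0" "\<And>j. j \<in> I \<Longrightarrow> vapp (E j) f = 0"
      using X frameD(4)[OF F] vapp_outside by auto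
    then show ?thesis by (simp add: vapp_sum_left vapp_scale_left)
  qed
qed

lemma zero_vfield: "0 \<in> V"
  using vfieldsI[of 0] by (simp add: vapp_def smooth_functions_zero zero_fun_def[symmetric])

lemma contr_zero_field: "\<alpha> \<in> forms A \<Longrightarrow> contr 0 \<alpha> = 0"
  using contr_add_field[of \<alpha> 0 0] zero_vfield by simp

lemma vfields_sum: "(\<And>j. j \<in> I \<Longrightarrow> X j \<in> V) \<Longrightarrow> sum X I \<in> V"
  by (induction I rule: infinite_finite_induct) (simp_all add: zero_vfield vfields_add)

lemma contr_sum_field:
  "\<alpha> \<in> forms A \<Longrightarrow> (\<And>j. j \<in> I \<Longrightarrow> X j \<in> V) \<Longrightarrow> contr (sum X I) \<alpha> = (\<Sum>j\<in>I. contr (X j) \<alpha>)"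
  by (induction I rule: infinite_finite_induct)
    (simp_all add: contr_zero_field contr_add_field vfields_sum)

text \<open>In coordinates this is Euler's identity \<open>\<Sum>j. dx\<^sub>j \<and> i\<^bsub>\<partial>\<^sub>j\<^esub> \<alpha> = k \<alpha>\<close> for a \<open>k\<close>-form \<open>\<alpha>\<close>.\<close>

lemma euler_identity:
  assumes F: "frame \<kappa> I x E" and \<alpha>: "\<alpha> \<in> forms A"
  shows "(\<Sum>j\<in>I. d0 (x j) \<^bold>\<and> contr (E j) \<alpha>) = (\<lambda>Xs p. real (length Xs) * \<kappa> p * \<alpha> Xs p)"
proof
  note [simp] = frameD(3,4)[OF F]
  fix Xs
  show "(\<Sum>j\<in>I. d0 (x j) \<^bold>\<and> contr (E j) \<alpha>) Xs = (\<lambda>p. real (length Xs) * \<kappa> p * \<alpha> Xs p)"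
  proof (cases "Xs \<in> lists V")
    case False
    moreover have "(\<Sum>j\<in>I. d0 (x j) \<^bold>\<and> contr (E j) \<alpha>) \<in> forms A"
      by (intro forms_sum forms_wedge d0_forms forms_contr \<alpha>) auto
    ultimately show ?thesis using formsD(2)[OF _ False] \<alpha> by (simp add: zero_fun_def)
  next
    case True
    then show ?thesis using \<alpha>
    proof (induction Xs arbitrary: \<alpha>)
      case Nil
      then show ?case by (simp add: fun_eq_iff sum_fun_apply wedge_Nil d0_Nil)
    next
      case (Cons X Xs)
      have X: "X \<in> V" and a: "\<alpha> \<in> forms A" using Cons by auto
      have gr: "grade (d0 f) = - d0 f" if "f \<in> C" for f
        using parity_grade[of 1 "d0 f"] d0_pforms[OF that] by (simp add: pforms_iff)
      \<comment> \<open>The first summand adds up to \<kappa> times \<open>contr X \<alpha>\<close>,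
        one more unit in the degree count. In the second, the sign of moving X past an odd form
        cancels that of exchanging two contractions.\<close>
      have "contr X (\<Sum>j\<in>I. d0 (x j) \<^bold>\<and> contr (E j) \<alpha>) =
          (\<Sum>j\<in>I. smul (vapp X (x j)) (contr (E j) \<alpha>) + d0 (x j) \<^bold>\<and> contr (E j) (contr X \<alpha>))"
        unfolding contr_sum
        by (rule sum.cong) (simp_all add: contr_wedge contr_d0 X func_form_wedge gr contr_swap[OF a, of X])
      also have "\<dots> = (\<Sum>j\<in>I. smul (vapp X (x j)) (contr (E j) \<alpha>)) + (\<Sum>j\<in>I. d0 (x j) \<^bold>\<and> contr (E j) (contr X \<alpha>))"
        by (rule sum.distrib)
      also have "(\<Sum>j\<in>I. smul (vapp X (x j)) (contr (E j) \<alpha>)) = contr (\<Sum>j\<in>I. vscale (vapp X (x j)) (E j)) \<alpha>"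
        by (subst contr_sum_field[OF a]) (auto intro!: sum.cong simp: vfields_vscale vapp_smooth X contr_vscale[OF a])
      also have "\<dots> = smul \<kappa> (contr X \<alpha>)"
        unfolding frame_field[OF F X, symmetric] by (rule contr_vscale[OF a X frameD(1)[OF F]])
      finally have "contr X (\<Sum>j\<in>I. d0 (x j) \<^bold>\<and> contr (E j) \<alpha>) Xs p =
          (smul \<kappa> (contr X \<alpha>) + (\<Sum>j\<in>I. d0 (x j) \<^bold>\<and> contr (E j) (contr X \<alpha>))) Xs p" for p
        by simp
      then show ?case
        using Cons.IH[OF forms_contr[OF a X]]
        by (simp add: contr_def[of X] smul_def fun_eq_iff distrib_right)
    qed
  qed
qed

text \<open>Euler's identity expresses the top degree part of \<alpha>, up to a factor, by products
  of the \<open>d0 (x j)\<close> with forms of lower degree. D kills the first factors, and \<kappa>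
  D kills the second ones by induction on the degree bound.\<close>

lemma derivation_vanishes:
  assumes F: "frame \<kappa> I x E" and D: "D \<in> pders A a"
    and D0: "\<And>f. f \<in> C \<Longrightarrow> D (func_form f) = 0" and D1: "\<And>j. j \<in> I \<Longrightarrow> D (d0 (x j)) = 0"
    and \<alpha>: "\<alpha> \<in> forms A"
  shows "smul \<kappa> (D \<alpha>) = 0"
proof -
  note [simp] = frameD(3,4)[OF F]
  have smulD: "D (smul f \<alpha>) = smul f (D \<alpha>)" if "f \<in> C" "\<alpha> \<in> forms A" for f \<alpha>
    using pders_smul[OF D that] D0 that by simp
  have "smul \<kappa> (D \<alpha>) = 0" if "\<alpha> \<in> forms A" "\<And>Xs. length Xs > N \<Longrightarrow> \<alpha> Xs = 0" for N \<alpha>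
    using that
  proof (induction N arbitrary: \<alpha>)
    case 0
    have "\<alpha> = func_form (\<alpha> [])" using 0(2) by (auto simp: fun_eq_iff func_form_def)
    then have "smul \<kappa> (D \<alpha>) = 0" using D0[of "\<alpha> []"] formsD(1)[OF 0(1), of "[]"] smul_simps(3) by (metis lists.Nil)
    then show ?case .
  next
    case (Suc N)
    let ?T = "\<Sum>j\<in>I. d0 (x j) \<^bold>\<and> contr (E j) \<alpha>"
    \<comment> \<open>The Euler factor in degree N + 1: subtracting \<open>?T\<close> from the
      multiple of \<alpha> by c removes that degree, and leaves a form covered by the induction
      hypothesis.\<close>
    define c where "c = (\<lambda>p. real (Suc N) * \<kappa> p)"
    have c: "c \<in> C" unfolding c_def by (intro smooth_functions_scale frameD(1)[OF F])
    have T: "?T \<in> forms A" by (intro forms_sum forms_wedge d0_forms forms_contr Suc) auto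
    have contr0: "smul \<kappa> (D (contr (E j) \<alpha>)) = 0" if "j \<in> I" for j
    proof (rule Suc.IH)
      show "contr (E j) \<alpha> \<in> forms A" using that by (intro forms_contr Suc.prems) simp
      show "contr (E j) \<alpha> Xs = 0" if "length Xs > N" for Xs
        unfolding contr_def using that by (intro Suc.prems(2)) simp
    qed
    have "D (d0 (x j) \<^bold>\<and> contr (E j) \<alpha>) = ksign a (d0 (x j) \<^bold>\<and> D (contr (E j) \<alpha>))" if "j \<in> I" for j
      using pders_wedge[OF D d0_pforms forms_contr[OF Suc.prems(1)], of "x j" "E j"] that D1 by simp
    then have "smul \<kappa> (D (d0 (x j) \<^bold>\<and> contr (E j) \<alpha>)) = 0" if "j \<in> I" for j
      using contr0[OF that] that
      by (simp add: ksign_def smul_simps wedge_smul_right[symmetric])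
    then have DT: "smul \<kappa> (D ?T) = 0"
      by (subst pders_sum_arg[OF D]) (auto intro!: forms_wedge d0_forms forms_contr Suc.prems simp: smul_sum)
    have "smul \<kappa> (D (smul c \<alpha> - ?T)) = 0"
    proof (rule Suc.IH)
      show "smul c \<alpha> - ?T \<in> forms A" by (intro forms_diff forms_smul c T Suc.prems)
      show "(smul c \<alpha> - ?T) Xs = 0" if "length Xs > N" for Xs
      proof (cases "length Xs = Suc N")
        case True
        then show ?thesis by (simp add: euler_identity[OF F Suc.prems(1)] smul_def c_def fun_eq_iff)
      next
        case False
        then have "\<alpha> Xs = 0" using that by (intro Suc.prems(2)) simp
        then show ?thesis by (simp add: euler_identity[OF F Suc.prems(1)] smul_def fun_eq_iff)
      qed
    qed
    then have "smul \<kappa> (smul c (D \<alpha>)) = 0"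
      using DT by (simp add: pders_diff_arg[OF D forms_smul[OF Suc.prems(1) c] T] smulD[OF c Suc.prems(1)] smul_simps)
    then have "\<kappa> p * (c p * D \<alpha> Xs p) = 0" for Xs p
      by (simp add: smul_def fun_eq_iff)
    \<comment> \<open>At a zero of \<kappa> the claim is trivial and elsewhere the factor c p
      cancels, so the power of \<kappa> does not grow with the degree.\<close>
    then have "\<kappa> p * D \<alpha> Xs p = 0" for Xs p
      unfolding c_def by (metis mult_eq_0_iff of_nat_neq_0)
    then have "smul \<kappa> (D \<alpha>) = 0" by (simp add: smul_def fun_eq_iff)
    then show ?case .
  qed
  moreover obtain N where "\<And>Xs. length Xs \<ge> N \<Longrightarrow> \<alpha> Xs = 0" using formsD(6)[OF \<alpha>] by blast
  ultimately show ?thesis using \<alpha> by (meson less_imp_le)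
qed

text \<open>With the arguments Xs and the point q fixed, f \<mapsto> D f Xs q is a tangent vector at
  q, even though D f may have any degree. The frame identity for tangent vectors thus applies to
  D.\<close>

lemma derivation_on_functions:
  assumes F: "frame \<kappa> I x E" and D: "D \<in> pders A a" and f: "f \<in> C"
  shows "smul \<kappa> (D (func_form f)) = (\<Sum>j\<in>I. smul (vapp (E j) f) (D (func_form (x j))))"
proof (intro ext)
  fix Xs q
  have out: "D (func_form f) = 0" if "f \<notin> C" for f
    using that formsD(1)[of "func_form f" "[]"] by (intro pders_outside[OF D]) (auto simp: func_form_def)
  have "(\<lambda>f. D (func_form f) Xs q) \<in> tangent_space A q"
    unfolding tangent_space_def
  proof (intro CollectI conjI ballI allI impI)
    fix f h assume f: "f \<in> C" and h: "h \<in> C"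
    show "D (func_form (f + h)) Xs q = D (func_form f) Xs q + D (func_form h) Xs q"
      by (simp add: func_form_simps pders_add_arg[OF D] func_form_forms f h)
    show "D (func_form (f * h)) Xs q = D (func_form f) Xs q * h q + f q * D (func_form h) Xs q"
      using pders_smul[OF D f func_form_forms[OF h]]
      by (simp add: func_form_simps wedge_func_form) (simp add: smul_def)
  next
    fix c f assume f: "f \<in> C"
    have "func_form (\<lambda>q. c * f q) = smul (\<lambda>q. c) (func_form f)" by (auto simp: func_form_def smul_def fun_eq_iff)
    then show "D (func_form (\<lambda>q. c * f q)) Xs q = c * D (func_form f) Xs q"
      using pders_smul_const[OF D func_form_forms[OF f], of c] by (simp add: smul_def)
  qed (simp add: out)
  from frameD(5)[OF F this f]
  show "smul \<kappa> (D (func_form f)) Xs q = (\<Sum>j\<in>I. smul (vapp (E j) f) (D (func_form (x j)))) Xs q"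
    by (simp add: sum_fun_apply smul_def vapp_def mult.commute)
qed

lemma frame_d0:
  assumes F: "frame \<kappa> I x E" and f: "f \<in> C"
  shows "smul \<kappa> (d0 f) = (\<Sum>j\<in>I. smul (vapp (E j) f) (d0 (x j)))"
proof (rule form_eqI)
  note [simp] = frameD(1,3,4)[OF F]
  show "smul \<kappa> (d0 f) \<in> forms A" "(\<Sum>j\<in>I. smul (vapp (E j) f) (d0 (x j))) \<in> forms A"
    using f by (auto intro!: forms_smul forms_sum d0_forms vapp_smooth)
  show "smul \<kappa> (d0 f) [] = (\<Sum>j\<in>I. smul (vapp (E j) f) (d0 (x j))) []"
    by (simp add: sum_fun_apply smul_def d0_Nil)
  fix X assume X: "X \<in> V"
  show "contr X (smul \<kappa> (d0 f)) = contr X (\<Sum>j\<in>I. smul (vapp (E j) f) (d0 (x j)))"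
    by (simp add: contr_sum contr_d0 X func_form_simps(2)[symmetric] frame_vapp[OF F X f] func_form_sum mult.commute)
qed

section \<open>Graded metrics and their non-degeneracy on Lie derivatives and interior
  products\<close>

lemma graded_metricD:
  assumes "graded_metric A G"
  shows "X \<in> ders A \<Longrightarrow> Y \<in> ders A \<Longrightarrow> G X Y \<in> forms A"
    "X \<in> ders A \<Longrightarrow> Y \<in> ders A \<Longrightarrow> Z \<in> ders A \<Longrightarrow> G (X + Y) Z = G X Z + G Y Z"
    "X \<in> ders A \<Longrightarrow> Y \<in> ders A \<Longrightarrow> Z \<in> ders A \<Longrightarrow> G X (Y + Z) = G X Y + G X Z"
    "X \<in> pders A a \<Longrightarrow> Y \<in> pders A b \<Longrightarrow> G X Y = ksign (a * b) (G Y X)"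
    "\<alpha> \<in> pforms A a \<Longrightarrow> X \<in> pders A b \<Longrightarrow> Y \<in> pders A c \<Longrightarrow> G (\<alpha> \<cdot> X) Y = \<alpha> \<^bold>\<and> G X Y"
    "\<alpha> \<in> pforms A a \<Longrightarrow> X \<in> pders A b \<Longrightarrow> Y \<in> pders A c \<Longrightarrow> G X (\<alpha> \<cdot> Y) = ksign (b * a) (\<alpha> \<^bold>\<and> G X Y)"
    "F \<in> graded_hom A \<Longrightarrow> \<exists>!Y. Y \<in> ders A \<and> (\<forall>X\<in>ders A. G X Y = F X)"
proof -
  show "G X (\<alpha> \<cdot> Y) = ksign (b * a) (\<alpha> \<^bold>\<and> G X Y)"
    if "\<alpha> \<in> pforms A a" "X \<in> pders A b" "Y \<in> pders A c"
  proof -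
    have "\<alpha> \<^bold>\<and> G X Y = ksign (b * a) (G X (\<alpha> \<cdot> Y))"
      using assms that unfolding graded_metric_def by blast
    then show ?thesis by (simp add: ksign_def)
  qed
qed (use assms in \<open>unfold graded_metric_def, blast+\<close>)

lemma ders_zero: "0 \<in> ders A"
  using pders_ders[OF pders_zero] .

lemma metric_zero: 
  assumes G: "graded_metric A G" and X: "X \<in> ders A"
  shows "G 0 X = 0" "G X 0 = 0"
  using graded_metricD(2)[OF G ders_zero ders_zero X] graded_metricD(3)[OF G X ders_zero ders_zero] by simp_all

lemma metric_uminus:
  assumes G: "graded_metric A G" and X: "X \<in> pders A a" and Y: "Y \<in> pders A b"
  shows "G (- X) Y = - G X Y" "G X (- Y) = - G X Y"
  using graded_metricD(2)[OF G pders_ders[OF X] pders_ders[OF pders_uminus[OF X]] pders_ders[OF Y]]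
    graded_metricD(3)[OF G pders_ders[OF X] pders_ders[OF Y] pders_ders[OF pders_uminus[OF Y]]]
    metric_zero[OF G pders_ders[OF X]] metric_zero[OF G pders_ders[OF Y]]
  by (simp_all add: eq_neg_iff_add_eq_0 add.commute)

lemma metric_diff:
  assumes G: "graded_metric A G" and X: "X \<in> pders A a" "X' \<in> pders A a" and Y: "Y \<in> pders A b" "Y' \<in> pders A b"
  shows "G (X - X') Y = G X Y - G X' Y" "G X (Y - Y') = G X Y - G X Y'"
  using graded_metricD(2)[OF G pders_ders[OF X(1)] pders_ders[OF pders_uminus[OF X(2)]] pders_ders[OF Y(1)]]
    graded_metricD(3)[OF G pders_ders[OF X(1)] pders_ders[OF Y(1)] pders_ders[OF pders_uminus[OF Y(2)]]]
    metric_uminus[OF G X(2) Y(1)] metric_uminus[OF G X(1) Y(2)]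
  by (simp_all only: diff_conv_add_uminus)

lemma metric_ksign:
  assumes G: "graded_metric A G" and X: "X \<in> pders A a" and Y: "Y \<in> pders A b"
  shows "G (ksign n X) Y = ksign n (G X Y)" "G X (ksign n Y) = ksign n (G X Y)"
  using metric_uminus[OF G X Y] by (simp_all add: ksign_def)

lemma metric_sum:
  assumes G: "graded_metric A G" and X: "\<And>j. j \<in> I \<Longrightarrow> X j \<in> pders A a" and Y: "Y \<in> ders A"
  shows "G (sum X I) Y = (\<Sum>j\<in>I. G (X j) Y)"
  using sum_hom_on[of "\<lambda>X. X \<in> pders A a" "\<lambda>X. G X Y" I X] X
    graded_metricD(2)[OF G pders_ders pders_ders Y] metric_zero(1)[OF G Y] pders_zero pders_add
  by blast

text \<open>For homogeneous X, subtracting Lie derivatives from \<kappa> X leaves \<open>X1\<close>,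
  which kills functions; subtracting interior products from \<kappa> \<open>X1\<close> leaves
  \<open>X2\<close>, which kills their differentials too, so \<kappa> \<open>X2\<close> = 0. The
  subtracted terms are orthogonal to D, hence \<kappa>^3 G X D = 0, and \<kappa> is chosen nonzero
  at the point considered.\<close>

lemma metric_nondegenerate_lie_int:
  assumes G: "graded_metric A G" and D: "D \<in> pders A b"
    and L0: "\<And>Z. Z \<in> V \<Longrightarrow> G (L Z) D = 0" and i0: "\<And>Z. Z \<in> V \<Longrightarrow> G (i Z) D = 0"
  shows "D = 0"
proof -
  have homog: "G X D = 0" if X: "X \<in> pders A a" for X a
  proof (intro ext)
    fix Xs p
    obtain \<kappa> and I :: "('e \<times> bool) set" and x E where F: "frame \<kappa> I x E" and p: "\<kappa> p \<noteq> 0"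
      using local_frame[of p] by blast
    note [simp] = frameD(1,3,4)[OF F]
    define X1 where "X1 = func_form \<kappa> \<cdot> X - (\<Sum>j\<in>I. X (func_form (x j)) \<cdot> L (E j))"
    define X2 where "X2 = func_form \<kappa> \<cdot> X1 - (\<Sum>j\<in>I. X1 (d0 (x j)) \<cdot> i (E j))"
    have \<kappa>: "func_form \<kappa> \<in> pforms A 0" by (simp add: func_form_pforms)
    have a1: "X (func_form (x j)) \<in> pforms A a" if "j \<in> I" for j
      using pders_pforms[OF X func_form_pforms[of "x j"]] that by simp
    have t1: "X (func_form (x j)) \<cdot> L (E j) \<in> pders A a" if "j \<in> I" for j
      using pders_lmult[OF a1[OF that] lie_der_pders[of "E j"]] that by simp
    have k1: "func_form \<kappa> \<cdot> X \<in> pders A a" using pders_lmult[OF \<kappa> X] by simp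
    have s1: "(\<Sum>j\<in>I. X (func_form (x j)) \<cdot> L (E j)) \<in> pders A a" by (intro pders_sum t1)
    have X1: "X1 \<in> pders A a" unfolding X1_def by (intro pders_diff k1 s1)
    have a2: "X1 (d0 (x j)) \<in> pforms A (a + 1)" if "j \<in> I" for j
      using pders_pforms[OF X1 d0_pforms[of "x j"]] that by simp
    have t2: "X1 (d0 (x j)) \<cdot> i (E j) \<in> pders A a" if "j \<in> I" for j
      using pders_lmult[OF a2[OF that] int_prod_pders[of "E j"]] that pders_cong[of a "a + 1 + 1"] by simp
    have k2: "func_form \<kappa> \<cdot> X1 \<in> pders A a" using pders_lmult[OF \<kappa> X1] by simp
    have s2: "(\<Sum>j\<in>I. X1 (d0 (x j)) \<cdot> i (E j)) \<in> pders A a" by (intro pders_sum t2)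
    have X2: "X2 \<in> pders A a" unfolding X2_def by (intro pders_diff k2 s2)
    have X1f: "X1 (func_form f) = 0" if "f \<in> C" for f
      using derivation_on_functions[OF F X that] that
      by (simp add: X1_def sum_fun_apply lmult_def func_form_wedge lie_der_func_form wedge_func_form)
    have X2f: "X2 (func_form f) = 0" if "f \<in> C" for f
      using that by (simp add: X2_def sum_fun_apply lmult_def X1f int_prod_eq func_form_forms)
    have "smul \<kappa> (X1 (d0 f)) = (\<Sum>j\<in>I. smul (vapp (E j) f) (X1 (d0 (x j))))" if f: "f \<in> C" for f
    proof -
      have "smul \<kappa> (X1 (d0 f)) = X1 (smul \<kappa> (d0 f))"
        using pders_smul[OF X1 _ d0_forms[OF f]] X1f by simp
      also have "\<dots> = (\<Sum>j\<in>I. X1 (smul (vapp (E j) f) (d0 (x j))))"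
        unfolding frame_d0[OF F f]
        by (rule pders_sum_arg[OF X1]) (simp add: forms_smul d0_forms vapp_smooth f)
      also have "\<dots> = (\<Sum>j\<in>I. smul (vapp (E j) f) (X1 (d0 (x j))))"
        using pders_smul[OF X1 _ d0_forms] X1f f by (intro sum.cong) (simp_all add: vapp_smooth)
      finally show ?thesis .
    qed
    then have X2d: "X2 (d0 f) = 0" if "f \<in> C" for f
      using that by (simp add: X2_def sum_fun_apply lmult_def func_form_wedge int_prod_eq d0_forms contr_d0 wedge_func_form)
    have "func_form \<kappa> \<cdot> X2 = 0"
    proof
      fix \<alpha> show "(func_form \<kappa> \<cdot> X2) \<alpha> = 0 \<alpha>"
      proof (cases "\<alpha> \<in> forms A")
        case True
        have "smul \<kappa> (X2 \<alpha>) = 0" by (rule derivation_vanishes[OF F X2 X2f X2d True]) auto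
        then show ?thesis by (simp add: lmult_def func_form_wedge)
      qed (simp add: lmult_def pders_outside[OF X2])
    qed
    then have 2: "smul \<kappa> (G X2 D) = 0"
      using graded_metricD(5)[OF G \<kappa> X2 D] metric_zero(1)[OF G pders_ders[OF D]] by (simp add: func_form_wedge)
    have "G X2 D = smul \<kappa> (G X1 D) - (\<Sum>j\<in>I. X1 (d0 (x j)) \<^bold>\<and> G (i (E j)) D)"
      unfolding X2_def metric_diff(1)[OF G k2 s2 D D]
      by (simp add: metric_sum[OF G t2 pders_ders[OF D]] graded_metricD(5)[OF G \<kappa> X1 D] func_form_wedge
          graded_metricD(5)[OF G a2 int_prod_pders D])
    then have 1: "G X2 D = smul \<kappa> (G X1 D)" by (simp add: i0)
    have "G X1 D = smul \<kappa> (G X D) - (\<Sum>j\<in>I. X (func_form (x j)) \<^bold>\<and> G (L (E j)) D)"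
      unfolding X1_def metric_diff(1)[OF G k1 s1 D D]
      by (simp add: metric_sum[OF G t1 pders_ders[OF D]] graded_metricD(5)[OF G \<kappa> X D] func_form_wedge
          graded_metricD(5)[OF G a1 lie_der_pders D])
    then have "G X1 D = smul \<kappa> (G X D)" by (simp add: L0)
    then have "smul \<kappa> (smul \<kappa> (smul \<kappa> (G X D))) Xs p = 0" using 1 2 by simp
    then show "G X D Xs p = 0 Xs p" using p by (simp add: smul_def)
  qed
  have "G X D = 0" if X: "X \<in> ders A" for X
  proof -
    obtain X0 X1 where "X = X0 + X1" "X0 \<in> pders A 0" "X1 \<in> pders A 1"
      using X unfolding ders_def by blast
    then show ?thesis using graded_metricD(2)[OF G pders_ders pders_ders pders_ders[OF D], of X0 0 X1 1] homog by simp
  qed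
  \<comment> \<open>Non-degeneracy enters through uniqueness: D and 0 both represent the zero
    homomorphism.\<close>
  moreover have "(\<lambda>X. 0) \<in> graded_hom A" by (simp add: graded_hom_def forms_zero)
  from graded_metricD(7)[OF G this] have "Y = Y'" if "Y \<in> ders A" "Y' \<in> ders A" "\<forall>X\<in>ders A. G X Y = 0" "\<forall>X\<in>ders A. G X Y' = 0" for Y Y'
    using that by blast
  ultimately show ?thesis using pders_ders[OF D] ders_zero metric_zero(2)[OF G] by blast
qed

section \<open>The curvature of the semi-symmetric metric connection\<close>

lemma connectionD:
  assumes "graded_connection A N"
  shows "X \<in> pders A a \<Longrightarrow> Y \<in> pders A b \<Longrightarrow> N X Y \<in> pders A (a + b)"
    "X \<in> ders A \<Longrightarrow> Y \<in> ders A \<Longrightarrow> Z \<in> ders A \<Longrightarrow> N (X + Y) Z = N X Z + N Y Z"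
    "X \<in> ders A \<Longrightarrow> Y \<in> ders A \<Longrightarrow> Z \<in> ders A \<Longrightarrow> N X (Y + Z) = N X Y + N X Z"
    "\<alpha> \<in> pforms A a \<Longrightarrow> X \<in> pders A b \<Longrightarrow> Y \<in> ders A \<Longrightarrow>
      N X (\<alpha> \<cdot> Y) = X \<alpha> \<cdot> Y + ksign (b * a) (\<alpha> \<cdot> N X Y)"
  using assms by (auto simp: graded_connection_def)

lemma connection_zero:
  assumes N: "graded_connection A N" and X: "X \<in> ders A"
  shows "N 0 X = 0" "N X 0 = 0"
  using connectionD(2)[OF N ders_zero ders_zero X] connectionD(3)[OF N X ders_zero ders_zero] by simp_all

text \<open>The torsion condition exhibits the commutator as a difference of two derivations of
  known parity.\<close>

lemma gcommutator_parity:
  assumes "graded_levi_civita A G N" "X \<in> pders A a" "Y \<in> pders A b"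
  shows "gcommutator A X Y \<in> pders A (a + b)" "gcommutator A X Y = N X Y - ksign (a * b) (N Y X)"
proof -
  have N: "graded_connection A N" using assms(1) by (simp add: graded_levi_civita_def)
  show *: "gcommutator A X Y = N X Y - ksign (a * b) (N Y X)"
    using assms unfolding graded_levi_civita_def by metis
  have "N Y X \<in> pders A (a + b)" using connectionD(1)[OF N assms(3,2)] by (simp add: add.commute)
  then show "gcommutator A X Y \<in> pders A (a + b)"
    unfolding * by (rule pders_diff[OF connectionD(1)[OF N assms(2,3)] pders_ksign])
qed

end

text \<open>Isolates the algebra that depends only on P being an odd form times an even derivation
  \<open>Q\<close>; later \<open>Q\<close> is the Lie derivative along U.\<close>

locale semi_symmetric = manifold A
  for A :: "('p::{t2_space, second_countable_topology}, 'e::euclidean_space) atlas" +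
  fixes G :: "'p der \<Rightarrow> 'p der \<Rightarrow> 'p form" and N :: "'p der \<Rightarrow> 'p der \<Rightarrow> 'p der"
    and \<omega> :: "'p form" and Q :: "'p der"
  assumes G: "graded_metric A G" and G_odd: "metric_parity A G 1" and N_lc: "graded_levi_civita A G N"
    and \<omega>: "\<omega> \<in> pforms A 1" and Q: "Q \<in> pders A 0"
begin

definition "P = \<omega> \<cdot> Q"

abbreviation "N' \<equiv> semi_symmetric_connection A G N P"

lemma N: "graded_connection A N"
  using N_lc by (simp add: graded_levi_civita_def)

lemma G_pforms: "X \<in> pders A a \<Longrightarrow> Y \<in> pders A b \<Longrightarrow> G X Y \<in> pforms A (a + b + 1)"
  using G_odd by (simp add: metric_parity_def)

lemma N_metric: "X \<in> pders A a \<Longrightarrow> Y \<in> pders A b \<Longrightarrow> Z \<in> ders A \<Longrightarrow>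
    X (G Y Z) = G (N X Y) Z + ksign (a * b) (G Y (N X Z))"
  using N_lc unfolding graded_levi_civita_def by blast

lemma P: "P \<in> pders A 1"
  using pders_lmult[OF \<omega> Q] by (simp add: P_def)

lemma \<omega>_square: "\<omega> \<^bold>\<and> \<omega> = 0"
proof -
  have "\<omega> \<^bold>\<and> \<omega> = - (\<omega> \<^bold>\<and> \<omega>)" using wedge_commute[of 1 \<omega> 1 \<omega>] \<omega> by (simp add: pforms_iff)
  then show ?thesis by (auto simp: fun_eq_iff)
qed

lemma \<omega>_wedge_\<omega>:
  assumes "\<alpha> \<in> pforms A a"
  shows "(\<omega> \<^bold>\<and> \<alpha>) \<^bold>\<and> \<omega> = 0"
proof -
  have "\<alpha> \<^bold>\<and> \<omega> = ksign (a * 1) (\<omega> \<^bold>\<and> \<alpha>)"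
    using assms \<omega> by (intro wedge_commute) (auto simp: pforms_iff)
  then have "(\<omega> \<^bold>\<and> \<alpha>) \<^bold>\<and> \<omega> = ksign a ((\<omega> \<^bold>\<and> \<omega>) \<^bold>\<and> \<alpha>)"
    by (simp add: wedge_assoc wedge_ksign_right)
  then show ?thesis by (simp add: \<omega>_square)
qed

text \<open>Every pairing with P is divisible by \<omega>, and so is P. This is the source of the
  vanishing products below; wedge factors in between only change signs.\<close>

lemma G_P: "X \<in> pders A a \<Longrightarrow> G X P = ksign a (\<omega> \<^bold>\<and> G X Q)"
  using graded_metricD(6)[OF G \<omega> _ Q, of X a] by (simp add: P_def)

lemma G_P_parity: "X \<in> pders A a \<Longrightarrow> G X P \<in> pforms A a"
  using G_pforms[of X a P 1] P pforms_cong[of a "a + 1 + 1"] by simp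

lemma G_P_wedge_\<omega>: "X \<in> pders A a \<Longrightarrow> G X P \<^bold>\<and> \<omega> = 0"
  using \<omega>_wedge_\<omega>[OF G_pforms[OF _ Q]] by (simp add: G_P wedge_ksign_left)

lemma lmult_P: "\<alpha> \<cdot> P = (\<alpha> \<^bold>\<and> \<omega>) \<cdot> Q"
  by (simp add: P_def lmult_simps)

lemma G_P_lmult_P: "X \<in> pders A a \<Longrightarrow> G X P \<cdot> P = 0"
  by (simp add: lmult_P G_P_wedge_\<omega> lmult_simps)

lemma G_P_wedge_P:
  assumes X: "X \<in> pders A a" and \<alpha>: "\<alpha> \<in> pforms A b"
  shows "(G X P \<^bold>\<and> \<alpha>) \<cdot> P = 0"
proof -
  have "\<alpha> \<^bold>\<and> \<omega> = ksign (b * 1) (\<omega> \<^bold>\<and> \<alpha>)" 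
    using \<alpha> \<omega> by (intro wedge_commute) (auto simp: pforms_iff)
  then have "(G X P \<^bold>\<and> \<alpha>) \<^bold>\<and> \<omega> = ksign b ((G X P \<^bold>\<and> \<omega>) \<^bold>\<and> \<alpha>)"
    by (simp add: wedge_assoc wedge_ksign_right)
  then show ?thesis by (simp add: lmult_P G_P_wedge_\<omega>[OF X] lmult_simps)
qed

lemma G_P_wedge_G_P:
  assumes X: "X \<in> pders A a" and Y: "Y \<in> pders A b"
  shows "G X P \<^bold>\<and> G Y P = 0"
proof -
  have "G X P \<^bold>\<and> G Y P = ksign b ((G X P \<^bold>\<and> \<omega>) \<^bold>\<and> G Y Q)"
    unfolding G_P[OF Y] by (simp add: wedge_ksign_right wedge_assoc)
  then show ?thesis by (simp add: G_P_wedge_\<omega>[OF X])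
qed

section \<open>The semi-symmetric connection on homogeneous arguments\<close>

lemma N'_eq:
  assumes X: "X \<in> pders A a" and Y: "Y \<in> pders A b"
  shows "N' X Y = N X Y + ksign (a * b) (G Y P \<cdot> X) - G X Y \<cdot> P"
  by (simp add: semi_symmetric_connection_def rmult_pders[OF X G_P_parity[OF Y]])

lemma N'_zero:
  assumes "X \<in> pders A a"
  shows "N' 0 X = 0" "N' X 0 = 0"
  using assms pders_ders[OF assms] pders_ders[OF P]
  by (simp_all add: N'_eq[OF assms pders_zero[of 0]] N'_eq[OF pders_zero[of 0] assms] connection_zero[OF N] metric_zero[OF G] lmult_simps)

lemma N'_add:
  assumes "X \<in> pders A a" "Y \<in> pders A b" "Z \<in> pders A b"
  shows "N' X (Y + Z) = N' X Y + N' X Z"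
  using assms[THEN pders_ders] pders_ders[OF P]
  by (simp add: N'_eq[OF assms(1,2)] N'_eq[OF assms(1,3)] N'_eq[OF assms(1) pders_add[OF assms(2,3)]]
      connectionD(3)[OF N] graded_metricD(2,3)[OF G] lmult_simps ksign_add)

lemma N'_uminus:
  assumes "X \<in> pders A a" "Y \<in> pders A b"
  shows "N' X (- Y) = - N' X Y"
  using N'_add[OF assms pders_uminus[OF assms(2)]] N'_zero[OF assms(1)]
  by (simp add: eq_neg_iff_add_eq_0 add.commute)

lemma N'_ksign:
  assumes "X \<in> pders A a" "Y \<in> pders A b"
  shows "N' X (ksign n Y) = ksign n (N' X Y)"
  using N'_uminus[OF assms] by (simp add: ksign_def)

lemma N'_lmult:
  assumes X: "X \<in> pders A a" and \<alpha>: "\<alpha> \<in> pforms A b" and Y: "Y \<in> pders A c"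
  shows "N' X (\<alpha> \<cdot> Y) = X \<alpha> \<cdot> Y + ksign (a * b) (\<alpha> \<cdot> N' X Y)"
proof -
  show ?thesis
    unfolding N'_eq[OF X pders_lmult[OF \<alpha> Y]] connectionD(4)[OF N \<alpha> X pders_ders[OF Y]]
      graded_metricD(5)[OF G \<alpha> Y P] graded_metricD(6)[OF G \<alpha> X Y] N'_eq[OF X Y]
    by (simp add: lmult_simps ksign_add ksign_diff distrib_left)
qed

text \<open>The two connections agree on P: the correction terms contain \<langle>P, P\<rangle> and
  \<langle>X, P\<rangle> P, each with \<omega> twice.\<close>

lemma N'_P:
  assumes X: "X \<in> pders A a"
  shows "N' X P = N X P"
proof -
  have "G P Q = \<omega> \<^bold>\<and> G Q Q" using graded_metricD(5)[OF G \<omega> Q Q] by (simp add: P_def)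
  then have "G P P = 0" using G_P[OF P] by (simp add: wedge_assoc[symmetric] \<omega>_square)
  then show ?thesis by (simp add: N'_eq[OF X P] G_P_lmult_P[OF X] lmult_simps)
qed

text \<open>The Leibniz rule is applied to each term of \<open>N' Y Z\<close>, and metric
  compatibility of \<open>N\<close> turns X applied to a pairing into pairings of covariant
  derivatives. The result is affine in P.\<close>

lemma N'_N':
  assumes X: "X \<in> pders A a" and Y: "Y \<in> pders A b" and Z: "Z \<in> pders A c"
  shows "N' X (N' Y Z) = N X (N Y Z) + ksign (a * (b + c)) (G (N Y Z) P \<cdot> X) - G X (N Y Z) \<cdot> P
    + ksign (b * c) ((G (N X Z) P + ksign (a * c) (G Z (N X P))) \<cdot> Y + ksign (a * c) (G Z P \<cdot> N X Y))
    - (G (N X Y) Z + ksign (a * b) (G Y (N X Z))) \<cdot> P - ksign (a * (b + c + 1)) (G Y Z \<cdot> N X P)"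
proof -
  have NYZ: "N Y Z \<in> pders A (b + c)" by (rule connectionD(1)[OF N Y Z])
  have \<theta>: "G Z P \<in> pforms A c" by (rule G_P_parity[OF Z])
  have GYZ: "G Y Z \<in> pforms A (b + c + 1)" by (rule G_pforms[OF Y Z])
  have t1: "G Z P \<cdot> Y \<in> pders A (b + c)" using pders_lmult[OF \<theta> Y] by (simp add: add.commute)
  have t2: "G Y Z \<cdot> P \<in> pders A (b + c)"
    using pders_lmult[OF GYZ P] pders_cong[of "b + c" "b + c + 1 + 1"] by simp
  \<comment> \<open>The Leibniz rule gives \<langle>Z, P\<rangle> times \<open>N' X Y\<close>; the
    two P-terms of the latter then contain \<omega> twice and vanish.\<close>
  have 1: "N' X (G Z P \<cdot> Y) = (G (N X Z) P + ksign (a * c) (G Z (N X P))) \<cdot> Y + ksign (a * c) (G Z P \<cdot> N X Y)"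
    unfolding N'_lmult[OF X \<theta> Y] N_metric[OF X Z pders_ders[OF P]] N'_eq[OF X Y]
    by (simp add: lmult_simps G_P_wedge_G_P[OF Z Y] G_P_wedge_P[OF Z G_pforms[OF X Y]])
  have 2: "N' X (G Y Z \<cdot> P) = (G (N X Y) Z + ksign (a * b) (G Y (N X Z))) \<cdot> P + ksign (a * (b + c + 1)) (G Y Z \<cdot> N X P)"
    unfolding N'_lmult[OF X GYZ P] N'_P[OF X] N_metric[OF X Y pders_ders[OF Z]] ..
  have 3: "N' X (N Y Z + ksign (b * c) (G Z P \<cdot> Y) + - (G Y Z \<cdot> P)) =
      N' X (N Y Z) + ksign (b * c) (N' X (G Z P \<cdot> Y)) - N' X (G Y Z \<cdot> P)"
    unfolding N'_add[OF X pders_add[OF NYZ pders_ksign[OF t1]] pders_uminus[OF t2]] N'_add[OF X NYZ pders_ksign[OF t1]]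
      N'_ksign[OF X t1] N'_uminus[OF X t2] by simp
  have 4: "N' Y Z = N Y Z + ksign (b * c) (G Z P \<cdot> Y) + - (G Y Z \<cdot> P)" by (simp add: N'_eq[OF Y Z])
  show ?thesis
    unfolding 4 3 1 2 N'_eq[OF X NYZ] by (simp only: diff_diff_eq)
qed

text \<open>The absent homogeneous part of X or Y is the zero derivation, so M is only asked to send
  the zero arguments that arise to 0.\<close>

lemma graded_curvature_pders:
  assumes X: "X \<in> pders A a" and Y: "Y \<in> pders A b"
    and M: "\<And>W V. W \<in> pders A a \<or> W \<in> pders A b \<Longrightarrow> M W 0 = (0 :: 'p der)" "M 0 (M X Z) = 0" "M 0 (M Y Z) = 0" "M 0 Z = 0"
  shows "graded_curvature A M X Y Z = M X (M Y Z) - ksign (a * b) (M Y (M X Z)) - M (gcommutator A X Y) Z"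
proof -
  have M0: "M X 0 = 0" "M Y 0 = 0" "M 0 0 = 0" using M(1) X Y pders_zero by blast+
  have "(\<Sum>a'<2. \<Sum>b'<2. M (dpart A a' X) (M (dpart A b' Y) Z) - ksign (a' * b') (M (dpart A b' Y) (M (dpart A a' X) Z)))
      = M X (M Y Z) - ksign (a * b) (M Y (M X Z))"
  proof (rule sum_parity[of a])
    fix a' assume a': "even (a + a')"
    show "(\<Sum>b'<2. M (dpart A a' X) (M (dpart A b' Y) Z) - ksign (a' * b') (M (dpart A b' Y) (M (dpart A a' X) Z)))
      = M X (M Y Z) - ksign (a * b) (M Y (M X Z))"
    proof (rule sum_parity[of b])
      fix b' assume "even (b + b')"
      then show "M (dpart A a' X) (M (dpart A b' Y) Z) - ksign (a' * b') (M (dpart A b' Y) (M (dpart A a' X) Z))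
          = M X (M Y Z) - ksign (a * b) (M Y (M X Z))"
        using a' by (auto simp: dpart_pders[OF X] dpart_pders[OF Y] ksign_def)
    qed (use a' in \<open>simp add: dpart_pders[OF X] dpart_pders[OF Y] M M0\<close>)
  next
    fix a' assume "odd (a + a')"
    then show "(\<Sum>b'<2. M (dpart A a' X) (M (dpart A b' Y) Z) - ksign (a' * b') (M (dpart A b' Y) (M (dpart A a' X) Z))) = 0"
      by (auto simp: sum_lessThan_2 dpart_pders[OF X] dpart_pders[OF Y] M M0)
  qed
  then show ?thesis by (simp add: graded_curvature_def)
qed

text \<open>Among the terms linear in P, those where \<open>N Y Z\<close> or \<open>N X Z\<close> is
  paired cancel between the two orders of differentiation. Those with \<open>N X Y\<close> or
  \<open>N Y X\<close> cancel against the commutator term by torsion freeness. Only the derivatives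
  of P itself remain.\<close>

lemma curvature_N':
  assumes X: "X \<in> pders A a" and Y: "Y \<in> pders A b" and Z: "Z \<in> pders A c"
  shows "graded_curvature A N' X Y Z =
      N X (N Y Z) - ksign (a * b) (N Y (N X Z)) - N (gcommutator A X Y) Z
    + ksign (b * c + a * c) (G Z (N X P) \<cdot> Y) - ksign (a * b + a * c + b * c) (G Z (N Y P) \<cdot> X)
    - ksign (a * (b + c + 1)) (G Y Z \<cdot> N X P) + ksign (a * b + b * (a + c + 1)) (G X Z \<cdot> N Y P)"
proof -
  let ?K = "gcommutator A X Y"
  have K: "?K \<in> pders A (a + b)" "?K = N X Y - ksign (a * b) (N Y X)"
    using gcommutator_parity[OF N_lc X Y] by auto
  have NXY: "N X Y \<in> pders A (a + b)" "N Y X \<in> pders A (a + b)"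
    using connectionD(1)[OF N X Y] connectionD(1)[OF N Y X] by (simp_all add: add.commute)
  have parity': "N' X Z \<in> pders A (a + c)" if X: "X \<in> pders A a" for X a
  proof -
    have "G Z P \<cdot> X \<in> pders A (a + c)" using pders_lmult[OF G_P_parity[OF Z] X] by (simp add: add.commute)
    moreover have "G X Z \<cdot> P \<in> pders A (a + c)"
      using pders_lmult[OF G_pforms[OF X Z] P] pders_cong[of "a + c" "a + c + 1 + 1"] by simp
    ultimately show ?thesis
      unfolding N'_eq[OF X Z] by (intro pders_diff pders_add pders_ksign connectionD(1)[OF N X Z])
  qed
  have "graded_curvature A N' X Y Z = N' X (N' Y Z) - ksign (a * b) (N' Y (N' X Z)) - N' ?K Z"
    by (rule graded_curvature_pders[OF X Y]) (use N'_zero parity'[OF X] parity'[OF Y] Z in blast)+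
  moreover have "N' ?K Z = N ?K Z + ksign ((a + b) * c) (G Z P \<cdot> (N X Y - ksign (a * b) (N Y X)))
      - (G (N X Y) Z - ksign (a * b) (G (N Y X) Z)) \<cdot> P"
    unfolding N'_eq[OF K(1) Z]
    \<comment> \<open>The commutator is expanded only in the correction terms; inside
      \<open>N\<close> it has to stay, as part of the curvature of \<open>N\<close>.\<close>
    by (subst (2 3) K(2)) (simp add: metric_diff(1)[OF G NXY(1) pders_ksign[OF NXY(2)] Z Z] metric_ksign[OF G NXY(2) Z])
  ultimately show ?thesis
    unfolding N'_N'[OF X Y Z] N'_N'[OF Y X Z]
    by (cases "even a"; cases "even b"; cases "even c") (simp_all add: ksign_def lmult_simps algebra_simps)
qed

end

section \<open>The Levi-Civita connection of the associated metric\<close>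

lemma diff_eq_minus_diff: "x + y = x' + y' \<Longrightarrow> x - x' = - (y - y')" for x :: "'a::ab_group_add"
  by (simp add: algebra_simps)

context manifold
begin

text \<open>These are the \<open>e\<^sub>n X\<close> and \<open>m\<^sub>n f\<close> of the introduction.\<close>

definition frame_der :: "nat \<Rightarrow> 'p vfield \<Rightarrow> 'p der" where
  "frame_der n X = (if n = 0 then L X else if n = 1 then i X else 0)"

definition frame_form :: "nat \<Rightarrow> ('p \<Rightarrow> real) \<Rightarrow> 'p form" where
  "frame_form n f = (if n = 0 then d0 f else if n = 1 then func_form f else 0)"

lemma frame_der_pders: "X \<in> V \<Longrightarrow> frame_der n X \<in> pders A n"
  by (simp add: frame_der_def lie_der_pders int_prod_pders pders_zero flip: One_nat_def)

lemma frame_form_add: "f \<in> C \<Longrightarrow> h \<in> C \<Longrightarrow> frame_form n (f + h) = frame_form n f + frame_form n h"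
  by (simp add: frame_form_def d0_add func_form_simps)

lemma int_prod_d0: "f \<in> C \<Longrightarrow> X \<in> V \<Longrightarrow> i X (d0 f) = func_form (vapp X f)"
  by (simp add: int_prod_eq d0_forms contr_d0)

lemma int_prod_func_form: "f \<in> C \<Longrightarrow> i X (func_form f) = 0"
  by (simp add: int_prod_eq func_form_forms)

text \<open>Adding indices encodes that Lie derivatives commute with d, that i_X df = X f, and that
  i_X f = 0, where the last has index 2.\<close>

lemma frame_der_apply:
  assumes "X \<in> V" "f \<in> C"
  shows "frame_der a X (frame_form b f) = frame_form (a + b) (vapp X f)"
  using assms lie_der_zero[OF assms(1)] pders_zero_arg[OF int_prod_pders[OF assms(1)]]
  by (auto simp: frame_der_def frame_form_def lie_der_d0 lie_der_func_form int_prod_d0 int_prod_func_form)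

lemma gcommutator_frame_der:
  assumes X: "X \<in> V" and Y: "Y \<in> V"
  shows "gcommutator A (frame_der a X) (frame_der b Y) = frame_der (a + b) (vbracket X Y)"
proof -
  have 0: "gcommutator A 0 D = 0" "gcommutator A D 0 = 0" if "D \<in> pders A n" for D n
    unfolding gcommutator_pders[OF pders_zero[of 0] that] gcommutator_pders[OF that pders_zero[of 0]]
    using pders_zero_arg[OF that] by (auto simp: fun_eq_iff)
  show ?thesis
    using 0[OF lie_der_pders] 0[OF int_prod_pders] 0[OF pders_zero[of 0]] X Y
    by (auto simp: frame_der_def gcommutator_lie_lie gcommutator_lie_int gcommutator_int_lie gcommutator_int_int)
qed

lemma lie_der_diff_field:
  assumes X: "X \<in> V" and Y: "Y \<in> V"
  shows "L (X - Y) = L X - L Y"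
proof
  fix \<omega>
  show "L (X - Y) \<omega> = (L X - L Y) \<omega>"
  proof (cases "\<omega> \<in> forms A")
    case True
    have "L (X - Y) \<omega> Xs = (L X \<omega> - L Y \<omega>) Xs" for Xs
    proof (cases "Xs \<in> lists V")
      case lists: True
      then show ?thesis using True
      proof (induction Xs arbitrary: \<omega>)
        case Nil
        then have "L (X - Y) \<omega> [] = (L X \<omega> - L Y \<omega>) []" by (simp add: lie_der_Nil vapp_diff_left)
        then show ?case .
      next
        case (Cons Z Zs)
        note XY = X Y vfields_diff[OF X Y] vfields_bracket
        have "vbracket X Z = vbracket (X - Y) Z + vbracket Y Z"
        proof (rule vfield_eqI)
          fix f show "vapp (vbracket X Z) f = vapp (vbracket (X - Y) Z + vbracket Y Z) f"
            using XY Cons.hyps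
            by (cases "f \<in> C") (simp_all add: vapp_bracket vapp_diff_left vapp_add_left vapp_diff vapp_smooth vapp_outside vapp_zero)
        qed
        then have "contr (vbracket X Z) \<omega> = contr (vbracket (X - Y) Z) \<omega> + contr (vbracket Y Z) \<omega>"
          using contr_add_field[OF Cons.prems, of "vbracket (X - Y) Z" "vbracket Y Z"] Cons.hyps XY by simp
        moreover have "L (X - Y) (contr Z \<omega>) Zs = (L X (contr Z \<omega>) - L Y (contr Z \<omega>)) Zs"
          using Cons.IH forms_contr[OF Cons.prems] Cons.hyps by blast
        ultimately have "contr Z (L (X - Y) \<omega>) Zs = (contr Z (L X \<omega>) - contr Z (L Y \<omega>)) Zs"
          using contr_lie_der[OF Cons.prems] Cons.hyps XY by simp
        then have "L (X - Y) \<omega> (Z # Zs) = (L X \<omega> - L Y \<omega>) (Z # Zs)" by (simp add: contr_def)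
        then show ?case .
      qed
    qed (simp add: lie_der_outside)
    then show ?thesis by (simp add: fun_eq_iff)
  qed (simp add: lie_der_not_form)
qed

lemma int_prod_diff_field: "X \<in> V \<Longrightarrow> Y \<in> V \<Longrightarrow> i (X - Y) = i X - i Y"
proof
  fix \<omega> assume XY: "X \<in> V" "Y \<in> V"
  show "i (X - Y) \<omega> = (i X - i Y) \<omega>"
  proof (cases "\<omega> \<in> forms A")
    case True
    then show ?thesis using contr_add_field[OF True vfields_diff[OF XY] XY(2)] by (simp add: int_prod_eq)
  qed (simp add: int_prod_def)
qed

lemma frame_der_diff: "X \<in> V \<Longrightarrow> Y \<in> V \<Longrightarrow> frame_der n (X - Y) = frame_der n X - frame_der n Y"
  by (simp add: frame_der_def lie_der_diff_field int_prod_diff_field)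

text \<open>The sign is \<open>- 1\<close> only if \<open>a\<close> and \<open>b\<close> are odd, and then both sides vanish.\<close>

lemma ksign_frame_der: "ksign (a * b) (frame_der (a + b + c) X) = frame_der (a + b + c) X"
  and ksign_frame_form: "ksign (a * b) (frame_form (a + b + c) f) = frame_form (a + b + c) f"
proof -
  have "odd (a * b) \<Longrightarrow> a + b + c \<ge> 2" by (cases a; cases b) auto
  then show "ksign (a * b) (frame_der (a + b + c) X) = frame_der (a + b + c) X"
    "ksign (a * b) (frame_form (a + b + c) f) = frame_form (a + b + c) f"
    by (auto simp: ksign_def frame_der_def frame_form_def)
qed

end

locale riemannian = manifold A
  for A :: "('p::{t2_space, second_countable_topology}, 'e::euclidean_space) atlas" +
  fixes g :: "'p \<Rightarrow> 'p tvec \<Rightarrow> 'p tvec \<Rightarrow> real" and nab :: "'p vfield \<Rightarrow> 'p vfield \<Rightarrow> 'p vfield"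
    and G :: "'p der \<Rightarrow> 'p der \<Rightarrow> 'p form" and N :: "'p der \<Rightarrow> 'p der \<Rightarrow> 'p der"
  assumes g: "riemannian_metric A g" and nab: "levi_civita A g nab"
    and assoc: "associated_graded_metric A g G" and N_lc: "graded_levi_civita A G N"
begin

abbreviation gf :: "'p vfield \<Rightarrow> 'p vfield \<Rightarrow> 'p \<Rightarrow> real" where
  "gf X Y \<equiv> (\<lambda>p. g p (X p) (Y p))"

lemma gf_smooth: "X \<in> V \<Longrightarrow> Y \<in> V \<Longrightarrow> gf X Y \<in> C"
  using g by (simp add: riemannian_metric_def)

lemma nab_closed: "X \<in> V \<Longrightarrow> Y \<in> V \<Longrightarrow> nab X Y \<in> V"
  and nab_torsion: "X \<in> V \<Longrightarrow> Y \<in> V \<Longrightarrow> nab X Y - nab Y X = vbracket X Y"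
  and nab_metric: "X \<in> V \<Longrightarrow> Y \<in> V \<Longrightarrow> Z \<in> V \<Longrightarrow> vapp X (gf Y Z) = gf (nab X Y) Z + gf Y (nab X Z)"
  using nab by (auto simp: levi_civita_def vapp_def fun_eq_iff)

lemma G: "graded_metric A G" and G_odd: "metric_parity A G 1"
  using assoc by (auto simp: associated_graded_metric_def)

lemma N: "graded_connection A N"
  using N_lc by (simp add: graded_levi_civita_def)

lemma G_frame:
  assumes X: "X \<in> V" and Y: "Y \<in> V"
  shows "G (frame_der a X) (frame_der b Y) = frame_form (a + b) (gf X Y)"
proof -
  have "G (L X) (L Y) = d0 (gf X Y)" "G (L X) (i Y) = func_form (gf X Y)" "G (i X) (L Y) = func_form (gf X Y)" "G (i X) (i Y) = 0"
    using assoc X Y ext_deriv_func_form[OF gf_smooth[OF X Y]]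
    by (auto simp: associated_graded_metric_def metric_form_def)
  then show ?thesis
    using metric_zero[OF G pders_ders[OF frame_der_pders[OF X]], of a] metric_zero[OF G pders_ders[OF frame_der_pders[OF Y]], of b]
    by (auto simp: frame_der_def frame_form_def)
qed

lemma N_metric: "X \<in> pders A a \<Longrightarrow> Y \<in> pders A b \<Longrightarrow> Z \<in> ders A \<Longrightarrow>
    X (G Y Z) = G (N X Y) Z + ksign (a * b) (G Y (N X Z))"
  using N_lc unfolding graded_levi_civita_def by blast

text \<open>Koszul's argument: the defect \<open>G (S X Y) Z\<close> of the claimed connection is symmetric in
  \<open>X\<close>, \<open>Y\<close> and skew in \<open>Y\<close>, \<open>Z\<close> (in the graded sense), hence zero.\<close>

lemma N_frame:
  assumes X: "X \<in> V" and Y: "Y \<in> V"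
  shows "N (frame_der a X) (frame_der b Y) = frame_der (a + b) (nab X Y)"
proof -
  define S where "S = (\<lambda>a b X Y. N (frame_der a X) (frame_der b Y) - frame_der (a + b) (nab X Y))"
  define T where "T = (\<lambda>a b c X Y Z. G (S a b X Y) (frame_der c Z))"
  note e = frame_der_pders
  have N_pders: "N (frame_der a X) (frame_der b Y) \<in> pders A (a + b)" if "X \<in> V" "Y \<in> V" for a b X Y
    using that by (intro connectionD(1)[OF N] e)
  have S: "S a b X Y \<in> pders A (a + b)" if "X \<in> V" "Y \<in> V" for a b X Y
    unfolding S_def using that by (intro pders_diff N_pders e nab_closed)
  have S_sym: "S a b X Y = ksign (a * b) (S b a Y X)" if XY: "X \<in> V" "Y \<in> V" for a b X Y
  proof -
    have "N (frame_der a X) (frame_der b Y) - ksign (a * b) (N (frame_der b Y) (frame_der a X))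
        = frame_der (a + b) (nab X Y - nab Y X)"
      using gcommutator_parity(2)[OF N_lc e[OF XY(1)] e[OF XY(2)], of a b] gcommutator_frame_der[OF XY, of a b]
      by (simp add: nab_torsion[OF XY])
    also have "\<dots> = frame_der (a + b) (nab X Y) - ksign (a * b) (frame_der (b + a) (nab Y X))"
      using ksign_frame_der[of a b 0 "nab Y X"] XY by (simp add: frame_der_diff nab_closed add.commute)
    finally show ?thesis by (simp add: S_def ksign_diff algebra_simps)
  qed
  have T_sym: "T a b c X Y Z = ksign (a * b) (T b a c Y X Z)" if "X \<in> V" "Y \<in> V" "Z \<in> V" for a b c X Y Z
    unfolding T_def S_sym[OF that(1,2), of a b] by (rule metric_ksign(1)[OF G S e]) (use that in auto)
  have T_skew: "T a b c X Y Z = - ksign (b * c) (T a c b X Z Y)" if XYZ: "X \<in> V" "Y \<in> V" "Z \<in> V" for a b c X Y Z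
  proof -
    let ?X = "frame_der a X" and ?Y = "frame_der b Y" and ?Z = "frame_der c Z"
    \<comment> \<open>The claimed connection is metric as well, because the Riemannian one is;
      comparing it with the metric condition for \<open>N\<close> makes the defect skew.\<close>
    have "frame_der a X (G ?Y ?Z) = frame_form (a + b + c) (gf (nab X Y) Z) + frame_form (a + b + c) (gf Y (nab X Z))"
      using XYZ by (simp add: G_frame frame_der_apply gf_smooth nab_metric frame_form_add nab_closed add.assoc)
    \<comment> \<open>The Koszul sign can be inserted freely by
      \<open>ksign_frame_form\<close>.\<close>
    also have "frame_form (a + b + c) (gf Y (nab X Z)) = ksign (a * b) (G ?Y (frame_der (a + c) (nab X Z)))"
      using XYZ ksign_frame_form[of a b c "gf Y (nab X Z)"] by (simp add: G_frame nab_closed add_ac)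
    also have "frame_form (a + b + c) (gf (nab X Y) Z) = G (frame_der (a + b) (nab X Y)) ?Z"
      using XYZ by (simp add: G_frame nab_closed)
    finally have eq: "frame_der a X (G ?Y ?Z) = G (frame_der (a + b) (nab X Y)) ?Z
        + ksign (a * b) (G ?Y (frame_der (a + c) (nab X Z)))" .
    have "G (N ?X ?Y) ?Z - G (frame_der (a + b) (nab X Y)) ?Z
        = - (ksign (a * b) (G ?Y (N ?X ?Z)) - ksign (a * b) (G ?Y (frame_der (a + c) (nab X Z))))"
      by (rule diff_eq_minus_diff)
        (rule trans[OF N_metric[OF e[OF XYZ(1)] e[OF XYZ(2)] pders_ders[OF e[OF XYZ(3)]], symmetric] eq])
    then have "T a b c X Y Z = - ksign (a * b) (G ?Y (S a c X Z))"
      unfolding T_def S_def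
      using metric_diff(1)[OF G N_pders[OF XYZ(1,2)] e[OF nab_closed[OF XYZ(1,2)]] e[OF XYZ(3)] e[OF XYZ(3)], of a b c]
        metric_diff(2)[OF G e[OF XYZ(2)] e[OF XYZ(2)] N_pders[OF XYZ(1,3)] e[OF nab_closed[OF XYZ(1,3)]], of b a c]
      by (simp add: ksign_diff)
    also have "G ?Y (S a c X Z) = ksign (b * (a + c)) (T a c b X Z Y)"
      unfolding T_def by (rule graded_metricD(4)[OF G e[OF XYZ(2)] S[OF XYZ(1,3)]])
    also have "- ksign (a * b) (ksign (b * (a + c)) (T a c b X Z Y)) = - ksign (b * c) (T a c b X Z Y)"
      by (simp add: ksign_def)
    finally show ?thesis .
  qed
  have T0: "T a b c X Y Z = 0" if XYZ: "X \<in> V" "Y \<in> V" "Z \<in> V" for c Z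
  proof -
    \<comment> \<open>Six exchanges, alternately of the first and of the last two entries, return to
      the original order. Each graded sign occurs twice and cancels; the three skew exchanges leave
      a factor -1.\<close>
    have "T a b c X Y Z = ksign (a * b) (T b a c Y X Z)" using XYZ by (intro T_sym)
    also have "T b a c Y X Z = - ksign (a * c) (T b c a Y Z X)" using XYZ by (intro T_skew)
    also have "T b c a Y Z X = ksign (b * c) (T c b a Z Y X)" using XYZ by (intro T_sym)
    also have "T c b a Z Y X = - ksign (b * a) (T c a b Z X Y)" using XYZ by (intro T_skew)
    also have "T c a b Z X Y = ksign (c * a) (T a c b X Z Y)" using XYZ by (intro T_sym)
    also have "T a c b X Z Y = - ksign (c * b) (T a b c X Y Z)" using XYZ by (intro T_skew)
    also have "ksign (a * b) (- ksign (a * c) (ksign (b * c) (- ksign (b * a) (ksign (c * a) (- ksign (c * b) W))))) = - W"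
      for W :: "'p form"
      by (cases "even a"; cases "even b"; cases "even c") (simp_all add: ksign_def)
    finally have "T a b c X Y Z = - T a b c X Y Z" .
    then show ?thesis by (auto simp: fun_eq_iff)
  qed
  have G0: "G (frame_der c Z) (S a b X Y) = 0" if "Z \<in> V" for c Z
    using T0[OF X Y that, of c] graded_metricD(4)[OF G e[OF that] S[OF X Y], of c a b] by (simp add: T_def)
  have "S a b X Y = 0"
    by (rule metric_nondegenerate_lie_int[OF G S[OF X Y]]) (use G0[of _ 0] G0[of _ 1] in \<open>simp_all add: frame_der_def\<close>)
  then show ?thesis by (simp add: S_def)
qed

section \<open>Curvature for P = \<omega> L_U\<close>

context
  fixes U :: "'p vfield" and \<omega> :: "'p form"
  assumes U: "U \<in> V" and \<omega>: "\<omega> \<in> pforms A 1"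
begin

interpretation semi_symmetric A G N \<omega> "L U"
  by unfold_locales (use G G_odd N_lc \<omega> lie_der_pders[OF U] in auto)

lemma N_frame_P:
  assumes X: "X \<in> V"
  shows "N (frame_der a X) P = frame_der a X \<omega> \<cdot> L U + ksign a (\<omega> \<cdot> frame_der a (nab X U))"
  using connectionD(4)[OF N \<omega> frame_der_pders[OF X] pders_ders[OF lie_der_pders[OF U]], of a] N_frame[OF X U, of a 0]
  by (simp add: P_def frame_der_def[of 0])

lemma G_N_frame_P:
  assumes X: "X \<in> V" and Z: "Z \<in> V"
  shows "G (frame_der c Z) (N (frame_der a X) P) = ksign (c * (a + 1)) (frame_der a X \<omega> \<^bold>\<and> frame_form c (gf Z U))
    + ksign (a + c) (\<omega> \<^bold>\<and> frame_form (c + a) (gf Z (nab X U)))"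
proof -
  note e = frame_der_pders
  have L: "frame_der 0 U = L U" by (simp add: frame_der_def)
  have X\<omega>: "frame_der a X \<omega> \<in> pforms A (a + 1)" by (rule pders_pforms[OF e[OF X] \<omega>])
  have 1: "frame_der a X \<omega> \<cdot> L U \<in> pders A (a + 1)" using pders_lmult[OF X\<omega> lie_der_pders[OF U]] by simp
  have 2: "\<omega> \<cdot> frame_der a (nab X U) \<in> pders A (a + 1)"
    using pders_lmult[OF \<omega> e[OF nab_closed[OF X U]], of a] by (simp add: add.commute)
  have 3: "G (frame_der c Z) (ksign a (\<omega> \<cdot> frame_der a (nab X U))) =
      ksign (a + c) (\<omega> \<^bold>\<and> frame_form (c + a) (gf Z (nab X U)))"
    using graded_metricD(6)[OF G \<omega> e[OF Z] e[OF nab_closed[OF X U]], of c a]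
    by (simp add: metric_ksign(2)[OF G e[OF Z] 2] G_frame[OF Z nab_closed[OF X U]])
  show ?thesis
    unfolding N_frame_P[OF X] 3
      graded_metricD(3)[OF G pders_ders[OF e[OF Z]] pders_ders[OF 1] pders_ders[OF pders_ksign[OF 2]]]
      graded_metricD(6)[OF G X\<omega> e[OF Z] lie_der_pders[OF U]]
    using G_frame[OF Z U, of c 0] by (simp add: L)
qed

text \<open>The signs are kept as unreduced exponents in a, b, c: one formula holds for all indices,
  and substituting 0 and 1 evaluates them.\<close>

lemma curvature_frame:
  assumes X: "X \<in> V" and Y: "Y \<in> V" and Z: "Z \<in> V"
  shows "graded_curvature A (semi_symmetric_connection A G N (\<omega> \<cdot> L U)) (frame_der a X) (frame_der b Y) (frame_der c Z) =
      frame_der (a + b + c) (curvature nab X Y Z)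
    + ksign (b * c + a * c) ((ksign (c * (a + 1)) (frame_der a X \<omega> \<^bold>\<and> frame_form c (gf Z U))
        + ksign (a + c) (\<omega> \<^bold>\<and> frame_form (c + a) (gf Z (nab X U)))) \<cdot> frame_der b Y)
    - ksign (a * b + a * c + b * c) ((ksign (c * (b + 1)) (frame_der b Y \<omega> \<^bold>\<and> frame_form c (gf Z U))
        + ksign (b + c) (\<omega> \<^bold>\<and> frame_form (c + b) (gf Z (nab Y U)))) \<cdot> frame_der a X)
    - ksign (a * (b + c + 1)) (frame_form (b + c) (gf Y Z) \<cdot> (frame_der a X \<omega> \<cdot> L U + ksign a (\<omega> \<cdot> frame_der a (nab X U))))
    + ksign (a * b + b * (a + c + 1)) (frame_form (a + c) (gf X Z) \<cdot> (frame_der b Y \<omega> \<cdot> L U + ksign b (\<omega> \<cdot> frame_der b (nab Y U))))"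
proof -
  note e = frame_der_pders
  have "N (frame_der a X) (N (frame_der b Y) (frame_der c Z))
      - ksign (a * b) (N (frame_der b Y) (N (frame_der a X) (frame_der c Z)))
      - N (gcommutator A (frame_der a X) (frame_der b Y)) (frame_der c Z)
      = frame_der (a + b + c) (nab X (nab Y Z)) - ksign (a * b) (frame_der (a + b + c) (nab Y (nab X Z)))
        - frame_der (a + b + c) (nab (vbracket X Y) Z)"
    using X Y Z by (simp add: N_frame gcommutator_frame_der nab_closed vfields_bracket add_ac)
  also have "\<dots> = frame_der (a + b + c) (curvature nab X Y Z)"
    using X Y Z by (simp add: ksign_frame_der curvature_def frame_der_diff nab_closed vfields_bracket vfields_diff)
  finally have R: "N (frame_der a X) (N (frame_der b Y) (frame_der c Z))
      - ksign (a * b) (N (frame_der b Y) (N (frame_der a X) (frame_der c Z)))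
      - N (gcommutator A (frame_der a X) (frame_der b Y)) (frame_der c Z) = frame_der (a + b + c) (curvature nab X Y Z)" .
  show ?thesis
    using curvature_N'[OF e[OF X] e[OF Y] e[OF Z], of a b c]
    unfolding R P_def[symmetric] N_frame_P[OF X, symmetric] N_frame_P[OF Y, symmetric] G_N_frame_P[OF X Z, symmetric]
      G_N_frame_P[OF Y Z, symmetric] G_frame[OF Y Z] G_frame[OF X Z] .
qed

end

end

section \<open>The six curvature formulas\<close>

theorem proposition2p15:
  fixes A :: "('p::{t2_space, second_countable_topology}, 'e::euclidean_space) atlas"
    and g :: "'p \<Rightarrow> 'p tvec \<Rightarrow> 'p tvec \<Rightarrow> real"
    and nab :: "'p vfield \<Rightarrow> 'p vfield \<Rightarrow> 'p vfield"
    and G :: "'p der \<Rightarrow> 'p der \<Rightarrow> 'p form"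
    and nabL :: "'p der \<Rightarrow> 'p der \<Rightarrow> 'p der"
    and U X Y Z :: "'p vfield" and \<omega> :: "'p form"
  defines "L \<equiv> lie_der A" and "i \<equiv> int_prod A" and "d \<equiv> ext_deriv A"
    and "h \<equiv> metric_form g" and "R \<equiv> curvature nab"
    and "R' \<equiv> graded_curvature A (semi_symmetric_connection A G nabL (\<omega> \<cdot> lie_der A U))"
  assumes "smooth_manifold A"
    and "riemannian_metric A g"
    and "levi_civita A g nab"
    and "associated_graded_metric A g G"
    and "graded_levi_civita A G nabL"
    and "U \<in> vfields A" and "\<omega> \<in> pforms A 1"
    and "X \<in> vfields A" and "Y \<in> vfields A" and "Z \<in> vfields A"
  shows
    "R' (L X) (L Y) (L Z) =
        L (R X Y Z) + L X \<omega> \<^bold>\<and> d (h Z U) \<cdot> L Y + \<omega> \<^bold>\<and> d (h Z (nab X U)) \<cdot> L Y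
      - L Y \<omega> \<^bold>\<and> d (h Z U) \<cdot> L X - \<omega> \<^bold>\<and> d (h Z (nab Y U)) \<cdot> L X - d (h Y Z) \<^bold>\<and> L X \<omega> \<cdot> L U
      - d (h Y Z) \<^bold>\<and> \<omega> \<cdot> L (nab X U) + d (h X Z) \<^bold>\<and> L Y \<omega> \<cdot> L U + d (h X Z) \<^bold>\<and> \<omega> \<cdot> L (nab Y U)
     \<and>
     R' (L X) (L Y) (i Z) =
        i (R X Y Z) - L X \<omega> \<^bold>\<and> h Z U \<cdot> L Y - \<omega> \<^bold>\<and> h Z (nab X U) \<cdot> L Y
      + L Y \<omega> \<^bold>\<and> h Z U \<cdot> L X + \<omega> \<^bold>\<and> h Z (nab Y U) \<cdot> L X - h Y Z \<^bold>\<and> L X \<omega> \<cdot> L U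
      - h Y Z \<^bold>\<and> \<omega> \<cdot> L (nab X U) + h X Z \<^bold>\<and> L Y \<omega> \<cdot> L U + h X Z \<^bold>\<and> \<omega> \<cdot> L (nab Y U)
     \<and>
     R' (L X) (i Y) (L Z) =
        i (R X Y Z) + L X \<omega> \<^bold>\<and> d (h Z U) \<cdot> i Y + \<omega> \<^bold>\<and> d (h Z (nab X U)) \<cdot> i Y
      - i Y \<omega> \<^bold>\<and> d (h Z U) \<cdot> L X + \<omega> \<^bold>\<and> h Z (nab Y U) \<cdot> L X - h Y Z \<^bold>\<and> L X \<omega> \<cdot> L U
      - h Y Z \<^bold>\<and> \<omega> \<cdot> L (nab X U) - d (h X Z) \<^bold>\<and> i Y \<omega> \<cdot> L U + d (h X Z) \<^bold>\<and> \<omega> \<cdot> i (nab Y U)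
     \<and>
     R' (L X) (i Y) (i Z) =
        L X \<omega> \<^bold>\<and> h Z U \<cdot> i Y + \<omega> \<^bold>\<and> h Z (nab X U) \<cdot> i Y + i Y \<omega> \<^bold>\<and> h Z U \<cdot> L X
      + h X Z \<^bold>\<and> i Y \<omega> \<cdot> L U - h X Z \<^bold>\<and> \<omega> \<cdot> i (nab Y U)
     \<and>
     R' (i X) (i Y) (L Z) =
        i X \<omega> \<^bold>\<and> d (h Z U) \<cdot> i Y - \<omega> \<^bold>\<and> h Z (nab X U) \<cdot> i Y + i Y \<omega> \<^bold>\<and> d (h Z U) \<cdot> i X
      - \<omega> \<^bold>\<and> h Z (nab Y U) \<cdot> i X - h Y Z \<^bold>\<and> i X \<omega> \<cdot> L U + h Y Z \<^bold>\<and> \<omega> \<cdot> i (nab X U)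
      - h X Z \<^bold>\<and> i Y \<omega> \<cdot> L U + h X Z \<^bold>\<and> \<omega> \<cdot> i (nab Y U)
     \<and>
     R' (i X) (i Y) (i Z) = i X \<omega> \<^bold>\<and> h Z U \<cdot> i Y + i Y \<omega> \<^bold>\<and> h Z U \<cdot> i X"
proof -
  interpret riemannian A g nab G nabL
    by (unfold_locales; fact)
  note V = \<open>U \<in> vfields A\<close> \<open>X \<in> vfields A\<close> \<open>Y \<in> vfields A\<close> \<open>Z \<in> vfields A\<close>
  have d: "d (func_form (gf X Y)) = d0 (gf X Y)" if "X \<in> vfields A" "Y \<in> vfields A" for X Y
    using ext_deriv_func_form[OF gf_smooth[OF that]] by (simp add: d_def)
  have h: "h X Y = func_form (gf X Y)" for X Y
    by (simp add: h_def metric_form_def)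
  have e: "L = frame_der 0" "i = frame_der (Suc 0)"
    by (auto simp: L_def i_def frame_der_def)
  note R' = curvature_frame[OF \<open>U \<in> vfields A\<close> \<open>\<omega> \<in> pforms A 1\<close> V(2,3,4), folded R'_def R_def]
  \<comment> \<open>Index sums of 2 or more give 0. For instance, with all three indices 1 this
    removes the Riemannian curvature, the pairings of X and Y with Z, and the terms with covariant
    derivatives of U.\<close>
  have ff: "frame_form 0 = d0" "frame_form (Suc 0) = func_form" "frame_form (Suc (Suc n)) = (\<lambda>f. 0)" for n
    by (auto simp: frame_form_def)
  have f2: "frame_der (Suc (Suc n)) = (\<lambda>X. 0)" for n
    by (auto simp: frame_der_def)
  show ?thesis
    using R'[of 0 0 0] R'[of 0 0 1] R'[of 0 1 0] R'[of 0 1 1] R'[of 1 1 0] R'[of 1 1 1]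
    by (simp add: d V nab_closed e h ff f2 lmult_simps L_def[symmetric] algebra_simps)
qed

end
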